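(* Let $\Omega\subset\mathbb{R}^N$ be a bounded strictly convex domain having an interior tangent ball at every point of $\partial\Omega$, and $j\in\{1,\dots,N\}$. Let $g$ be such that the viscosity solution $z$ of $\lambda_j(D^2z)=0$ in $\Omega$, $z=g$ on $\partial\Omega$, belongs to $C^1(\overline\Omega)$, and let $u_0\in C^1(\overline\Omega)$ with $u_0|_{\partial\Omega}=g$. Let $\mu_1>0$, $\psi_1$, $\varphi_1=-\psi_1$ be as follows: $\psi_1\in C(\overline\Omega)$, $\psi_1>0$ in $\Omega$, $\psi_1=0$ on $\partial\Omega$, $-\lambda_N(D^2\psi_1)=\mu_1\psi_1$ in $\Omega$ (so $-\lambda_1(D^2\varphi_1)=\mu_1\varphi_1$). Let $u$ be the viscosity solution of $u_t-\lambda_j(D^2u)=0$ in $\Omega\times(0,\infty)$, $u=g$ on $\partial\Omega\times(0,\infty)$, $u(\cdot,0)=u_0$. Then there exist constants $C_1,C_2>0$ depending on $u_0$ such that for all $x\in\Omega$, $t>0$, \[ z(x)+C_1e^{-\mu_1t}\varphi_1(x)\le u(x,t)\le z(x)+C_2e^{-\mu_1t}\psi_1(x). \]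
   Context: $\lambda_j(A)$ is the $j$-th smallest eigenvalue of a symmetric matrix $A$, $\lambda_j(A)=\inf_{\dim S=j}\sup_{v\in S,|v|=1}\langle Av,v\rangle$. All equations are in the viscosity sense, solutions continuous up to the boundary. *)

theory Defs
  imports "HOL-Analysis.Analysis"
begin

text \<open>j-th smallest eigenvalue via the Courant-Fischer min-max formula:
  lambda_j(A) = inf over j-dimensional subspaces S of sup over unit v in S of <Av,v>.\<close>
definition eigval :: "nat \<Rightarrow> real^'n^'n \<Rightarrow> real" where
  "eigval j A = Inf { Sup { (A *v v) \<bullet> v | v. v \<in> S \<and> norm v = 1 } | S.
                       subspace S \<and> dim S = j }"

definition domain :: "(real^'n) set \<Rightarrow> bool" where
  "domain \<Omega> \<longleftrightarrow> open \<Omega> \<and> connected \<Omega> \<and> \<Omega> \<noteq> {}"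

definition strictly_convex_set :: "(real^'n) set \<Rightarrow> bool" where
  "strictly_convex_set \<Omega> \<longleftrightarrow>
     (\<forall>x\<in>closure \<Omega>. \<forall>y\<in>closure \<Omega>. \<forall>t::real. x \<noteq> y \<and> 0 < t \<and> t < 1
        \<longrightarrow> (1 - t) *\<^sub>R x + t *\<^sub>R y \<in> \<Omega>)"

definition interior_ball_condition :: "(real^'n) set \<Rightarrow> bool" where
  "interior_ball_condition \<Omega> \<longleftrightarrow>
     (\<forall>x\<in>frontier \<Omega>. \<exists>c r. r > 0 \<and> ball c r \<subseteq> \<Omega> \<and> dist c x = r)"

definition C1_closure :: "(real^'n) set \<Rightarrow> (real^'n \<Rightarrow> real) \<Rightarrow> bool" where
  "C1_closure \<Omega> f \<longleftrightarrow> continuous_on (closure \<Omega>) f \<and>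
     (\<exists>Df. continuous_on (closure \<Omega>) Df \<and>
        (\<forall>x\<in>\<Omega>. (f has_derivative (\<lambda>h. Df x \<bullet> h)) (at x)))"

definition C2_test :: "(real^'n) set \<Rightarrow> (real^'n \<Rightarrow> real) \<Rightarrow> (real^'n \<Rightarrow> real^'n)
                       \<Rightarrow> (real^'n \<Rightarrow> real^'n^'n) \<Rightarrow> bool" where
  "C2_test U p Dp Hp \<longleftrightarrow> open U \<and>
     (\<forall>x\<in>U. (p has_derivative (\<lambda>h. Dp x \<bullet> h)) (at x)) \<and>
     (\<forall>x\<in>U. (Dp has_derivative (\<lambda>h. Hp x *v h)) (at x)) \<and>
     continuous_on U Hp"

definition visc_sub :: "(real^'n) set \<Rightarrow> (real^'n \<Rightarrow> real \<Rightarrow> real^'n \<Rightarrow> real^'n^'n \<Rightarrow> real)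
                        \<Rightarrow> (real^'n \<Rightarrow> real) \<Rightarrow> bool" where
  "visc_sub \<Omega> F u \<longleftrightarrow> continuous_on \<Omega> u \<and>
     (\<forall>x0\<in>\<Omega>. \<forall>U p Dp Hp. C2_test U p Dp Hp \<and> x0 \<in> U \<and>
        (\<exists>e>0. \<forall>y\<in>ball x0 e. u y - p y \<le> u x0 - p x0)
        \<longrightarrow> F x0 (u x0) (Dp x0) (Hp x0) \<le> 0)"

definition visc_super :: "(real^'n) set \<Rightarrow> (real^'n \<Rightarrow> real \<Rightarrow> real^'n \<Rightarrow> real^'n^'n \<Rightarrow> real)
                        \<Rightarrow> (real^'n \<Rightarrow> real) \<Rightarrow> bool" where
  "visc_super \<Omega> F u \<longleftrightarrow> continuous_on \<Omega> u \<and>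
     (\<forall>x0\<in>\<Omega>. \<forall>U p Dp Hp. C2_test U p Dp Hp \<and> x0 \<in> U \<and>
        (\<exists>e>0. \<forall>y\<in>ball x0 e. u y - p y \<ge> u x0 - p x0)
        \<longrightarrow> F x0 (u x0) (Dp x0) (Hp x0) \<ge> 0)"

definition visc_sol where
  "visc_sol \<Omega> F u \<longleftrightarrow> visc_sub \<Omega> F u \<and> visc_super \<Omega> F u"

definition C21_test :: "((real^'n) \<times> real) set \<Rightarrow> (real^'n \<Rightarrow> real \<Rightarrow> real)
     \<Rightarrow> (real^'n \<Rightarrow> real \<Rightarrow> real^'n) \<Rightarrow> (real^'n \<Rightarrow> real \<Rightarrow> real^'n^'n)
     \<Rightarrow> (real^'n \<Rightarrow> real \<Rightarrow> real) \<Rightarrow> bool" where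
  "C21_test U p Dp Hp Tp \<longleftrightarrow> open U \<and>
     (\<forall>(x,t)\<in>U. ((\<lambda>y. p y t) has_derivative (\<lambda>h. Dp x t \<bullet> h)) (at x)) \<and>
     (\<forall>(x,t)\<in>U. ((\<lambda>y. Dp y t) has_derivative (\<lambda>h. Hp x t *v h)) (at x)) \<and>
     (\<forall>(x,t)\<in>U. ((\<lambda>s. p x s) has_real_derivative Tp x t) (at t)) \<and>
     continuous_on U (\<lambda>(x,t). p x t) \<and> continuous_on U (\<lambda>(x,t). Dp x t) \<and>
     continuous_on U (\<lambda>(x,t). Hp x t) \<and> continuous_on U (\<lambda>(x,t). Tp x t)"

definition pvisc_sub :: "(real^'n) set \<Rightarrow> (real^'n \<Rightarrow> real \<Rightarrow> real \<Rightarrow> real \<Rightarrow> real^'n \<Rightarrow> real^'n^'n \<Rightarrow> real)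
                         \<Rightarrow> (real^'n \<Rightarrow> real \<Rightarrow> real) \<Rightarrow> bool" where
  "pvisc_sub \<Omega> G u \<longleftrightarrow> continuous_on (\<Omega> \<times> {0<..}) (\<lambda>(x,t). u x t) \<and>
     (\<forall>x0\<in>\<Omega>. \<forall>t0>0. \<forall>U p Dp Hp Tp. C21_test U p Dp Hp Tp \<and> (x0,t0) \<in> U \<and>
        (\<exists>e>0. \<forall>y s. dist y x0 < e \<and> \<bar>s - t0\<bar> < e \<longrightarrow> u y s - p y s \<le> u x0 t0 - p x0 t0)
        \<longrightarrow> G x0 t0 (u x0 t0) (Tp x0 t0) (Dp x0 t0) (Hp x0 t0) \<le> 0)"

definition pvisc_super :: "(real^'n) set \<Rightarrow> (real^'n \<Rightarrow> real \<Rightarrow> real \<Rightarrow> real \<Rightarrow> real^'n \<Rightarrow> real^'n^'n \<Rightarrow> real)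
                         \<Rightarrow> (real^'n \<Rightarrow> real \<Rightarrow> real) \<Rightarrow> bool" where
  "pvisc_super \<Omega> G u \<longleftrightarrow> continuous_on (\<Omega> \<times> {0<..}) (\<lambda>(x,t). u x t) \<and>
     (\<forall>x0\<in>\<Omega>. \<forall>t0>0. \<forall>U p Dp Hp Tp. C21_test U p Dp Hp Tp \<and> (x0,t0) \<in> U \<and>
        (\<exists>e>0. \<forall>y s. dist y x0 < e \<and> \<bar>s - t0\<bar> < e \<longrightarrow> u y s - p y s \<ge> u x0 t0 - p x0 t0)
        \<longrightarrow> G x0 t0 (u x0 t0) (Tp x0 t0) (Dp x0 t0) (Hp x0 t0) \<ge> 0)"

definition pvisc_sol where
  "pvisc_sol \<Omega> G u \<longleftrightarrow> pvisc_sub \<Omega> G u \<and> pvisc_super \<Omega> G u"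

end

theory Submission
  imports Defs "HOL-Complex_Analysis.Great_Picard"
begin

text \<open>
  Since \<open>\<psi>1\<close> is a supersolution of \<open>- \<lambda>\<^sub>N(D\<^sup>2\<psi>) = \<mu>1 \<psi>\<close>, it is concave, and near \<open>x\<close> it lies below a
  paraboloid of opening \<open>c\<close> for every \<open>c < \<mu>1 \<psi>1(x) / 2\<close>. Replacing \<open>\<psi>1\<close> by that paraboloid in a test
  shows that \<open>z + C exp(- \<mu>1 t) \<psi>1\<close> is a viscosity supersolution of the evolution equation, and
  \<open>z - C exp(- \<mu>1 t) \<psi>1\<close> a subsolution. Concavity also gives linear growth of \<open>\<psi>1\<close> off the boundary,
  so the initial data, which are Lipschitz and agree with \<open>z\<close> on the boundary, are ordered for large
  \<open>C\<close>. It remains to compare.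

  The comparison principle needs semijets of two continuous functions at an interior maximum of their
  sum. After sup-convolution the sum is touched from above by affine functions on a set \<open>E\<close> of positive
  measure, where both gradients are Lipschitz (Jensen's lemma). Instead of Alexandrov's theorem, a
  weak form of Rademacher's theorem is enough: for Lipschitz \<open>f\<close> with bounded support and
  \<open>I(h) = \<integral>|f(x + h) - f(x)|\<^sup>2 dx\<close>, the parallelogram law gives
  \<open>I(2h) = 4 I(h) - \<integral>|f(x + 2h) - 2 f(x + h) + f(x)|\<^sup>2 dx\<close>. The sum over the scales \<open>2\<^sup>-\<^sup>k h\<close> telescopes, so
  second differences at scale \<open>2\<^sup>-\<^sup>k\<close> are \<open>o(2\<^sup>-\<^sup>k)\<close> almost everywhere, and every blow-up limit along the
  dyadic scales is linear.
\<close>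

section \<open>Blow-ups of Lipschitz functions along dyadic scales\<close>

text \<open>The obstacle is that \<open>u\<close> and the barrier are merely continuous, so at a
  maximum of their difference neither need have derivatives. Tilted maxima of the sup-convolved sum
  fill a set of positive measure, which leaves room for an almost-everywhere statement. Blow-up
  limits are obtained only along a subsequence, and two functions need not share it; hence the pair
  of gradients is blown up as one map. A subsequence is enough: an expansion at a single small
  radius, with a small multiple of the identity added to the Hessian, already yields a genuine
  semijet nearby. The two semijets sit at different points. This is harmless, since the operator
  depends on the Hessian alone and every term in \<open>\<psi>1\<close> is evaluated at the point of
  the barrier, where the decay rate makes these terms cancel. The comparison is carried out for an
  abstract degenerate elliptic operator, so that the lower bound is the upper bound for
  \<open>- u\<close>.\<close>

lemma integrable_bounded_support:
  fixes f :: "'a::euclidean_space \<Rightarrow> real"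
  assumes "continuous_on UNIV f" and supp: "\<And>x. R < norm x \<Longrightarrow> f x = 0"
  shows "integrable lborel f"
proof -
  have "integrable lborel (\<lambda>x. indicator (cball 0 R) x *\<^sub>R f x)"
    using assms(1) by (intro borel_integrable_compact) (auto intro: continuous_on_subset)
  also have "(\<lambda>x. indicator (cball 0 R) x *\<^sub>R f x) = f"
    using supp by (force simp: indicator_def)
  finally show ?thesis .
qed

lemma lborel_integral_translate:
  fixes f :: "'a::euclidean_space \<Rightarrow> real"
  assumes "f \<in> borel_measurable borel"
  shows "(LINT x|lborel. f (x + c)) = (LINT x|lborel. f x)"
proof -
  have "(LINT x|lborel. f x) = (LINT x|distr lborel borel ((+) c). f x)"
    by (simp only: lborel_distr_plus)
  also have "\<dots> = (LINT x|lborel. f (c + x))"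
    using assms by (intro integral_distr) auto
  finally show ?thesis by (simp add: add.commute)
qed

lemma second_difference_energy_summable:
  fixes f :: "'a::euclidean_space \<Rightarrow> real"
  assumes lip: "L-lipschitz_on UNIV f" and supp: "\<And>x. R < norm x \<Longrightarrow> f x = 0"
  shows "summable (\<lambda>k. 4 ^ k * (LINT x|lborel.
           (f (x + (2 / 2 ^ k) *\<^sub>R h) - 2 * f (x + (1 / 2 ^ k) *\<^sub>R h) + f x)\<^sup>2))"
proof -
  define I where "I a = (LINT x|lborel. (f (x + a) - f x)\<^sup>2)" for a
  define J where "J a = (LINT x|lborel. (f (x + 2 *\<^sub>R a) - 2 * f (x + a) + f x)\<^sup>2)" for a
  have L: "0 \<le> L" using lip by (rule lipschitz_on_nonneg)
  have cf: "continuous_on A f" for A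
    using lipschitz_on_continuous_on[OF lip] by (rule continuous_on_subset) auto
  have cfc: "continuous_on UNIV (\<lambda>x. f (x + a))" for a
    by (rule continuous_on_compose2[OF cf[of UNIV]]) (auto intro!: continuous_intros)
  have vanish: "f (x + a) = 0" if "R + norm a < norm x" for x a
    using that norm_triangle_ineq4[of "x + a" a] by (intro supp) auto
  have vanish0: "f x = 0" if "R + norm a < norm x" for x a :: 'a
    using that norm_ge_zero[of a] by (intro supp) linarith
  have intI: "integrable lborel (\<lambda>x. (f (x + a) - f x)\<^sup>2)" for a
    by (rule integrable_bounded_support[where R = "R + norm a"])
       (auto intro!: continuous_intros cf cfc simp: vanish vanish0)
  have intI': "integrable lborel (\<lambda>x. (f (x + 2 *\<^sub>R a) - f (x + a))\<^sup>2)" for a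
  proof (rule integrable_bounded_support[where R = "R + norm (2 *\<^sub>R a)"])
    fix x :: 'a assume "R + norm (2 *\<^sub>R a) < norm x"
    moreover have "norm (2 *\<^sub>R a) = 2 * norm a" by simp
    ultimately have "R + norm a < norm x" "R + norm (2 *\<^sub>R a) < norm x"
      using norm_ge_zero[of a] by linarith+
    thus "(f (x + 2 *\<^sub>R a) - f (x + a))\<^sup>2 = 0" using vanish by simp
  qed (auto intro!: continuous_intros cfc)
  have intJ: "integrable lborel (\<lambda>x. (f (x + 2 *\<^sub>R a) - 2 * f (x + a) + f x)\<^sup>2)" for a
  proof (rule integrable_bounded_support[where R = "R + norm (2 *\<^sub>R a)"])
    fix x :: 'a assume "R + norm (2 *\<^sub>R a) < norm x"
    moreover have "norm (2 *\<^sub>R a) = 2 * norm a" by simp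
    ultimately have "R + norm a < norm x" "R + norm (2 *\<^sub>R a) < norm x"
      using norm_ge_zero[of a] by linarith+
    thus "(f (x + 2 *\<^sub>R a) - 2 * f (x + a) + f x)\<^sup>2 = 0"
      using vanish vanish0 by simp
  qed (auto intro!: continuous_intros cf cfc)
  have shift: "(LINT x|lborel. (f (x + 2 *\<^sub>R a) - f (x + a))\<^sup>2) = I a" for a
  proof -
    have "(\<lambda>x. (f (x + a) - f x)\<^sup>2) \<in> borel_measurable borel"
      by (intro borel_measurable_continuous_onI continuous_intros cf cfc)
    from lborel_integral_translate[OF this, of a] show ?thesis
      by (simp add: I_def add.assoc scaleR_2)
  qed
  \<comment> \<open>The parallelogram law for \<open>f (x + 2a) - f (x + a)\<close> and
    \<open>f (x + a) - f x\<close>: their difference is the second difference, their sum the first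
    difference at \<open>2a\<close>, and both have energy \<open>I a\<close> by translation.\<close>
  have par: "J a = 4 * I a - I (2 *\<^sub>R a)" for a
  proof -
    have "J a + I (2 *\<^sub>R a) = (LINT x|lborel. (f (x + 2 *\<^sub>R a) - 2 * f (x + a) + f x)\<^sup>2
        + (f (x + 2 *\<^sub>R a) - f x)\<^sup>2)"
      using Bochner_Integration.integral_add[OF intJ intI, of a "2 *\<^sub>R a"] by (simp add: J_def I_def)
    also have "\<dots> = (LINT x|lborel. 2 * (f (x + 2 *\<^sub>R a) - f (x + a))\<^sup>2 + 2 * (f (x + a) - f x)\<^sup>2)"
      by (rule Bochner_Integration.integral_cong) (auto simp: power2_eq_square algebra_simps)
    also have "\<dots> = 2 * I a + 2 * I a"
      by (subst Bochner_Integration.integral_add) (auto simp: intI intI' shift, simp add: I_def)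
    finally show ?thesis by simp
  qed
  define V where "V = measure lborel (cball (0::'a) (R + 2 * norm h))"
  have V0: "0 \<le> V" by (simp add: V_def)
  have bound: "I a \<le> L\<^sup>2 * (norm a)\<^sup>2 * V" if "norm a \<le> 2 * norm h" for a
  proof -
    have pw: "(f (x + a) - f x)\<^sup>2 \<le> (L\<^sup>2 * (norm a)\<^sup>2) * indicator (cball (0::'a) (R + 2 * norm h)) x" for x
    proof (cases "norm x \<le> R + 2 * norm h")
      case True
      have "\<bar>f (x + a) - f x\<bar> \<le> L * norm a"
        using lipschitz_onD[OF lip, of "x + a" x] by (simp add: dist_norm)
      hence "\<bar>f (x + a) - f x\<bar>\<^sup>2 \<le> (L * norm a)\<^sup>2" by (intro power_mono) auto
      thus ?thesis using True by (simp add: power_mult_distrib)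
    next
      case False
      thus ?thesis using that vanish[of a x] vanish0[of a x] by (simp add: indicator_def)
    qed
    have "I a \<le> (LINT x|lborel. (L\<^sup>2 * (norm a)\<^sup>2) * indicator (cball (0::'a) (R + 2 * norm h)) x)"
      unfolding I_def
    proof (rule Bochner_Integration.integral_mono)
      show "integrable lborel (\<lambda>x. (f (x + a) - f x)\<^sup>2)" by (rule intI)
      show "integrable lborel (\<lambda>x. (L\<^sup>2 * (norm a)\<^sup>2) * indicator (cball (0::'a) (R + 2 * norm h)) x)"
        using emeasure_bounded_finite[OF bounded_cball, of "0 :: 'a" "R + 2 * norm h"]
        by (intro integrable_mult_right integrable_real_indicator) auto
    qed (rule pw)
    also have "\<dots> = L\<^sup>2 * (norm a)\<^sup>2 * V" by (simp add: V_def)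
    finally show ?thesis .
  qed
  \<comment> \<open>Bounded because \<open>I a\<close> is quadratic in \<open>norm a\<close>. The
    scale \<open>2 / 2 ^ k\<close> makes \<open>c (Suc k) - c k\<close> the rescaled
    second-difference energy at \<open>1 / 2 ^ k\<close>.\<close>
  define c where "c k = 4 ^ k * I ((2 / 2 ^ k) *\<^sub>R h)" for k :: nat
  have cB: "c k \<le> 4 * L\<^sup>2 * (norm h)\<^sup>2 * V" for k
  proof -
    have n: "norm ((2 / 2 ^ k) *\<^sub>R h) = 2 / 2 ^ k * norm h" by simp
    have "(2 / 2 ^ k) * norm h \<le> 2 * norm h"
      by (intro mult_right_mono) (auto simp: divide_le_eq)
    hence "I ((2 / 2 ^ k) *\<^sub>R h) \<le> L\<^sup>2 * (2 / 2 ^ k * norm h)\<^sup>2 * V"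
      using bound[of "(2 / 2 ^ k) *\<^sub>R h"] n by simp
    hence "c k \<le> 4 ^ k * (L\<^sup>2 * (2 / 2 ^ k * norm h)\<^sup>2 * V)"
      unfolding c_def by (intro mult_left_mono) auto
    also have "\<dots> = 4 * L\<^sup>2 * (norm h)\<^sup>2 * V"
    proof -
      have "(2 ^ k)\<^sup>2 = (4 ^ k :: real)" by (simp add: power2_eq_square flip: power_mult_distrib)
      thus ?thesis by (simp add: power_mult_distrib power_divide)
    qed
    finally show ?thesis .
  qed
  have step: "4 ^ k * J ((1 / 2 ^ k) *\<^sub>R h) = c (Suc k) - c k" for k
    by (simp add: par c_def algebra_simps)
  have J0: "0 \<le> J a" for a unfolding J_def by simp
  have "summable (\<lambda>k. 4 ^ k * J ((1 / 2 ^ k) *\<^sub>R h))"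
  proof (rule summableI_nonneg_bounded)
    fix n
    have "(\<Sum>k<n. 4 ^ k * J ((1 / 2 ^ k) *\<^sub>R h)) = c n - c 0"
      unfolding step by (rule sum_lessThan_telescope)
    also have "c 0 \<ge> 0" by (simp add: c_def I_def)
    hence "c n - c 0 \<le> 4 * L\<^sup>2 * (norm h)\<^sup>2 * V" using cB[of n] by linarith
    finally show "(\<Sum>k<n. 4 ^ k * J ((1 / 2 ^ k) *\<^sub>R h)) \<le> 4 * L\<^sup>2 * (norm h)\<^sup>2 * V" .
  qed (simp add: J0)
  thus ?thesis by (simp add: J_def)
qed

text \<open>The base point moves with the scale: \<open>y\<close> is where the blow-up is probed.
  Translation invariance removes the shift from each integral, so the energies stay summable, the
  sum of the integrands is finite almost everywhere, and its terms tend to zero.\<close>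

lemma second_difference_AE_tendsto:
  fixes f :: "'a::euclidean_space \<Rightarrow> real"
  assumes lip: "L-lipschitz_on UNIV f" and supp: "\<And>x. R < norm x \<Longrightarrow> f x = 0"
  shows "AE x in lborel. (\<lambda>k. 2 ^ k * (f (x + (1 / 2 ^ k) *\<^sub>R y + (2 / 2 ^ k) *\<^sub>R h)
            - 2 * f (x + (1 / 2 ^ k) *\<^sub>R y + (1 / 2 ^ k) *\<^sub>R h) + f (x + (1 / 2 ^ k) *\<^sub>R y))) \<longlonglongrightarrow> 0"
proof -
  define G where "G k x = (f (x + (2 / 2 ^ k) *\<^sub>R h) - 2 * f (x + (1 / 2 ^ k) *\<^sub>R h) + f x)\<^sup>2" for k x
  define H where "H k x = 4 ^ k * G k (x + (1 / 2 ^ k) *\<^sub>R y)" for k x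
  have cf: "continuous_on A f" for A
    using lipschitz_on_continuous_on[OF lip] by (rule continuous_on_subset) auto
  have cfc: "continuous_on UNIV (\<lambda>x. f (x + a))" for a
    by (rule continuous_on_compose2[OF cf[of UNIV]]) (auto intro!: continuous_intros)
  have cG: "continuous_on UNIV (G k)" for k
    unfolding G_def by (intro continuous_intros cf cfc)
  have mG: "G k \<in> borel_measurable borel" for k
    using cG by (rule borel_measurable_continuous_onI)
  have cH: "continuous_on UNIV (H k)" for k
    unfolding H_def
    by (intro continuous_intros continuous_on_compose2[OF cG]) auto
  have mH[measurable]: "H k \<in> borel_measurable borel" for k
    using cH by (rule borel_measurable_continuous_onI)
  have H0: "0 \<le> H k x" for k x by (simp add: H_def G_def)
  have iH: "integrable lborel (H k)" for k
  proof (rule integrable_bounded_support[OF cH, where R = "R + norm y + 2 * norm h"])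
    fix x :: 'a assume x: "R + norm y + 2 * norm h < norm x"
    have le: "norm ((c / 2 ^ k) *\<^sub>R v) \<le> c * norm v" if "0 \<le> c" for c :: real and v :: 'a
    proof -
      have "c / 2 ^ k \<le> c" using that by (simp add: divide_le_eq mult_le_cancel_left1)
      thus ?thesis using that by (simp add: mult_right_mono del: times_divide_eq_left)
    qed
    have v: "f (x + (1 / 2 ^ k) *\<^sub>R y + w) = 0" if "norm w \<le> 2 * norm h" for w :: 'a
    proof (rule supp)
      have "norm x \<le> norm (x + (1 / 2 ^ k) *\<^sub>R y + w) + norm ((1 / 2 ^ k) *\<^sub>R y + w)"
        using norm_triangle_ineq4[of "x + (1 / 2 ^ k) *\<^sub>R y + w" "(1 / 2 ^ k) *\<^sub>R y + w"]
        by (simp add: add.assoc)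
      also have "norm ((1 / 2 ^ k) *\<^sub>R y + w) \<le> norm y + 2 * norm h"
        using norm_triangle_ineq[of "(1 / 2 ^ k) *\<^sub>R y" w] le[of 1 y] that by linarith
      finally show "R < norm (x + (1 / 2 ^ k) *\<^sub>R y + w)" using x by linarith
    qed
    have "norm ((1 / 2 ^ k) *\<^sub>R h) \<le> 2 * norm h" using le[of 1 h] norm_ge_zero[of h] by linarith
    thus "H k x = 0"
      using v[of 0] v[of "(1 / 2 ^ k) *\<^sub>R h"] v[of "(2 / 2 ^ k) *\<^sub>R h"] le[of 2 h]
      by (simp add: H_def G_def)
  qed
  have eqH: "(LINT x|lborel. H k x) = 4 ^ k * (LINT x|lborel. G k x)" for k
    unfolding H_def using lborel_integral_translate[OF mG[of k]] by simp
  have sH: "summable (\<lambda>k. LINT x|lborel. H k x)"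
    unfolding eqH unfolding G_def by (rule second_difference_energy_summable[OF lip supp])
  have "(\<integral>\<^sup>+x. (\<Sum>k. ennreal (H k x)) \<partial>lborel) = (\<Sum>k. \<integral>\<^sup>+x. ennreal (H k x) \<partial>lborel)"
    by (intro nn_integral_suminf) auto
  also have "\<dots> = (\<Sum>k. ennreal (LINT x|lborel. H k x))"
    using H0 iH by (intro suminf_cong nn_integral_eq_integral) auto
  also have "\<dots> = ennreal (\<Sum>k. LINT x|lborel. H k x)"
    using H0 sH by (intro suminf_ennreal2) (auto intro!: integral_nonneg_AE)
  finally have fin: "(\<integral>\<^sup>+x. (\<Sum>k. ennreal (H k x)) \<partial>lborel) \<noteq> \<infinity>" by simp
  have "AE x in lborel. (\<Sum>k. ennreal (H k x)) \<noteq> \<infinity>"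
    using fin by (intro nn_integral_PInf_AE) auto
  thus ?thesis
  proof eventually_elim
    case (elim x)
    hence "summable (\<lambda>k. H k x)" using H0 by (intro summable_suminf_not_top) auto
    hence "(\<lambda>k. H k x) \<longlonglongrightarrow> 0" by (rule summable_LIMSEQ_zero)
    hence "(\<lambda>k. sqrt (H k x)) \<longlonglongrightarrow> sqrt 0" by (intro tendsto_real_sqrt)
    moreover have "sqrt (H k x) = \<bar>2 ^ k * (f (x + (1 / 2 ^ k) *\<^sub>R y + (2 / 2 ^ k) *\<^sub>R h)
            - 2 * f (x + (1 / 2 ^ k) *\<^sub>R y + (1 / 2 ^ k) *\<^sub>R h) + f (x + (1 / 2 ^ k) *\<^sub>R y))\<bar>" for k
    proof -
      have "(4::real) ^ k = (2 ^ k)\<^sup>2" by (simp add: power2_eq_square flip: power_mult_distrib)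
      thus ?thesis unfolding H_def G_def by (simp flip: power_mult_distrib)
    qed
    ultimately show ?case by (simp add: tendsto_rabs_zero_iff)
  qed
qed

text \<open>The rescaled second differences are Lipschitz in \<open>y\<close> and \<open>h\<close>
  uniformly in \<open>k\<close>, so the null sets belonging to a countable dense set of
  \<open>y\<close> and \<open>h\<close> already serve for all.\<close>

lemma second_difference_AE_tendsto_all:
  fixes f :: "'a::euclidean_space \<Rightarrow> real"
  assumes lip: "L-lipschitz_on UNIV f" and supp: "\<And>x. R < norm x \<Longrightarrow> f x = 0"
  shows "AE x in lborel. \<forall>y h. (\<lambda>k. 2 ^ k * (f (x + (1 / 2 ^ k) *\<^sub>R y + (2 / 2 ^ k) *\<^sub>R h)
            - 2 * f (x + (1 / 2 ^ k) *\<^sub>R y + (1 / 2 ^ k) *\<^sub>R h) + f (x + (1 / 2 ^ k) *\<^sub>R y))) \<longlonglongrightarrow> 0"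
proof -
  define T where "T x y h k = 2 ^ k * (f (x + (1 / 2 ^ k) *\<^sub>R y + (2 / 2 ^ k) *\<^sub>R h)
            - 2 * f (x + (1 / 2 ^ k) *\<^sub>R y + (1 / 2 ^ k) *\<^sub>R h) + f (x + (1 / 2 ^ k) *\<^sub>R y))" for x y h k
  have L: "0 \<le> L" using lip by (rule lipschitz_on_nonneg)
  have lipT: "\<bar>T x y h k - T x y' h' k\<bar> \<le> 4 * L * (norm (y - y') + norm (h - h'))" for x y h y' h' k
  proof -
    have d: "2 ^ k * \<bar>f (x + (1 / 2 ^ k) *\<^sub>R y + (c / 2 ^ k) *\<^sub>R h) - f (x + (1 / 2 ^ k) *\<^sub>R y' + (c / 2 ^ k) *\<^sub>R h')\<bar>
            \<le> L * (norm (y - y') + c * norm (h - h'))" if "0 \<le> c" for c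
    proof -
      have "\<bar>f (x + (1 / 2 ^ k) *\<^sub>R y + (c / 2 ^ k) *\<^sub>R h) - f (x + (1 / 2 ^ k) *\<^sub>R y' + (c / 2 ^ k) *\<^sub>R h')\<bar>
         \<le> L * norm ((1 / 2 ^ k) *\<^sub>R (y - y') + (c / 2 ^ k) *\<^sub>R (h - h'))"
        using lipschitz_onD[OF lip, of "x + (1 / 2 ^ k) *\<^sub>R y + (c / 2 ^ k) *\<^sub>R h" "x + (1 / 2 ^ k) *\<^sub>R y' + (c / 2 ^ k) *\<^sub>R h'"]
        by (simp add: dist_norm algebra_simps)
      also have "\<dots> \<le> L * (1 / 2 ^ k * norm (y - y') + c / 2 ^ k * norm (h - h'))"
        using that by (intro mult_left_mono L order_trans[OF norm_triangle_ineq]) auto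
      also have "\<dots> = L * (norm (y - y') + c * norm (h - h')) / 2 ^ k"
        by (simp add: field_simps)
      finally show ?thesis by (simp add: field_simps)
    qed
    have comb: "\<bar>p * (a - 2 * b + c) - p * (a' - 2 * b' + c')\<bar> \<le> A + 2 * B + C"
      if "p * \<bar>a - a'\<bar> \<le> A" "p * \<bar>b - b'\<bar> \<le> B" "p * \<bar>c - c'\<bar> \<le> C" "0 \<le> p"
      for p a b c a' b' c' A B C :: real
    proof -
      have "\<bar>p * (a - 2 * b + c) - p * (a' - 2 * b' + c')\<bar>
          = p * \<bar>(a - a') - 2 * (b - b') + (c - c')\<bar>"
      proof -
        have "p * (a - 2 * b + c) - p * (a' - 2 * b' + c') = p * ((a - a') - 2 * (b - b') + (c - c'))"
          by algebra
        thus ?thesis using that(4) by (simp only: abs_mult abs_of_nonneg)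
      qed
      also have "\<dots> \<le> p * (\<bar>a - a'\<bar> + 2 * \<bar>b - b'\<bar> + \<bar>c - c'\<bar>)"
        using that(4)
        by (intro mult_left_mono) (smt (verit) abs_triangle_ineq abs_triangle_ineq4 abs_mult, simp)
      finally show ?thesis using that by (simp add: algebra_simps)
    qed
    have "\<bar>T x y h k - T x y' h' k\<bar> \<le> L * (norm (y - y') + 2 * norm (h - h'))
       + 2 * (L * (norm (y - y') + 1 * norm (h - h'))) + L * (norm (y - y') + 0 * norm (h - h'))"
      unfolding T_def using d[of 2] d[of 1] d[of 0, simplified] by (intro comb) simp_all
    also have "\<dots> = 4 * L * (norm (y - y') + norm (h - h'))" by (simp add: algebra_simps)
    finally show ?thesis .
  qed
  obtain D :: "'a set" where D: "countable D" "\<And>X. open X \<Longrightarrow> X \<noteq> {} \<Longrightarrow> \<exists>d\<in>D. d \<in> X"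
    using countable_dense_setE by blast
  have "AE x in lborel. \<forall>y\<in>D. \<forall>h\<in>D. T x y h \<longlonglongrightarrow> 0"
    unfolding T_def using second_difference_AE_tendsto[OF lip supp] D(1)
    by (auto simp: AE_ball_countable)
  thus ?thesis
  proof eventually_elim
    case (elim x)
    have "T x y h \<longlonglongrightarrow> 0" for y h
    proof (rule LIMSEQ_I)
      fix r :: real assume r: "0 < r"
      define e where "e = r / (16 * (L + 1))"
      have e: "0 < e" using r L by (simp add: e_def)
      obtain y' h' where D': "y' \<in> D" "h' \<in> D" "y' \<in> ball y e" "h' \<in> ball h e"
        using D(2)[of "ball y e"] D(2)[of "ball h e"] e by auto
      hence "4 * L * (norm (y - y') + norm (h - h')) \<le> 4 * L * (e + e)"
        using L by (intro mult_left_mono) (auto simp: dist_norm)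
      also have "\<dots> \<le> 8 * (L + 1) * e" using e by (simp add: algebra_simps)
      also have "\<dots> = r / 2"
      proof -
        have "16 * (L + 1) * e = r" unfolding e_def using L by (simp del: distrib_left_numeral)
        thus ?thesis by linarith
      qed
      finally have le: "4 * L * (norm (y - y') + norm (h - h')) \<le> r / 2" by simp
      obtain n0 where n0: "\<And>n. n \<ge> n0 \<Longrightarrow> \<bar>T x y' h' n\<bar> < r / 2"
        using elim D' r LIMSEQ_D[of "T x y' h'" 0 "r/2"] by fastforce
      have "\<bar>T x y h n\<bar> < r" if "n \<ge> n0" for n
        using n0[OF that] lipT[of x y h n y' h'] le by linarith
      thus "\<exists>n0. \<forall>n\<ge>n0. norm (T x y h n - 0) < r" by auto
    qed
    thus ?case unfolding T_def by blast
  qed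
qed

section \<open>Lipschitz extension with bounded support\<close>

text \<open>McShane's extension \<open>m\<close> is clamped between \<open>- c\<close> and
  \<open>c\<close>, where \<open>c\<close> decreases from \<open>B\<close> on \<open>E\<close> with
  slope \<open>L\<close> until it reaches zero. On \<open>E\<close> the clamp is inactive, at
  distance \<open>B / L\<close> it forces zero, and both \<open>m\<close> and \<open>c\<close> are
  \<open>L\<close>-Lipschitz, so the constant does not grow.\<close>

lemma lipschitz_extension_bounded_support:
  fixes g :: "'a::euclidean_space \<Rightarrow> real"
  assumes E: "bounded E" and B: "\<And>x. x \<in> E \<Longrightarrow> \<bar>g x\<bar> \<le> B"
    and lip: "\<And>x y. x \<in> E \<Longrightarrow> y \<in> E \<Longrightarrow> \<bar>g x - g y\<bar> \<le> L * dist x y" and L: "0 < L"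
  obtains G R where "L-lipschitz_on UNIV G" "\<And>x. R < norm x \<Longrightarrow> G x = 0" "\<And>x. x \<in> E \<Longrightarrow> G x = g x"
proof (cases "E = {}")
  case True
  show thesis
    by (rule that[of "\<lambda>_. 0" 0]) (use L True in \<open>auto intro!: lipschitz_onI\<close>)
next
  case False
  then obtain e0 where e0: "e0 \<in> E" by blast
  have B0: "0 \<le> B" using B[OF e0] by linarith
  obtain R0 where R0: "\<And>x. x \<in> E \<Longrightarrow> norm x \<le> R0" using E by (auto simp: bounded_iff)
  define m where "m x = (INF e\<in>E. g e + L * dist x e)" for x
  define c where "c x = max 0 (B - L * infdist x E)" for x
  define G where "G x = max (- c x) (min (c x) (m x))" for x
  have bdd: "bdd_below ((\<lambda>e. g e + L * dist x e) ` E)" for x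
  proof (rule bdd_belowI2)
    fix e assume "e \<in> E"
    have "0 \<le> L * dist x e" using L by simp
    thus "- B \<le> g e + L * dist x e" using B[OF \<open>e \<in> E\<close>] by linarith
  qed
  have m_le: "m x \<le> m y + L * dist x y" for x y
  proof -
    have "m x - L * dist x y \<le> g e + L * dist y e" if "e \<in> E" for e
    proof -
      have "m x \<le> g e + L * dist x e" unfolding m_def by (rule cINF_lower[OF bdd that])
      also have "L * dist x e \<le> L * (dist x y + dist y e)"
        using L by (intro mult_left_mono dist_triangle) auto
      finally show ?thesis by (simp add: algebra_simps)
    qed
    hence "m x - L * dist x y \<le> m y" unfolding m_def[of y] using False by (intro cINF_greatest)
    thus ?thesis by simp
  qed
  have m_eq: "m x = g x" if "x \<in> E" for x
  proof (rule antisym)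
    show "m x \<le> g x" unfolding m_def using cINF_lower[OF bdd that, of x] by simp
    show "g x \<le> m x" unfolding m_def
      using False lip[OF that] by (intro cINF_greatest) (auto simp: abs_le_iff algebra_simps)
  qed
  have c_le: "\<bar>c x - c y\<bar> \<le> L * dist x y" for x y :: 'a
  proof -
    have "\<bar>infdist x E - infdist y E\<bar> \<le> dist x y"
      using infdist_triangle[of x E y] infdist_triangle[of y E x] by (simp add: dist_commute)
    hence "L * \<bar>infdist x E - infdist y E\<bar> \<le> L * dist x y" using L by simp
    hence "\<bar>L * infdist x E - L * infdist y E\<bar> \<le> L * dist x y"
      using L by (simp add: abs_mult flip: right_diff_distrib)
    thus ?thesis by (auto simp: c_def)
  qed
  have G_lip: "L-lipschitz_on UNIV G"
  proof (rule lipschitz_onI)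
    fix x y :: 'a
    have "\<bar>m x - m y\<bar> \<le> L * dist x y" using m_le[of x y] m_le[of y x] by (auto simp: dist_commute)
    thus "dist (G x) (G y) \<le> L * dist x y" using c_le[of x y] by (auto simp: G_def dist_real_def)
  qed (use L in simp)
  show thesis
  proof (rule that[OF G_lip])
    fix x assume "x \<in> E"
    thus "G x = g x" using B[of x] by (simp add: G_def m_eq c_def abs_le_iff)
  next
    fix x :: 'a assume x: "R0 + B / L < norm x"
    have "norm x - R0 \<le> infdist x E" unfolding infdist_notempty[OF False]
    proof (rule cINF_greatest[OF False])
      fix e assume "e \<in> E"
      thus "norm x - R0 \<le> dist x e" using R0[of e] norm_triangle_ineq2[of x e] by (simp add: dist_norm)
    qed
    hence "B / L \<le> infdist x E" using x by linarith
    hence "c x = 0" using L by (simp add: c_def field_simps)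
    thus "G x = 0" by (simp add: G_def)
  qed
qed

section \<open>Linearity of blow-up limits\<close>

text \<open>Vanishing second differences make the limit additive, and the uniform Lipschitz bound
  upgrades additivity to linearity. Convergence then has to be known on a basis only, which a
  subsequence can provide.\<close>

lemma asymptotically_additive_tendsto:
  fixes q :: "nat \<Rightarrow> 'a::euclidean_space \<Rightarrow> 'c::real_normed_vector"
  assumes lip: "\<And>k y z. norm (q k y - q k z) \<le> M * norm (y - z)"
    and zero: "\<And>k. q k 0 = 0"
    and sd: "\<And>y h. (\<lambda>k. q k (y + 2 *\<^sub>R h) - 2 *\<^sub>R q k (y + h) + q k y) \<longlonglongrightarrow> 0"
    and lim: "\<And>b. b \<in> Basis \<Longrightarrow> (\<lambda>k. q k b) \<longlonglongrightarrow> l b"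
  shows "(\<lambda>k. q k y) \<longlonglongrightarrow> (\<Sum>b\<in>Basis. (y \<bullet> b) *\<^sub>R l b)"
proof -
  \<comment> \<open>The segments from \<open>0\<close> to \<open>a + b\<close> and from
    \<open>a\<close> to \<open>b\<close> have the same midpoint; subtracting their second
    differences cancels the midpoint values and leaves the additivity defect.\<close>
  have add: "(\<lambda>k. q k (a + b) - q k a - q k b) \<longlonglongrightarrow> 0" for a b
  proof -
    have e: "a + 2 *\<^sub>R ((1/2) *\<^sub>R (b - a)) = b" "a + (1/2) *\<^sub>R (b - a) = (1/2) *\<^sub>R (a + b)"
      using scaleR_add_left[of "1/2" "1/2" a] by (simp_all add: algebra_simps)
    show ?thesis
      using tendsto_diff[OF sd[of 0 "(1/2) *\<^sub>R (a + b)"] sd[of a "(1/2) *\<^sub>R (b - a)"]]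
      by (simp only: e zero) (simp add: algebra_simps)
  qed
  have add_lim: "(\<lambda>k. q k (a + b)) \<longlonglongrightarrow> u + v" if "(\<lambda>k. q k a) \<longlonglongrightarrow> u" "(\<lambda>k. q k b) \<longlonglongrightarrow> v" for a b u v
    using tendsto_add[OF add[of a b] tendsto_add[OF that]] by simp
  have mult: "(\<lambda>k. q k (real n *\<^sub>R v) - real n *\<^sub>R q k v) \<longlonglongrightarrow> 0" for n v
  proof (induction n)
    case (Suc n)
    show ?case
      using tendsto_add[OF Suc add[of "real n *\<^sub>R v" v]] by (simp add: algebra_simps)
  qed (simp add: zero)
  have mult_nat: "(\<lambda>k. q k (real n *\<^sub>R v)) \<longlonglongrightarrow> real n *\<^sub>R u" if "(\<lambda>k. q k v) \<longlonglongrightarrow> u" for n v u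
    using tendsto_add[OF mult[of n v] tendsto_scaleR[OF tendsto_const that, of "real n"]] by simp
  have neg: "(\<lambda>k. q k (- v)) \<longlonglongrightarrow> - u" if "(\<lambda>k. q k v) \<longlonglongrightarrow> u" for v u
    using tendsto_minus[OF tendsto_add[OF add[of v "- v"] that]] by (simp add: zero)
  have mult_int: "(\<lambda>k. q k (real_of_int m *\<^sub>R v)) \<longlonglongrightarrow> real_of_int m *\<^sub>R u" if "(\<lambda>k. q k v) \<longlonglongrightarrow> u" for m v u
  proof (cases m)
    case (nonneg n) thus ?thesis using mult_nat[OF that, of n] by simp
  next
    case m: (neg n)
    have "real_of_int m = - real (Suc n)" by (simp add: m)
    thus ?thesis using neg[OF mult_nat[OF that, of "Suc n"]] by (simp only: scaleR_minus_left)
  qed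
  \<comment> \<open>Write \<open>n * c = m + f\<close> with \<open>m\<close> an integer and
    \<open>f\<close> between \<open>0\<close> and \<open>1\<close>. The integer part is controlled
    by \<open>mult_int\<close>, the fractional part costs at most \<open>C\<close>, and division by
    a large \<open>n\<close> brings the error below \<open>r\<close>.\<close>
  have mult_real: "(\<lambda>k. q k (c *\<^sub>R v)) \<longlonglongrightarrow> c *\<^sub>R u" if vu: "(\<lambda>k. q k v) \<longlonglongrightarrow> u" for c v u
  proof (rule LIMSEQ_I)
    fix r :: real assume r: "0 < r"
    have M: "0 \<le> M * norm v" using order_trans[OF norm_ge_zero lip[of 0 v 0]] by simp
    define C where "C = M * norm v + norm u"
    have C: "0 \<le> C" using M by (simp add: C_def)
    obtain n :: nat where n: "(C + 1) / r < real n" using reals_Archimedean2 by blast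
    have n0: "0 < real n" using n C r by (smt (verit) divide_nonneg_pos)
    define m where "m = \<lfloor>real n * c\<rfloor>"
    define f where "f = real n * c - of_int m"
    have f: "0 \<le> f" "f \<le> 1" unfolding f_def m_def by linarith+
    define R where "R k = (q k (of_int m *\<^sub>R v + f *\<^sub>R v) - q k (of_int m *\<^sub>R v) - q k (f *\<^sub>R v))
       + (q k (of_int m *\<^sub>R v) - of_int m *\<^sub>R u) - (q k (real n *\<^sub>R (c *\<^sub>R v)) - real n *\<^sub>R q k (c *\<^sub>R v))" for k
    have "R \<longlonglongrightarrow> 0 + (of_int m *\<^sub>R u - of_int m *\<^sub>R u) - 0"
      unfolding R_def by (intro tendsto_add tendsto_diff add mult mult_int[OF vu] tendsto_const)
    hence "\<exists>k0. \<forall>k\<ge>k0. norm (R k - 0) < 1" by (intro LIMSEQ_D) auto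
    then obtain k0 where k0: "\<And>k. k \<ge> k0 \<Longrightarrow> norm (R k) < 1" by auto
    have "norm (q k (c *\<^sub>R v) - c *\<^sub>R u) < r" if "k \<ge> k0" for k
    proof -
      have ncv: "of_int m *\<^sub>R v + f *\<^sub>R v = real n *\<^sub>R (c *\<^sub>R v)"
        by (simp add: f_def flip: scaleR_add_left)
      have ncu: "real n *\<^sub>R (c *\<^sub>R u) = of_int m *\<^sub>R u + f *\<^sub>R u"
        by (simp add: f_def flip: scaleR_add_left)
      have "real n *\<^sub>R (q k (c *\<^sub>R v) - c *\<^sub>R u) = R k + (q k (f *\<^sub>R v) - f *\<^sub>R u)"
        unfolding R_def scaleR_diff_right ncu unfolding ncv by simp
      also have "norm \<dots> \<le> norm (R k) + (norm (q k (f *\<^sub>R v)) + norm (f *\<^sub>R u))"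
        by (intro order_trans[OF norm_triangle_ineq] add_left_mono norm_triangle_ineq4)
      also have "norm (q k (f *\<^sub>R v)) \<le> f * (M * norm v)"
        using lip[of k "f *\<^sub>R v" 0] f by (simp add: zero algebra_simps)
      also have "\<dots> \<le> 1 * (M * norm v)" using f M by (intro mult_right_mono) auto
      also have "norm (f *\<^sub>R u) \<le> norm u" using f by (simp add: mult_left_le_one_le)
      finally have "real n * norm (q k (c *\<^sub>R v) - c *\<^sub>R u) \<le> norm (R k) + C"
        using n0 by (simp add: C_def)
      also have "\<dots> < C + 1" using k0[OF that] by simp
      also have "\<dots> < real n * r" using n r by (simp add: field_simps)
      finally show ?thesis using n0 by simp
    qed
    thus "\<exists>k0. \<forall>k\<ge>k0. norm (q k (c *\<^sub>R v) - c *\<^sub>R u) < r" by blast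
  qed
  have "(\<lambda>k. q k (\<Sum>b\<in>S. (y \<bullet> b) *\<^sub>R b)) \<longlonglongrightarrow> (\<Sum>b\<in>S. (y \<bullet> b) *\<^sub>R l b)" if "S \<subseteq> Basis" for S
  proof -
    have "finite S" using that finite_Basis by (rule finite_subset)
    thus ?thesis using that
      by (induction S rule: finite_induct) (auto simp: zero intro!: add_lim mult_real lim)
  qed
  from this[of Basis] show ?thesis by (simp add: euclidean_representation)
qed

text \<open>The rescaled increments \<open>q\<close> are \<open>L\<close>-Lipschitz uniformly in
  \<open>k\<close>. A subsequence converging on the basis converges everywhere to a linear map by
  asymptotic additivity, and a finite net of the unit ball makes the convergence uniform.\<close>

lemma blowup_uniform_linear_limit:
  fixes F :: "'a::euclidean_space \<Rightarrow> 'c::euclidean_space"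
  assumes lip: "L-lipschitz_on UNIV F"
    and sd: "\<And>y h. (\<lambda>k. 2 ^ k *\<^sub>R (F (x + (1 / 2 ^ k) *\<^sub>R y + (2 / 2 ^ k) *\<^sub>R h)
            - 2 *\<^sub>R F (x + (1 / 2 ^ k) *\<^sub>R y + (1 / 2 ^ k) *\<^sub>R h) + F (x + (1 / 2 ^ k) *\<^sub>R y))) \<longlonglongrightarrow> 0"
  obtains A \<kappa> where "linear A" "strict_mono (\<kappa> :: nat \<Rightarrow> nat)"
    "\<And>\<tau>. 0 < \<tau> \<Longrightarrow> \<forall>\<^sub>F i in sequentially. \<forall>y\<in>cball 0 1.
       norm (2 ^ \<kappa> i *\<^sub>R (F (x + (1 / 2 ^ \<kappa> i) *\<^sub>R y) - F x) - A y) \<le> \<tau>"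
proof -
  define q where "q k y = 2 ^ k *\<^sub>R (F (x + (1 / 2 ^ k) *\<^sub>R y) - F x)" for k :: nat and y
  have L: "0 \<le> L" using lip by (rule lipschitz_on_nonneg)
  have lipq: "norm (q k y - q k z) \<le> L * norm (y - z)" for k y z
  proof -
    have "q k y - q k z = 2 ^ k *\<^sub>R (F (x + (1 / 2 ^ k) *\<^sub>R y) - F (x + (1 / 2 ^ k) *\<^sub>R z))"
      by (simp add: q_def algebra_simps)
    hence "norm (q k y - q k z) = 2 ^ k * dist (F (x + (1 / 2 ^ k) *\<^sub>R y)) (F (x + (1 / 2 ^ k) *\<^sub>R z))"
      by (simp add: dist_norm)
    also have "\<dots> \<le> 2 ^ k * (L * dist (x + (1 / 2 ^ k) *\<^sub>R y) (x + (1 / 2 ^ k) *\<^sub>R z))"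
      by (intro mult_left_mono lipschitz_onD[OF lip]) auto
    also have "dist (x + (1 / 2 ^ k) *\<^sub>R y) (x + (1 / 2 ^ k) *\<^sub>R z) = norm (y - z) / 2 ^ k"
      by (simp add: dist_norm flip: scaleR_diff_right)
    finally show ?thesis by simp
  qed
  have q0: "q k 0 = 0" for k by (simp add: q_def)
  have "norm (q k b) \<le> L" if "b \<in> Basis" for k b
    using lipq[of k b 0] that by (simp add: q0)
  then obtain \<kappa> :: "nat \<Rightarrow> nat" where \<kappa>: "strict_mono \<kappa>"
      "\<And>b. b \<in> Basis \<Longrightarrow> \<exists>l. (\<lambda>i. q (\<kappa> i) b) \<longlonglongrightarrow> l"
    using function_convergent_subsequence[of "Basis :: 'a set" q L]
    by (metis countable_finite finite_Basis)
  then obtain l where l: "\<And>b. b \<in> Basis \<Longrightarrow> (\<lambda>i. q (\<kappa> i) b) \<longlonglongrightarrow> l b" by metis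
  define A where "A y = (\<Sum>b\<in>Basis. (y \<bullet> b) *\<^sub>R l b)" for y
  have sdq: "(\<lambda>i. q (\<kappa> i) (y + 2 *\<^sub>R h) - 2 *\<^sub>R q (\<kappa> i) (y + h) + q (\<kappa> i) y) \<longlonglongrightarrow> 0" for y h
  proof -
    have "q k (y + 2 *\<^sub>R h) - 2 *\<^sub>R q k (y + h) + q k y
       = 2 ^ k *\<^sub>R (F (x + (1 / 2 ^ k) *\<^sub>R y + (2 / 2 ^ k) *\<^sub>R h)
            - 2 *\<^sub>R F (x + (1 / 2 ^ k) *\<^sub>R y + (1 / 2 ^ k) *\<^sub>R h) + F (x + (1 / 2 ^ k) *\<^sub>R y))" for k
    proof -
      have "x + (1 / 2 ^ k) *\<^sub>R (y + 2 *\<^sub>R h) = x + (1 / 2 ^ k) *\<^sub>R y + (2 / 2 ^ k) *\<^sub>R h"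
           "x + (1 / 2 ^ k) *\<^sub>R (y + h) = x + (1 / 2 ^ k) *\<^sub>R y + (1 / 2 ^ k) *\<^sub>R h"
        by (simp_all add: scaleR_add_right)
      moreover have "p *\<^sub>R (a - d) - 2 *\<^sub>R (p *\<^sub>R (b - d)) + p *\<^sub>R (c - d) = p *\<^sub>R (a - 2 *\<^sub>R b + c)"
        for p :: real and a b c d :: 'c
        by (simp add: algebra_simps flip: scaleR_2)
      ultimately show ?thesis by (simp only: q_def)
    qed
    thus ?thesis using LIMSEQ_subseq_LIMSEQ[OF sd[of y h] \<kappa>(1)] by (simp add: o_def)
  qed
  have lim: "(\<lambda>i. q (\<kappa> i) y) \<longlonglongrightarrow> A y" for y
    unfolding A_def by (rule asymptotically_additive_tendsto[OF lipq q0 sdq l])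
  have linA: "linear A"
    unfolding A_def by (intro linear_compose_sum ballI)
      (auto intro!: linearI simp: inner_add_left algebra_simps)
  have lipA: "norm (A y - A z) \<le> L * norm (y - z)" for y z
    by (rule tendsto_upperbound[OF tendsto_norm[OF tendsto_diff[OF lim lim]]])
       (auto intro!: always_eventually lipq)
  show thesis
  proof (rule that[OF linA \<kappa>(1)])
    fix \<tau> :: real assume \<tau>: "0 < \<tau>"
    \<comment> \<open>Net spacing: moving to a net point costs at most \<open>\<tau> / 4\<close> in
      \<open>q\<close> and again in \<open>A\<close>, which leaves \<open>\<tau> / 2\<close> for the
      convergence on the net.\<close>
    define s where "s = \<tau> / (4 * (L + 1))"
    have s: "0 < s" "L * s \<le> \<tau> / 4"
    proof -
      show "0 < s" using \<tau> L by (simp add: s_def)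
      have "4 * (L + 1) * s = \<tau>" unfolding s_def using L by (simp del: distrib_left_numeral)
      thus "L * s \<le> \<tau> / 4" using \<open>0 < s\<close> by (simp add: algebra_simps)
    qed
    obtain T where T: "finite T" "cball 0 1 \<subseteq> (\<Union>t\<in>T. ball (t::'a) s)"
      using compact_cball[of "0::'a" 1] s(1) unfolding compact_eq_totally_bounded by blast
    have "\<forall>\<^sub>F i in sequentially. \<forall>t\<in>T. norm (q (\<kappa> i) t - A t) < \<tau> / 2"
    proof (intro eventually_ball_finite T(1) ballI)
      fix t
      have "0 < \<tau> / 2" using \<tau> by simp
      from tendstoD[OF lim this] show "\<forall>\<^sub>F i in sequentially. norm (q (\<kappa> i) t - A t) < \<tau> / 2"
        by (simp only: dist_norm)
    qed
    thus "\<forall>\<^sub>F i in sequentially. \<forall>y\<in>cball 0 1.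
       norm (2 ^ \<kappa> i *\<^sub>R (F (x + (1 / 2 ^ \<kappa> i) *\<^sub>R y) - F x) - A y) \<le> \<tau>"
    proof eventually_elim
      case (elim i)
      show ?case
      proof
        fix y :: 'a assume "y \<in> cball 0 1"
        then obtain t where t: "t \<in> T" "norm (t - y) < s" using T(2) by (auto simp: dist_norm)
        have 1: "L * norm (t - y) \<le> \<tau> / 4"
          using t(2) s L by (smt (verit) mult_left_mono)
        have "q (\<kappa> i) y - A y = (q (\<kappa> i) t - A t) - (q (\<kappa> i) t - q (\<kappa> i) y) + (A t - A y)" by simp
        hence "norm (q (\<kappa> i) y - A y) \<le> norm (q (\<kappa> i) t - A t) + norm (q (\<kappa> i) t - q (\<kappa> i) y) + norm (A t - A y)"
          by (smt (verit) norm_triangle_ineq norm_triangle_ineq4)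
        also have "\<dots> \<le> \<tau>"
          using bspec[OF elim t(1)] 1 lipq[of "\<kappa> i" t y] lipA[of t y] by linarith
        finally show "norm (2 ^ \<kappa> i *\<^sub>R (F (x + (1 / 2 ^ \<kappa> i) *\<^sub>R y) - F x) - A y) \<le> \<tau>" by (simp add: q_def)
      qed
    qed
  qed
qed

lemma norm_fst_le_norm: "norm (fst z) \<le> norm z"
  using norm_fst_le[of "fst z" "snd z"] by simp

lemma norm_snd_le_norm: "norm (snd z) \<le> norm z"
  using norm_snd_le[of "snd z" "fst z"] by simp

lemma infdist_lessE:
  assumes "infdist x E < c" "E \<noteq> {}"
  obtains e where "e \<in> E" "dist x e < c"
  using assms by (auto simp: infdist_notempty cINF_less_iff)

lemma AE_second_difference_vector:
  fixes F :: "'a::euclidean_space \<Rightarrow> 'c::euclidean_space"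
  assumes lip: "L-lipschitz_on UNIV F" and supp: "\<And>x. R < norm x \<Longrightarrow> F x = 0"
  obtains N where "negligible N"
    "\<And>x y h. x \<notin> N \<Longrightarrow> (\<lambda>k. 2 ^ k *\<^sub>R (F (x + (1 / 2 ^ k) *\<^sub>R y + (2 / 2 ^ k) *\<^sub>R h)
            - 2 *\<^sub>R F (x + (1 / 2 ^ k) *\<^sub>R y + (1 / 2 ^ k) *\<^sub>R h) + F (x + (1 / 2 ^ k) *\<^sub>R y))) \<longlonglongrightarrow> 0"
proof -
  define Q where "Q x c \<longleftrightarrow> (\<forall>y h. (\<lambda>k. 2 ^ k * (F (x + (1 / 2 ^ k) *\<^sub>R y + (2 / 2 ^ k) *\<^sub>R h) \<bullet> c
            - 2 * (F (x + (1 / 2 ^ k) *\<^sub>R y + (1 / 2 ^ k) *\<^sub>R h) \<bullet> c) + F (x + (1 / 2 ^ k) *\<^sub>R y) \<bullet> c)) \<longlonglongrightarrow> 0)"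
    for x c
  have "AE x in lborel. Q x c" if c: "c \<in> Basis" for c
    unfolding Q_def
  proof (rule second_difference_AE_tendsto_all[where R = R and f = "\<lambda>x. F x \<bullet> c"])
    show "L-lipschitz_on UNIV (\<lambda>x. F x \<bullet> c)"
    proof (rule lipschitz_onI)
      fix x y
      have "dist (F x \<bullet> c) (F y \<bullet> c) \<le> norm (F x - F y)"
        using Basis_le_norm[OF c, of "F x - F y"] by (simp add: dist_real_def inner_diff_left)
      also have "\<dots> \<le> L * dist x y" using lipschitz_onD[OF lip, of x y] by (simp add: dist_norm)
      finally show "dist (F x \<bullet> c) (F y \<bullet> c) \<le> L * dist x y" .
    qed (rule lipschitz_on_nonneg[OF lip])
  qed (simp add: supp)
  hence "AE x in lborel. \<forall>c\<in>Basis. Q x c" by (auto simp: AE_ball_countable countable_finite)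
  then obtain N where N: "N \<in> null_sets lborel" "{x \<in> space lborel. \<not> (\<forall>c\<in>Basis. Q x c)} \<subseteq> N"
    unfolding eventually_ae_filter by blast
  show thesis
  proof (rule that)
    show "negligible N" using N(1) by (simp add: negligible_iff_null_sets null_sets_completionI)
    fix x y h assume "x \<notin> N"
    hence "\<forall>c\<in>Basis. Q x c" using N(2) by auto
    thus "(\<lambda>k. 2 ^ k *\<^sub>R (F (x + (1 / 2 ^ k) *\<^sub>R y + (2 / 2 ^ k) *\<^sub>R h)
            - 2 *\<^sub>R F (x + (1 / 2 ^ k) *\<^sub>R y + (1 / 2 ^ k) *\<^sub>R h) + F (x + (1 / 2 ^ k) *\<^sub>R y))) \<longlonglongrightarrow> 0"
      by (subst tendsto_componentwise_iff) (simp add: Q_def inner_diff_left inner_add_left)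
  qed
qed

text \<open>Extending each coordinate separately loses a dimensional factor in the Lipschitz
  constant, which is harmless since \<open>M\<close> is only asserted to exist.\<close>

lemma lipschitz_extension_bounded_support_vector:
  fixes p :: "'a::euclidean_space \<Rightarrow> 'b::euclidean_space"
  assumes E: "bounded E" and B: "\<And>x. x \<in> E \<Longrightarrow> norm (p x) \<le> B"
    and lip: "\<And>x y. x \<in> E \<Longrightarrow> y \<in> E \<Longrightarrow> norm (p x - p y) \<le> L * dist x y" and L: "0 < L"
  obtains M G R where "M-lipschitz_on UNIV G" "\<And>x. R < norm x \<Longrightarrow> G x = 0" "\<And>x. x \<in> E \<Longrightarrow> G x = p x"
proof -
  have "\<exists>G R. L-lipschitz_on UNIV G \<and> (\<forall>x. R < norm x \<longrightarrow> G x = 0) \<and> (\<forall>x\<in>E. G x = p x \<bullet> b)"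
    if b: "b \<in> Basis" for b
  proof (rule lipschitz_extension_bounded_support[OF E, of "\<lambda>x. p x \<bullet> b" B L])
    fix x assume "x \<in> E"
    thus "\<bar>p x \<bullet> b\<bar> \<le> B" using B[of x] Basis_le_norm[OF b, of "p x"] by linarith
  next
    fix x y assume "x \<in> E" "y \<in> E"
    thus "\<bar>p x \<bullet> b - p y \<bullet> b\<bar> \<le> L * dist x y"
      using lip[of x y] Basis_le_norm[OF b, of "p x - p y"] by (simp add: inner_diff_left)
  qed (use L in blast)+
  then obtain G R where G: "\<And>b. b \<in> Basis \<Longrightarrow> L-lipschitz_on UNIV (G b)"
      "\<And>b x. b \<in> Basis \<Longrightarrow> R b < norm x \<Longrightarrow> G b x = 0"
      "\<And>b x. b \<in> Basis \<Longrightarrow> x \<in> E \<Longrightarrow> G b x = p x \<bullet> b" by metis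
  show thesis
  proof (rule that[of "real DIM('b) * L" "\<lambda>x. \<Sum>b\<in>Basis. G b x *\<^sub>R b" "Max (R ` Basis)"])
    show "(real DIM('b) * L)-lipschitz_on UNIV (\<lambda>x. \<Sum>b\<in>Basis. G b x *\<^sub>R b)"
    proof (rule lipschitz_onI)
      fix x y
      have "dist (\<Sum>b\<in>Basis. G b x *\<^sub>R b) (\<Sum>b\<in>Basis. G b y *\<^sub>R b)
          = norm (\<Sum>b\<in>Basis. (G b x - G b y) *\<^sub>R b)"
        by (simp add: dist_norm scaleR_diff_left sum_subtractf)
      also have "\<dots> \<le> (\<Sum>b\<in>(Basis::'b set). L * dist x y)"
        using lipschitz_onD[OF G(1)] by (intro sum_norm_le) (auto simp: dist_real_def)
      finally show "dist (\<Sum>b\<in>Basis. G b x *\<^sub>R b) (\<Sum>b\<in>Basis. G b y *\<^sub>R b) \<le> real DIM('b) * L * dist x y"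
        by simp
    qed (use L in simp)
  next
    fix x :: 'a assume "Max (R ` Basis) < norm x"
    thus "(\<Sum>b\<in>Basis. G b x *\<^sub>R b) = 0" by (intro sum.neutral) (auto simp: G(2))
  next
    fix x assume "x \<in> E"
    thus "(\<Sum>b\<in>Basis. G b x *\<^sub>R b) = p x" by (simp add: G(3) euclidean_representation)
  qed
qed

text \<open>The points \<open>e\<close> replace \<open>x + 2\<^sup>-\<^sup>k y\<close>, which need not lie in \<open>E\<close>. The linear map depends on the
  subsequence \<open>\<kappa>\<close>.\<close>

definition dyadic_derivative ::
    "'a::euclidean_space set \<Rightarrow> ('a \<Rightarrow> 'b::euclidean_space) \<Rightarrow> 'a \<Rightarrow> ('a \<Rightarrow> 'b) \<Rightarrow> (nat \<Rightarrow> nat) \<Rightarrow> bool" where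
  "dyadic_derivative E p x A \<kappa> \<longleftrightarrow> linear A \<and> strict_mono \<kappa> \<and>
     (\<forall>\<tau>>0. \<forall>\<^sub>F i in sequentially. \<forall>y\<in>cball 0 1. \<exists>e\<in>E.
        norm (x + (1 / 2 ^ \<kappa> i) *\<^sub>R y - e) \<le> \<tau> / 2 ^ \<kappa> i \<and>
        norm (p e - p x - (1 / 2 ^ \<kappa> i) *\<^sub>R A y) \<le> \<tau> / 2 ^ \<kappa> i)"

text \<open>Meant for the projections of a pair: both components inherit one and the same
  subsequence \<open>\<kappa>\<close>.\<close>

lemma dyadic_derivative_compose:
  assumes der: "dyadic_derivative E p x A \<kappa>" and L: "linear L" and le: "\<And>z. norm (L z) \<le> norm z"
  shows "dyadic_derivative E (\<lambda>x. L (p x)) x (\<lambda>y. L (A y)) \<kappa>"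
  unfolding dyadic_derivative_def
proof (intro conjI allI impI)
  show "linear (\<lambda>y. L (A y))"
    using der linear_compose[of A L] L by (simp add: dyadic_derivative_def o_def)
  show "strict_mono \<kappa>" using der by (simp add: dyadic_derivative_def)
  fix \<tau> :: real assume "0 < \<tau>"
  hence "\<forall>\<^sub>F i in sequentially. \<forall>y\<in>cball 0 1. \<exists>e\<in>E.
        norm (x + (1 / 2 ^ \<kappa> i) *\<^sub>R y - e) \<le> \<tau> / 2 ^ \<kappa> i \<and>
        norm (p e - p x - (1 / 2 ^ \<kappa> i) *\<^sub>R A y) \<le> \<tau> / 2 ^ \<kappa> i"
    using der by (simp add: dyadic_derivative_def)
  thus "\<forall>\<^sub>F i in sequentially. \<forall>y\<in>cball 0 1. \<exists>e\<in>E.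
        norm (x + (1 / 2 ^ \<kappa> i) *\<^sub>R y - e) \<le> \<tau> / 2 ^ \<kappa> i \<and>
        norm (L (p e) - L (p x) - (1 / 2 ^ \<kappa> i) *\<^sub>R L (A y)) \<le> \<tau> / 2 ^ \<kappa> i"
  proof eventually_elim
    case (elim i)
    show ?case
    proof
    fix y :: 'a assume y: "y \<in> cball 0 1"
    from bspec[OF elim y] obtain e where e: "e \<in> E" "norm (x + (1 / 2 ^ \<kappa> i) *\<^sub>R y - e) \<le> \<tau> / 2 ^ \<kappa> i"
        "norm (p e - p x - (1 / 2 ^ \<kappa> i) *\<^sub>R A y) \<le> \<tau> / 2 ^ \<kappa> i" by auto
    have "norm (L (p e) - L (p x) - (1 / 2 ^ \<kappa> i) *\<^sub>R L (A y)) \<le> \<tau> / 2 ^ \<kappa> i"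
      using le[of "p e - p x - (1 / 2 ^ \<kappa> i) *\<^sub>R A y"] e(3)
      by (simp add: linear_diff[OF L] linear_scale[OF L])
    thus "\<exists>e\<in>E. norm (x + (1 / 2 ^ \<kappa> i) *\<^sub>R y - e) \<le> \<tau> / 2 ^ \<kappa> i \<and>
        norm (L (p e) - L (p x) - (1 / 2 ^ \<kappa> i) *\<^sub>R L (A y)) \<le> \<tau> / 2 ^ \<kappa> i"
      using e by blast
    qed
  qed
qed

text \<open>The extension of \<open>p\<close> and the truncated distance to \<open>E\<close> are
  blown up together. The first component supplies the linear map. Vanishing of the second says that
  \<open>E\<close> has points within \<open>o(2^-k)\<close> of \<open>x + 2^-k y\<close> along the
  subsequence, and at such points the extension is \<open>p\<close> itself.\<close>

lemma lipschitz_blowup_AE: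
  fixes p :: "'a::euclidean_space \<Rightarrow> 'b::euclidean_space"
  assumes E: "bounded E" and B: "\<And>x. x \<in> E \<Longrightarrow> norm (p x) \<le> B"
    and lip: "\<And>x y. x \<in> E \<Longrightarrow> y \<in> E \<Longrightarrow> norm (p x - p y) \<le> L * dist x y" and L: "0 < L"
  obtains N where "negligible N"
    "\<And>x. x \<in> E \<Longrightarrow> x \<notin> N \<Longrightarrow> \<exists>A \<kappa>. dyadic_derivative E p x A \<kappa>"
proof -
  obtain M G R where G: "M-lipschitz_on UNIV G" "\<And>x. R < norm x \<Longrightarrow> G x = 0" "\<And>x. x \<in> E \<Longrightarrow> G x = p x"
    using lipschitz_extension_bounded_support_vector[OF E B lip L] by blast
  \<comment> \<open>The distance has no bounded support, so it is kept only on the unit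
    neighbourhood, which contains all points \<open>x + 2^-k y\<close>. The conjunct
    \<open>E \<noteq> {}\<close> secures boundedness, because \<open>infdist\<close> to the empty
    set is zero.\<close>
  define E' where "E' = {x. infdist x E \<le> 1 \<and> E \<noteq> {}}"
  obtain R0 where R0: "\<And>x. x \<in> E \<Longrightarrow> norm x \<le> R0" using E by (auto simp: bounded_iff)
  have "bounded E'"
    unfolding bounded_iff
  proof (intro exI ballI)
    fix x assume x: "x \<in> E'"
    hence "infdist x E < 2" "E \<noteq> {}" by (auto simp: E'_def)
    then obtain e where "e \<in> E" "dist x e < 2" by (rule infdist_lessE)
    thus "norm x \<le> R0 + 2" using R0[of e] norm_triangle_ineq2[of x e] by (simp add: dist_norm)
  qed
  have "\<bar>infdist x E\<bar> \<le> 1" if "x \<in> E'" for x using that by (simp add: E'_def infdist_nonneg)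
  moreover have "\<bar>infdist x E - infdist y E\<bar> \<le> 1 * dist x y" for x y
    using infdist_triangle[of x E y] infdist_triangle[of y E x] by (simp add: dist_commute)
  ultimately obtain D R' where D: "1-lipschitz_on UNIV D" "\<And>x. R' < norm x \<Longrightarrow> D x = 0"
      "\<And>x. x \<in> E' \<Longrightarrow> D x = infdist x E"
    by (rule lipschitz_extension_bounded_support[OF \<open>bounded E'\<close>, of "\<lambda>x. infdist x E" 1 1]) auto
  \<comment> \<open>The distance to \<open>E\<close> is nonnegative and vanishes at \<open>x\<close>, so its linear blow-up limit is zero. This
    replaces Lebesgue's density theorem.\<close>
  define F where "F x = (G x, D x)" for x
  have M: "0 \<le> M" using G(1) by (rule lipschitz_on_nonneg)
  have lipF: "(M + 1)-lipschitz_on UNIV F"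
  proof (rule lipschitz_onI)
    fix x y
    have "dist (F x) (F y) \<le> dist (G x) (G y) + dist (D x) (D y)"
      unfolding F_def dist_Pair_Pair by (rule sqrt_sum_squares_le_sum) auto
    also have "\<dots> \<le> M * dist x y + 1 * dist x y"
      by (intro add_mono lipschitz_onD[OF G(1)] lipschitz_onD[OF D(1)]) auto
    finally show "dist (F x) (F y) \<le> (M + 1) * dist x y" by (simp add: algebra_simps)
  qed (use M in simp)
  have suppF: "F x = 0" if "max R R' < norm x" for x
    using that by (simp add: F_def G(2) D(2) zero_prod_def)
  obtain N where N: "negligible N"
    "\<And>x y h. x \<notin> N \<Longrightarrow> (\<lambda>k. 2 ^ k *\<^sub>R (F (x + (1 / 2 ^ k) *\<^sub>R y + (2 / 2 ^ k) *\<^sub>R h)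
            - 2 *\<^sub>R F (x + (1 / 2 ^ k) *\<^sub>R y + (1 / 2 ^ k) *\<^sub>R h) + F (x + (1 / 2 ^ k) *\<^sub>R y))) \<longlonglongrightarrow> 0"
    using AE_second_difference_vector[OF lipF suppF] by blast
  show thesis
  proof (rule that[OF N(1)])
    fix x assume x: "x \<in> E" and "x \<notin> N"
    obtain A \<kappa> where A: "linear A" "strict_mono (\<kappa> :: nat \<Rightarrow> nat)"
      and lim: "\<And>\<tau>. 0 < \<tau> \<Longrightarrow> \<forall>\<^sub>F i in sequentially. \<forall>y\<in>cball 0 1.
         norm (2 ^ \<kappa> i *\<^sub>R (F (x + (1 / 2 ^ \<kappa> i) *\<^sub>R y) - F x) - A y) \<le> \<tau>"
      using blowup_uniform_linear_limit[OF lipF N(2)[OF \<open>x \<notin> N\<close>]] by blast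
    have inE': "x + (1 / 2 ^ k) *\<^sub>R y \<in> E'" if "y \<in> cball 0 1" for k :: nat and y
    proof -
      have "infdist (x + (1 / 2 ^ k) *\<^sub>R y) E \<le> dist (x + (1 / 2 ^ k) *\<^sub>R y) x"
        using x by (intro infdist_le) auto
      also have "\<dots> = norm y / 2 ^ k" by (simp add: dist_norm)
      also have "\<dots> \<le> 1" using that by (simp add: divide_le_eq order_trans[OF _ one_le_power])
      finally show ?thesis using x by (auto simp: E'_def)
    qed
    have Dx: "D x = 0" using inE'[of 0 0] D(3)[of x] x by simp
    have Dpos: "0 \<le> D (x + (1 / 2 ^ k) *\<^sub>R y)" if "y \<in> cball 0 1" for k :: nat and y
      using D(3)[OF inE'[OF that]] by (simp add: infdist_nonneg)
    have sndA_ge: "0 \<le> snd (A y)" if y: "y \<in> cball 0 1" for y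
    proof (rule field_le_epsilon)
      fix \<tau> :: real assume "0 < \<tau>"
      have "\<exists>n. \<forall>i\<ge>n. \<forall>y\<in>cball 0 1.
          norm (2 ^ \<kappa> i *\<^sub>R (F (x + (1 / 2 ^ \<kappa> i) *\<^sub>R y) - F x) - A y) \<le> \<tau>"
        using lim[OF \<open>0 < \<tau>\<close>] by (simp only: eventually_sequentially)
      then obtain i where i: "\<forall>y\<in>cball 0 1.
          norm (2 ^ \<kappa> i *\<^sub>R (F (x + (1 / 2 ^ \<kappa> i) *\<^sub>R y) - F x) - A y) \<le> \<tau>"
        by (meson order_refl)
      have "norm (2 ^ \<kappa> i *\<^sub>R (F (x + (1 / 2 ^ \<kappa> i) *\<^sub>R y) - F x) - A y) \<le> \<tau>"
        by (rule bspec[OF i y])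
      hence "norm (snd (2 ^ \<kappa> i *\<^sub>R (F (x + (1 / 2 ^ \<kappa> i) *\<^sub>R y) - F x) - A y)) \<le> \<tau>"
        by (rule order_trans[OF norm_snd_le_norm])
      hence "\<bar>2 ^ \<kappa> i * D (x + (1 / 2 ^ \<kappa> i) *\<^sub>R y) - snd (A y)\<bar> \<le> \<tau>" by (simp add: F_def Dx)
      moreover have "0 \<le> 2 ^ \<kappa> i * D (x + (1 / 2 ^ \<kappa> i) *\<^sub>R y)" using Dpos[OF y] by simp
      ultimately show "0 \<le> snd (A y) + \<tau>" by linarith
    qed
    have sndA: "snd (A y) = 0" if y: "y \<in> cball 0 1" for y
      using sndA_ge[OF y] sndA_ge[of "- y"] y linear_neg[OF A(1), of y] by simp
    have "\<forall>\<^sub>F i in sequentially. \<forall>y\<in>cball 0 1. \<exists>e\<in>E.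
          norm (x + (1 / 2 ^ \<kappa> i) *\<^sub>R y - e) \<le> \<tau> / 2 ^ \<kappa> i \<and>
          norm (p e - p x - (1 / 2 ^ \<kappa> i) *\<^sub>R fst (A y)) \<le> \<tau> / 2 ^ \<kappa> i" if \<tau>: "0 < \<tau>" for \<tau>
    proof -
      \<comment> \<open>Since \<open>infdist X E\<close> is at most \<open>s / 2 ^ k\<close>, a
        point of \<open>E\<close> lies within twice that. Up to the factor \<open>1 / 2 ^ k\<close>,
        moving there costs \<open>2 * M * s\<close> and the linear approximation \<open>s\<close>,
        together at most \<open>\<tau>\<close>.\<close>
      define s where "s = \<tau> / (2 * (M + 1))"
      have s: "0 < s" using \<tau> M by (simp add: s_def)
      have s2: "2 * (M + 1) * s = \<tau>" unfolding s_def using M by (simp del: distrib_left_numeral)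
      have Ms: "0 \<le> M * s" using M s by simp
      from lim[OF s] show ?thesis
      proof eventually_elim
        case (elim i)
        show ?case
        proof
          fix y :: 'a assume y: "y \<in> cball 0 1"
          define k where "k = \<kappa> i"
          define X where "X = x + (1 / 2 ^ k) *\<^sub>R y"
          have n: "norm (2 ^ k *\<^sub>R (F X - F x) - A y) \<le> s" using elim y by (simp add: k_def X_def)
          have "norm (snd (2 ^ k *\<^sub>R (F X - F x) - A y)) \<le> s" by (rule order_trans[OF norm_snd_le_norm n])
          hence "2 ^ k * D X \<le> s" by (simp add: F_def Dx sndA[OF y])
          hence "D X \<le> s / 2 ^ k" by (simp add: field_simps)
          hence "infdist X E \<le> s / 2 ^ k" using D(3)[OF inE'[OF y]] by (simp add: X_def)
          also have "\<dots> < 2 * s / 2 ^ k" using s by (simp add: field_simps)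
          finally obtain e where e: "e \<in> E" "dist X e < 2 * s / 2 ^ k"
            using x by (auto elim: infdist_lessE)
          have "norm (fst (2 ^ k *\<^sub>R (F X - F x) - A y)) \<le> s" by (rule order_trans[OF norm_fst_le_norm n])
          hence f: "norm (2 ^ k *\<^sub>R (G X - p x) - fst (A y)) \<le> s" using x by (simp add: F_def G(3))
          have "norm (p e - p x - (1 / 2 ^ k) *\<^sub>R fst (A y))
              \<le> norm (G e - G X) + norm (G X - p x - (1 / 2 ^ k) *\<^sub>R fst (A y))"
            using norm_triangle_ineq[of "G e - G X" "G X - p x - (1 / 2 ^ k) *\<^sub>R fst (A y)"] e(1)
            by (simp add: G(3) algebra_simps)
          also have "norm (G e - G X) \<le> M * (2 * s / 2 ^ k)"
          proof -
            have "norm (G e - G X) \<le> M * dist X e"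
              using lipschitz_onD[OF G(1), of e X] by (simp add: dist_norm norm_minus_commute)
            also have "\<dots> \<le> M * (2 * s / 2 ^ k)" using e(2) M by (intro mult_left_mono) auto
            finally show ?thesis .
          qed
          also have "G X - p x - (1 / 2 ^ k) *\<^sub>R fst (A y) = (1 / 2 ^ k) *\<^sub>R (2 ^ k *\<^sub>R (G X - p x) - fst (A y))"
            by (simp add: algebra_simps)
          also have "norm \<dots> \<le> s / 2 ^ k" using f by (simp add: divide_right_mono)
          also have "M * (2 * s / 2 ^ k) + s / 2 ^ k = (2 * (M * s) + s) / 2 ^ k"
            by (simp add: add_divide_distrib)
          also have "\<dots> \<le> \<tau> / 2 ^ k" using s2 s by (intro divide_right_mono) (auto simp: algebra_simps)
          finally have "norm (p e - p x - (1 / 2 ^ k) *\<^sub>R fst (A y)) \<le> \<tau> / 2 ^ k" by simp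
          moreover have "2 * s / 2 ^ k \<le> \<tau> / 2 ^ k"
            using s2 Ms by (intro divide_right_mono) (auto simp: algebra_simps)
          hence "norm (X - e) \<le> \<tau> / 2 ^ k" using e(2) by (simp add: dist_norm)
          ultimately show "\<exists>e\<in>E. norm (x + (1 / 2 ^ \<kappa> i) *\<^sub>R y - e) \<le> \<tau> / 2 ^ \<kappa> i \<and>
            norm (p e - p x - (1 / 2 ^ \<kappa> i) *\<^sub>R fst (A y)) \<le> \<tau> / 2 ^ \<kappa> i"
            using e(1) by (auto simp: X_def k_def)
        qed
      qed
    qed
    moreover have "linear (\<lambda>y. fst (A y))"
      using linear_compose[OF A(1) linear_fst] by (simp add: o_def)
    ultimately have "dyadic_derivative E p x (\<lambda>y. fst (A y)) \<kappa>"
      using A(2) by (simp add: dyadic_derivative_def)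
    thus "\<exists>A \<kappa>. dyadic_derivative E p x A \<kappa>" by blast
  qed
qed

section \<open>Semijets at interior maxima\<close>

text \<open>A second-order Taylor expansion with gradient \<open>p\<close> and Hessian
  \<open>A\<close>, but only on the balls of radius \<open>1 / 2 ^ \<kappa> i\<close>. It takes the
  place of Alexandrov's pointwise expansion.\<close>

definition dyadic_expansion ::
    "('a::euclidean_space \<Rightarrow> real) \<Rightarrow> 'a \<Rightarrow> 'a \<Rightarrow> ('a \<Rightarrow> 'a) \<Rightarrow> (nat \<Rightarrow> nat) \<Rightarrow> bool" where
  "dyadic_expansion f x p A \<kappa> \<longleftrightarrow> (\<forall>\<eta>>0. \<forall>\<^sub>F i in sequentially. \<forall>y\<in>cball 0 1.
    \<bar>f (x + (1 / 2 ^ \<kappa> i) *\<^sub>R y) - f x - (1 / 2 ^ \<kappa> i) * (p \<bullet> y) - (1 / 2 ^ \<kappa> i)\<^sup>2 * (A y \<bullet> y) / 2\<bar>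
      \<le> \<eta> * (1 / 2 ^ \<kappa> i)\<^sup>2)"

lemma dyadic_scale_eventually_less:
  assumes "strict_mono (\<kappa> :: nat \<Rightarrow> nat)" and "0 < \<rho>"
  shows "\<forall>\<^sub>F i in sequentially. 1 / 2 ^ \<kappa> i < (\<rho>::real)"
proof -
  have "filterlim \<kappa> at_top sequentially" by (rule filterlim_subseq[OF assms(1)])
  hence "(\<lambda>i. (1 / 2) ^ \<kappa> i :: real) \<longlonglongrightarrow> 0"
    by (intro filterlim_compose[OF LIMSEQ_power_zero]) auto
  hence "\<forall>\<^sub>F i in sequentially. (1 / 2) ^ \<kappa> i < \<rho>" using assms(2) by (intro order_tendstoD(2)) auto
  thus ?thesis by (simp add: power_divide)
qed

text \<open>The gradient \<open>p\<close> is known on \<open>E\<close> only, so it cannot be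
  integrated along a segment. The segment is cut into \<open>m\<close> pieces; on each,
  \<open>f\<close> is compared with its first-order expansion at a nearby point of \<open>E\<close>,
  where \<open>p\<close> equals \<open>p x\<close> plus the linear term up to the step length. The
  resulting Riemann sum yields half the quadratic form.\<close>

lemma dyadic_expansion_of_dyadic_derivative:
  fixes f :: "'a::euclidean_space \<Rightarrow> real"
  assumes par: "\<And>X h. X \<in> E \<Longrightarrow> norm h < \<rho> \<Longrightarrow> \<bar>f (X + h) - f X - p X \<bullet> h\<bar> \<le> L * (norm h)\<^sup>2"
    and \<rho>: "0 < \<rho>" and L: "0 \<le> L" and der: "dyadic_derivative E p x A \<kappa>"
  shows "dyadic_expansion f x (p x) A \<kappa>"
  unfolding dyadic_expansion_def
proof (intro allI impI)
  fix \<eta> :: real assume \<eta>: "0 < \<eta>"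
  have A: "linear A" and \<kappa>: "strict_mono \<kappa>"
    and near: "\<And>\<tau>. 0 < \<tau> \<Longrightarrow> \<forall>\<^sub>F i in sequentially. \<forall>y\<in>cball 0 1. \<exists>e\<in>E.
          norm (x + (1 / 2 ^ \<kappa> i) *\<^sub>R y - e) \<le> \<tau> / 2 ^ \<kappa> i \<and>
          norm (p e - p x - (1 / 2 ^ \<kappa> i) *\<^sub>R A y) \<le> \<tau> / 2 ^ \<kappa> i"
    using der by (auto simp: dyadic_derivative_def)
  obtain K where K: "0 < K" "\<And>y. norm (A y) \<le> K * norm y"
    using linear_bounded_pos[OF A] by (auto simp: mult.commute)
  \<comment> \<open>Each of the \<open>m\<close> steps contributes an error
    \<open>(5 * L + 1) * (r / m)^2\<close>, and the Riemann sum misses the integral by at most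
    \<open>K * r^2 / m\<close>; this \<open>m\<close> brings the total below
    \<open>\<eta> * r^2\<close>.\<close>
  obtain m :: nat where m: "(5 * L + 1 + K) / \<eta> < real m" using reals_Archimedean2 by blast
  have m0: "0 < real m" using m \<eta> L K(1) by (smt (verit) divide_nonneg_pos)
  have "\<forall>\<^sub>F i in sequentially. 1 / 2 ^ \<kappa> i < \<rho> * real m / 2"
    using \<rho> m0 by (intro dyadic_scale_eventually_less \<kappa>) simp
  moreover have "\<forall>\<^sub>F i in sequentially. \<forall>y\<in>cball 0 1. \<exists>e\<in>E.
          norm (x + (1 / 2 ^ \<kappa> i) *\<^sub>R y - e) \<le> (1 / real m) / 2 ^ \<kappa> i \<and>
          norm (p e - p x - (1 / 2 ^ \<kappa> i) *\<^sub>R A y) \<le> (1 / real m) / 2 ^ \<kappa> i"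
    using m0 by (intro near) simp
  ultimately show "\<forall>\<^sub>F i in sequentially. \<forall>y\<in>cball 0 1.
    \<bar>f (x + (1 / 2 ^ \<kappa> i) *\<^sub>R y) - f x - (1 / 2 ^ \<kappa> i) * (p x \<bullet> y) - (1 / 2 ^ \<kappa> i)\<^sup>2 * (A y \<bullet> y) / 2\<bar>
      \<le> \<eta> * (1 / 2 ^ \<kappa> i)\<^sup>2"
  proof eventually_elim
    case (elim i)
    note small = elim(1) and ex = elim(2)
    define r :: real where "r = 1 / 2 ^ \<kappa> i"
    have r: "0 < r" by (simp add: r_def)
    have r_small: "2 * (r / m) < \<rho>" using small m0 by (simp add: r_def field_simps power_divide)
    show ?case
      unfolding r_def[symmetric]
    proof
      fix y :: 'a assume "y \<in> cball 0 1"
      hence y: "norm y \<le> 1" by simp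
      define X where "X l = x + (r * (real l / m)) *\<^sub>R y" for l :: nat
      define Q where "Q = A y \<bullet> y"
      \<comment> \<open>The chosen \<open>e\<close> is within \<open>s\<close> of
        \<open>X l\<close>, hence within \<open>2 * s\<close> of \<open>X (Suc l)\<close>: the two
        first-order expansions cost \<open>L\<close> and \<open>4 * L\<close>, the error in
        \<open>p e\<close> costs \<open>1\<close>, all times \<open>s^2\<close>.\<close>
      have step: "\<bar>f (X (Suc l)) - f (X l) - (r / m) * (p x \<bullet> y) - (r / m)\<^sup>2 * real l * Q\<bar>
          \<le> (5 * L + 1) * (r / m)\<^sup>2" if l: "l < m" for l
      proof -
        define s where "s = r / m"
        have s: "0 < s" using r m0 by (simp add: s_def)
        have "norm ((real l / m) *\<^sub>R y) \<le> 1"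
        proof -
          have "real l * norm y \<le> real m * 1" using l y by (intro mult_mono) auto
          thus ?thesis using m0 by (simp add: divide_le_eq)
        qed
        hence "(real l / m) *\<^sub>R y \<in> cball 0 1" by simp
        from bspec[OF ex this] obtain e where e: "e \<in> E" "norm (x + r *\<^sub>R ((real l / m) *\<^sub>R y) - e) \<le> s"
            "norm (p e - p x - r *\<^sub>R A ((real l / m) *\<^sub>R y)) \<le> s"
          by (auto simp: r_def s_def mult.commute)
        have e2: "norm (X l - e) \<le> s" using e(2) by (simp add: X_def)
        have Xs: "X (Suc l) = X l + s *\<^sub>R y"
          by (simp add: X_def s_def add_divide_distrib algebra_simps)
        have sy: "norm (s *\<^sub>R y) \<le> s" using s y by (simp add: mult_left_le)
        have e3: "norm (X (Suc l) - e) \<le> 2 * s"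
          using norm_triangle_ineq[of "X l - e" "s *\<^sub>R y"] e2 sy by (simp add: Xs algebra_simps)
        have "\<bar>f (e + (X (Suc l) - e)) - f e - p e \<bullet> (X (Suc l) - e)\<bar> \<le> L * (norm (X (Suc l) - e))\<^sup>2"
          using e3 r_small by (intro par e(1)) (simp add: s_def)
        also have "\<dots> \<le> L * (2 * s)\<^sup>2" using e3 L by (intro mult_left_mono power_mono) auto
        finally have 1: "\<bar>f (X (Suc l)) - f e - p e \<bullet> (X (Suc l) - e)\<bar> \<le> L * (2 * s)\<^sup>2" by simp
        have "\<bar>f (e + (X l - e)) - f e - p e \<bullet> (X l - e)\<bar> \<le> L * (norm (X l - e))\<^sup>2"
          using e2 r_small s by (intro par e(1)) (simp add: s_def)
        also have "\<dots> \<le> L * s\<^sup>2" using e2 L by (intro mult_left_mono power_mono) auto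
        finally have 2: "\<bar>f (X l) - f e - p e \<bullet> (X l - e)\<bar> \<le> L * s\<^sup>2" by simp
        have "\<bar>(p e - p x - r *\<^sub>R A ((real l / m) *\<^sub>R y)) \<bullet> (s *\<^sub>R y)\<bar> \<le> s * s"
          by (rule order_trans[OF Cauchy_Schwarz_ineq2 mult_mono[OF e(3) sy]]) (use s in auto)
        moreover have "(p e - p x - r *\<^sub>R A ((real l / m) *\<^sub>R y)) \<bullet> (s *\<^sub>R y)
             = p e \<bullet> (s *\<^sub>R y) - s * (p x \<bullet> y) - s\<^sup>2 * real l * Q"
          using linear_scale[OF A]
          by (simp add: inner_diff_left Q_def s_def power2_eq_square algebra_simps)
        ultimately have 3: "\<bar>p e \<bullet> (s *\<^sub>R y) - s * (p x \<bullet> y) - s\<^sup>2 * real l * Q\<bar> \<le> s\<^sup>2"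
          by (simp add: power2_eq_square)
        have "p e \<bullet> (X (Suc l) - e) = p e \<bullet> (X l - e) + p e \<bullet> (s *\<^sub>R y)"
          by (simp add: Xs inner_diff_right inner_add_right)
        moreover have "L * (2 * s)\<^sup>2 + L * s\<^sup>2 + s\<^sup>2 = (5 * L + 1) * s\<^sup>2"
          by (simp add: power_mult_distrib algebra_simps)
        ultimately show ?thesis using 1 2 3 unfolding s_def[symmetric] by linarith
      qed
      have "\<bar>f (X l) - f x - real l * (r / m) * (p x \<bullet> y) - (r / m)\<^sup>2 * (real l * (real l - 1) / 2) * Q\<bar>
          \<le> real l * ((5 * L + 1) * (r / m)\<^sup>2)" if "l \<le> m" for l
        using that
      proof (induction l)
        case 0 thus ?case by (simp add: X_def)
      next
        case (Suc l)
        have "real (Suc l) * (real (Suc l) - 1) / 2 = real l * (real l - 1) / 2 + real l"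
          by (simp add: field_simps)
        hence "(r / m)\<^sup>2 * (real (Suc l) * (real (Suc l) - 1) / 2) * Q
            = (r / m)\<^sup>2 * (real l * (real l - 1) / 2) * Q + (r / m)\<^sup>2 * real l * Q"
          by (simp only: distrib_left distrib_right)
        moreover have "real (Suc l) * (r / m) * (p x \<bullet> y) = real l * (r / m) * (p x \<bullet> y) + (r / m) * (p x \<bullet> y)"
          by (simp add: algebra_simps add_divide_distrib)
        moreover have "real (Suc l) * ((5 * L + 1) * (r / m)\<^sup>2) = real l * ((5 * L + 1) * (r / m)\<^sup>2) + (5 * L + 1) * (r / m)\<^sup>2"
          by (simp add: algebra_simps)
        ultimately show ?case using Suc.IH step[of l] Suc.prems by linarith
      qed
      note sum_steps = this[of m, OF order_refl]
      have main: "\<bar>f (x + r *\<^sub>R y) - f x - r * (p x \<bullet> y) - (r\<^sup>2 / 2 - r\<^sup>2 / (2 * m)) * Q\<bar>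
          \<le> (5 * L + 1) * r\<^sup>2 / m"
      proof -
        have "X m = x + r *\<^sub>R y" "real m * (r / m) = r" using m0 by (simp_all add: X_def)
        moreover have "(r / m)\<^sup>2 * (real m * (real m - 1) / 2) = r\<^sup>2 / 2 - r\<^sup>2 / (2 * m)"
          using m0 by (simp add: power2_eq_square field_simps)
        moreover have "real m * ((5 * L + 1) * (r / m)\<^sup>2) = (5 * L + 1) * r\<^sup>2 / m"
          using m0 by (simp add: power2_eq_square)
        ultimately show ?thesis using sum_steps by (simp only:)
      qed
      have "\<bar>Q\<bar> \<le> K"
      proof -
        have "\<bar>Q\<bar> \<le> (K * norm y) * norm y"
          unfolding Q_def by (rule order_trans[OF Cauchy_Schwarz_ineq2 mult_right_mono[OF K(2)]]) simp
        also have "\<dots> \<le> (K * 1) * 1" using K(1) y by (intro mult_mono) auto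
        finally show ?thesis by simp
      qed
      hence "\<bar>r\<^sup>2 / (2 * m) * Q\<bar> \<le> r\<^sup>2 / (2 * m) * K"
        using r m0 by (simp add: abs_mult divide_right_mono mult_left_mono)
      also have "\<dots> \<le> K * r\<^sup>2 / m" using K(1) m0 by (simp add: field_simps)
      finally have Q: "\<bar>r\<^sup>2 / (2 * m) * Q\<bar> \<le> K * r\<^sup>2 / m" .
      have "\<bar>f (x + r *\<^sub>R y) - f x - r * (p x \<bullet> y) - r\<^sup>2 * Q / 2\<bar> \<le> (5 * L + 1) * r\<^sup>2 / m + K * r\<^sup>2 / m"
      proof -
        have "(r\<^sup>2 / 2 - r\<^sup>2 / (2 * m)) * Q = r\<^sup>2 * Q / 2 - r\<^sup>2 / (2 * m) * Q"
          by (simp add: left_diff_distrib)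
        thus ?thesis using main Q by linarith
      qed
      also have "\<dots> = (5 * L + 1 + K) / m * r\<^sup>2" by (simp add: algebra_simps add_divide_distrib)
      also have "\<dots> \<le> \<eta> * r\<^sup>2" using m m0 \<eta> by (intro mult_right_mono) (auto simp: field_simps)
      finally show "\<bar>f (x + r *\<^sub>R y) - f x - r * (p x \<bullet> y) - r\<^sup>2 * (A y \<bullet> y) / 2\<bar> \<le> \<eta> * r\<^sup>2"
        by (simp add: Q_def)
    qed
  qed
qed

text \<open>\<open>B\<close> is not required to be symmetric: only its quadratic form matters. Lower semijets of \<open>u\<close> are
  expressed as upper semijets of \<open>- u\<close>.\<close>

definition upper_jet :: "('a::euclidean_space \<Rightarrow> real) \<Rightarrow> 'a \<Rightarrow> 'a \<Rightarrow> ('a \<Rightarrow> 'a) \<Rightarrow> bool" where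
  "upper_jet u Y a B \<longleftrightarrow> linear B \<and>
     (\<exists>e>0. \<forall>h. norm h < e \<longrightarrow> u (Y + h) \<le> u Y + a \<bullet> h + (B h \<bullet> h) / 2)"

text \<open>On the sphere of radius \<open>r\<close> the added \<open>\<delta> / 2 * r^2\<close>
  beats the error \<open>\<delta> / 4 * r^2\<close>, so \<open>f\<close> minus the paraboloid
  attains its maximum over the ball in the interior. Re-expanding the paraboloid there keeps
  \<open>B\<close> and shifts the gradient by the symmetric part of \<open>B\<close> applied to
  \<open>k\<close>.\<close>

lemma upper_jet_of_expansion:
  fixes f :: "'a::euclidean_space \<Rightarrow> real"
  assumes cont: "continuous_on (cball x r) f" and A: "linear A" and r: "0 < r" and \<delta>: "0 < \<delta>"
    and exp: "\<And>h. norm h \<le> r \<Longrightarrow> f (x + h) \<le> f x + p \<bullet> h + (A h \<bullet> h) / 2 + \<delta> / 4 * r\<^sup>2"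
  defines "B \<equiv> \<lambda>h. A h + \<delta> *\<^sub>R h"
  obtains k where "norm k < r" "upper_jet f (x + k) (p + (1/2) *\<^sub>R (B k + adjoint B k)) B"
proof -
  have B: "linear B" unfolding B_def by (intro linear_compose_add A linear_scale_self)
  define \<phi> where "\<phi> h = p \<bullet> h + (B h \<bullet> h) / 2" for h
  have "continuous_on (cball 0 r) (\<lambda>h. f (x + h) - \<phi> h)"
    unfolding \<phi>_def
    by (intro continuous_intros linear_continuous_on_compose[OF _ B] continuous_on_compose2[OF cont]) auto
  moreover have "cball 0 r \<noteq> ({} :: 'a set)" using r by auto
  ultimately obtain k where k: "k \<in> cball 0 r" "\<And>h. h \<in> cball 0 r \<Longrightarrow> f (x + h) - \<phi> h \<le> f (x + k) - \<phi> k"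
    using continuous_attains_sup[OF compact_cball] by (metis (no_types, lifting))
  have "norm k < r"
  proof (rule ccontr)
    assume "\<not> norm k < r"
    hence kr: "norm k = r" using k(1) by simp
    have "f (x + k) - \<phi> k \<le> f x + \<delta> / 4 * r\<^sup>2 - \<delta> * r\<^sup>2 / 2"
      using exp[of k] kr by (simp add: \<phi>_def B_def inner_add_left add_divide_distrib power2_norm_eq_inner[symmetric])
    moreover have "f x \<le> f (x + k) - \<phi> k" using k(2)[of 0] r linear_0[OF B] by (simp add: \<phi>_def)
    moreover have "0 < \<delta> * r\<^sup>2" using \<delta> r by simp
    ultimately show False by simp
  qed
  moreover have "f (x + k + h) \<le> f (x + k) + (p + (1/2) *\<^sub>R (B k + adjoint B k)) \<bullet> h + (B h \<bullet> h) / 2"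
    if h: "norm h < r - norm k" for h
  proof -
    have "f (x + (k + h)) - \<phi> (k + h) \<le> f (x + k) - \<phi> k"
      using norm_triangle_ineq[of k h] h by (intro k(2)) auto
    moreover have "\<phi> (k + h) = \<phi> k + (p + (1/2) *\<^sub>R (B k + adjoint B k)) \<bullet> h + (B h \<bullet> h) / 2"
      by (simp add: \<phi>_def linear_add[OF B] inner_add_left inner_add_right adjoint_works[OF B]
          inner_commute[of "adjoint B k"] inner_commute[of "B k" h] add_divide_distrib)
    ultimately show ?thesis by (simp add: add.assoc)
  qed
  ultimately show thesis
    by (intro that[of k]) (auto simp: upper_jet_def B intro!: exI[of _ "r - norm k"])
qed

section \<open>Sup-convolution\<close>

text \<open>The competitors \<open>Y\<close> stay in \<open>K\<close> while \<open>X\<close> ranges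
  over the whole space, so paraboloids from below are available for all increments and not only for
  small ones.\<close>

definition sup_convolution :: "'a::euclidean_space set \<Rightarrow> real \<Rightarrow> ('a \<Rightarrow> real) \<Rightarrow> 'a \<Rightarrow> real" where
  "sup_convolution K c u X = (SUP Y\<in>K. u Y - c * (norm (X - Y))\<^sup>2)"

lemma sup_convolution_attained:
  assumes "compact K" "K \<noteq> {}" "continuous_on K u"
  obtains Y where "Y \<in> K" "sup_convolution K c u X = u Y - c * (norm (X - Y))\<^sup>2"
proof -
  have "continuous_on K (\<lambda>Y. u Y - c * (norm (X - Y))\<^sup>2)" by (intro continuous_intros assms)
  then obtain Y where Y: "Y \<in> K" "\<And>Z. Z \<in> K \<Longrightarrow> u Z - c * (norm (X - Z))\<^sup>2 \<le> u Y - c * (norm (X - Y))\<^sup>2"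
    using continuous_attains_sup[OF assms(1,2)] by (metis (no_types, lifting))
  hence "sup_convolution K c u X = u Y - c * (norm (X - Y))\<^sup>2"
    unfolding sup_convolution_def by (intro cSup_eq_maximum) auto
  thus thesis using Y(1) that by blast
qed

lemma sup_convolution_ge:
  assumes "compact K" "continuous_on K u" "Y \<in> K"
  shows "u Y - c * (norm (X - Y))\<^sup>2 \<le> sup_convolution K c u X"
  unfolding sup_convolution_def
proof (rule cSUP_upper[OF assms(3)])
  have "continuous_on K (\<lambda>Y. u Y - c * (norm (X - Y))\<^sup>2)" by (intro continuous_intros assms)
  hence "compact ((\<lambda>Y. u Y - c * (norm (X - Y))\<^sup>2) ` K)" using assms(1) by (rule compact_continuous_image)
  thus "bdd_above ((\<lambda>Y. u Y - c * (norm (X - Y))\<^sup>2) ` K)"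
    by (intro bounded_imp_bdd_above compact_imp_bounded)
qed

text \<open>Semiconvexity: the maximiser \<open>Y\<close> for \<open>X\<close> is still a competitor
  for \<open>X + h\<close>, and expanding its penalty gives the left-hand side.\<close>

lemma sup_convolution_lower_paraboloid:
  assumes "compact K" "continuous_on K u" "Y \<in> K" "sup_convolution K c u X = u Y - c * (norm (X - Y))\<^sup>2"
  shows "sup_convolution K c u X + ((2 * c) *\<^sub>R (Y - X)) \<bullet> h - c * (norm h)\<^sup>2 \<le> sup_convolution K c u (X + h)"
proof -
  have "(norm (X + h - Y))\<^sup>2 = (norm (X - Y))\<^sup>2 + 2 * ((X - Y) \<bullet> h) + (norm h)\<^sup>2"
    by (simp add: power2_norm_eq_inner algebra_simps inner_commute)
  hence "sup_convolution K c u X + ((2 * c) *\<^sub>R (Y - X)) \<bullet> h - c * (norm h)\<^sup>2 = u Y - c * (norm (X + h - Y))\<^sup>2"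
    unfolding assms(4) \<open>(norm (X + h - Y))\<^sup>2 = _\<close>
    by (simp add: algebra_simps)
  also have "\<dots> \<le> sup_convolution K c u (X + h)" by (rule sup_convolution_ge[OF assms(1-3)])
  finally show ?thesis .
qed

lemma continuous_on_sup_convolution:
  assumes K: "compact K" "K \<noteq> {}" "continuous_on K u" and c: "0 \<le> c" and S: "bounded S"
  shows "continuous_on S (sup_convolution K c u)"
proof -
  obtain R1 where R1: "\<And>X. X \<in> S \<Longrightarrow> norm X \<le> R1" using S by (auto simp: bounded_iff)
  obtain R2 where R2: "\<And>X. X \<in> K \<Longrightarrow> norm X \<le> R2"
    using compact_imp_bounded[OF K(1)] by (auto simp: bounded_iff)
  define L where "L = \<bar>c * (2 * (R1 + R2))\<bar>"
  have le: "sup_convolution K c u X - sup_convolution K c u X' \<le> L * dist X X'" if X: "X \<in> S" "X' \<in> S" for X X'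
  proof -
    obtain Y where Y: "Y \<in> K" "sup_convolution K c u X = u Y - c * (norm (X - Y))\<^sup>2"
      by (rule sup_convolution_attained[OF K])
    have "u Y - c * (norm (X' - Y))\<^sup>2 \<le> sup_convolution K c u X'"
      by (rule sup_convolution_ge[OF K(1,3) Y(1)])
    hence "sup_convolution K c u X - sup_convolution K c u X' \<le> c * ((norm (X' - Y))\<^sup>2 - (norm (X - Y))\<^sup>2)"
      using Y(2) by (simp add: right_diff_distrib)
    also have "(norm (X' - Y))\<^sup>2 - (norm (X - Y))\<^sup>2 = (norm (X' - Y) - norm (X - Y)) * (norm (X' - Y) + norm (X - Y))"
      by (simp add: power2_eq_square algebra_simps)
    also have "\<dots> \<le> dist X X' * (norm (X' - Y) + norm (X - Y))"
      using norm_triangle_ineq2[of "X' - Y" "X - Y"]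
      by (intro mult_right_mono) (auto simp: dist_norm norm_minus_commute)
    also have "\<dots> \<le> dist X X' * (2 * (R1 + R2))"
      using R1[OF X(1)] R1[OF X(2)] R2[OF Y(1)] norm_triangle_ineq4[of X Y] norm_triangle_ineq4[of X' Y]
      by (intro mult_left_mono) auto
    finally have "sup_convolution K c u X - sup_convolution K c u X' \<le> c * (dist X X' * (2 * (R1 + R2)))"
      using c by (simp add: mult_left_mono)
    also have "\<dots> = c * (2 * (R1 + R2)) * dist X X'" by (simp add: algebra_simps)
    also have "\<dots> \<le> L * dist X X'" unfolding L_def by (intro mult_right_mono) auto
    finally show ?thesis .
  qed
  have "L-lipschitz_on S (sup_convolution K c u)"
  proof (rule lipschitz_onI)
    fix X Y assume "X \<in> S" "Y \<in> S"
    thus "dist (sup_convolution K c u X) (sup_convolution K c u Y) \<le> L * dist X Y"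
      using le[of X Y] le[of Y X] by (simp add: dist_real_def dist_commute)
  qed (simp add: L_def)
  thus ?thesis by (rule lipschitz_on_continuous_on)
qed

text \<open>Moving \<open>X\<close> and its maximiser \<open>Y\<close> by the same \<open>h\<close>
  leaves the penalty unchanged, so the jet is carried over to \<open>Y\<close> with neither
  \<open>a\<close> nor \<open>B\<close> altered.\<close>

lemma upper_jet_sup_convolution:
  assumes K: "compact K" "continuous_on K u" and U: "open U" "U \<subseteq> K" "Y \<in> U"
    and Y: "sup_convolution K c u X = u Y - c * (norm (X - Y))\<^sup>2"
    and jet: "upper_jet (sup_convolution K c u) X a B"
  shows "upper_jet u Y a B"
proof -
  obtain e where e: "0 < e" "\<And>h. norm h < e \<Longrightarrow> sup_convolution K c u (X + h) \<le> sup_convolution K c u X + a \<bullet> h + (B h \<bullet> h) / 2"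
    using jet by (auto simp: upper_jet_def)
  obtain d where d: "0 < d" "ball Y d \<subseteq> U" using U(1,3) by (meson openE)
  have "u (Y + h) \<le> u Y + a \<bullet> h + (B h \<bullet> h) / 2" if h: "norm h < min d e" for h
  proof -
    have "Y + h \<in> K" using h d(2) U(2) by (auto simp: dist_norm subset_eq)
    from sup_convolution_ge[OF K this, of c "X + h"]
    have "u (Y + h) - c * (norm (X - Y))\<^sup>2 \<le> sup_convolution K c u (X + h)" by simp
    with e(2)[of h] h Y show ?thesis by simp
  qed
  thus ?thesis using jet d(1) e(1) unfolding upper_jet_def by (meson min_less_iff_conj)
qed

section \<open>Contact sets and the gradients on them\<close>

text \<open>A linear form cannot stay below a quadratic near the origin: test with a small positive
  multiple of \<open>v\<close>.\<close>

lemma contact_gradient_unique: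
  fixes v :: "'a::real_inner"
  assumes "0 < \<rho>" "0 \<le> c" and le: "\<And>h. norm h < \<rho> \<Longrightarrow> v \<bullet> h \<le> c * (norm h)\<^sup>2"
  shows "v = 0"
proof (rule ccontr)
  assume "v \<noteq> 0"
  hence v: "0 < norm v" by simp
  define s where "s = min (\<rho> / (2 * norm v)) (1 / (2 * (c + 1)))"
  have s: "0 < s" "s * norm v < \<rho>" "s * (c + 1) < 1"
  proof -
    show "0 < s" using assms(1,2) v by (simp add: s_def)
    have "s * norm v \<le> \<rho> / (2 * norm v) * norm v" by (intro mult_right_mono) (auto simp: s_def)
    also have "\<dots> < \<rho>" using v assms(1) by simp
    finally show "s * norm v < \<rho>" .
    have "s * (c + 1) \<le> 1 / (2 * (c + 1)) * (c + 1)" using assms(2) by (intro mult_right_mono) (auto simp: s_def)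
    also have "\<dots> < 1" using assms(2) by (simp add: divide_less_eq)
    finally show "s * (c + 1) < 1" .
  qed
  have "v \<bullet> (s *\<^sub>R v) \<le> c * (norm (s *\<^sub>R v))\<^sup>2" using s by (intro le) simp
  moreover have "v \<bullet> (s *\<^sub>R v) = s * (norm v)\<^sup>2" by (simp add: power2_norm_eq_inner)
  moreover have "c * (norm (s *\<^sub>R v))\<^sup>2 = s * ((s * c) * (norm v)\<^sup>2)"
    by (simp add: power_mult_distrib power2_eq_square)
  ultimately have "s * (norm v)\<^sup>2 \<le> s * ((s * c) * (norm v)\<^sup>2)" by (simp only:)
  hence "(norm v)\<^sup>2 \<le> (s * c) * (norm v)\<^sup>2" using s(1) by (simp only: mult_le_cancel_left_pos)
  moreover have "s * c < 1" using s(1,3) by (simp add: algebra_simps)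
  ultimately show False using v by (simp add: mult_le_cancel_right1)
qed

text \<open>From \<open>X\<close> go to \<open>X'\<close> and then a step of the same length
  \<open>D\<close> in the direction \<open>P - P'\<close>; there the paraboloid from below at
  \<open>X\<close> is compared with the one from above at \<open>X'\<close>. The quadratic terms
  total \<open>c * ((2 * D)^2 + 2 * D^2)\<close>, whence the factor \<open>6\<close> after division
  by \<open>D\<close>.\<close>

lemma two_sided_paraboloid_gradient_lipschitz:
  fixes f :: "'a::real_inner \<Rightarrow> real"
  assumes low: "\<And>h. f X + P \<bullet> h - c * (norm h)\<^sup>2 \<le> f (X + h)"
    and up: "\<And>h. norm h < \<rho> \<Longrightarrow> f (X + h) \<le> f X + P \<bullet> h + c * (norm h)\<^sup>2"
    and up': "\<And>h. norm h < \<rho> \<Longrightarrow> f (X' + h) \<le> f X' + P' \<bullet> h + c * (norm h)\<^sup>2"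
    and c: "0 \<le> c" and d: "norm (X' - X) < \<rho>"
  shows "norm (P - P') \<le> 6 * c * norm (X' - X)"
proof (cases "X = X' \<or> P = P'")
  case True
  show ?thesis
  proof (cases "X = X'")
    case eq: True
    have "(P - P') \<bullet> h \<le> (2 * c) * (norm h)\<^sup>2" if "norm h < \<rho>" for h
      using low[of h] up'[OF that] by (simp add: eq inner_diff_left)
    hence "P - P' = 0" using d c by (intro contact_gradient_unique[of \<rho> "2 * c"]) (auto simp: eq)
    thus ?thesis by (simp add: eq)
  qed (use True c in simp)
next
  case False
  define D where "D = norm (X' - X)"
  define v where "v = P - P'"
  have D: "0 < D" and v: "0 < norm v" using False by (auto simp: D_def v_def)
  define h where "h = (D / norm v) *\<^sub>R v"
  have nh: "norm h = D" using D v by (simp add: h_def)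
  have "f X + P \<bullet> (X' - X + h) - c * (norm (X' - X + h))\<^sup>2 \<le> f (X + (X' - X + h))" by (rule low)
  also have "\<dots> = f (X' + h)" by (simp add: algebra_simps)
  also have "\<dots> \<le> f X' + P' \<bullet> h + c * D\<^sup>2" using up'[of h] nh d by (simp add: D_def)
  also have "f X' \<le> f X + P \<bullet> (X' - X) + c * D\<^sup>2" using up[of "X' - X"] d by (simp add: D_def)
  finally have "v \<bullet> h \<le> c * (norm (X' - X + h))\<^sup>2 + 2 * (c * D\<^sup>2)"
    by (simp add: v_def inner_diff_left inner_diff_right inner_add_right)
  also have "\<dots> \<le> c * (2 * D)\<^sup>2 + 2 * (c * D\<^sup>2)"
    using norm_triangle_ineq[of "X' - X" h] nh c
    by (intro add_right_mono mult_left_mono power_mono) (auto simp: D_def)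
  also have "\<dots> = D * (6 * c * D)" by (simp add: power2_eq_square)
  also have "v \<bullet> h = D * norm v"
    using v by (simp add: h_def power2_norm_eq_inner[symmetric] power2_eq_square)
  finally have "norm v \<le> 6 * c * D" using D by (simp only: mult_le_cancel_left_pos)
  thus ?thesis by (simp add: v_def D_def)
qed

text \<open>Every slope of norm at most \<open>\<delta>\<close> occurs at a maximum of the tilted
  sum, so the sum of the two gradients maps the contact set \<open>E\<close> onto a ball. Being
  Lipschitz on \<open>E\<close>, it could not do so if \<open>E\<close> were negligible. Hence some
  point of \<open>E\<close> avoids the exceptional set of the blow-up result.\<close>

lemma contact_point_second_order:
  fixes f g :: "'a::euclidean_space \<Rightarrow> real"
  assumes K: "compact K" "K \<noteq> {}" and cont: "continuous_on K f" "continuous_on K g"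
    and pos: "0 < \<rho>" "0 \<le> c" "0 < \<delta>"
    and low_f: "\<And>X. X \<in> K \<Longrightarrow> \<exists>p. norm p \<le> B \<and> (\<forall>h. f X + p \<bullet> h - c * (norm h)\<^sup>2 \<le> f (X + h))"
    and low_g: "\<And>X. X \<in> K \<Longrightarrow> \<exists>p. norm p \<le> B \<and> (\<forall>h. g X + p \<bullet> h - c * (norm h)\<^sup>2 \<le> g (X + h))"
    and inner: "\<And>X q. X \<in> K \<Longrightarrow> norm q \<le> \<delta> \<Longrightarrow> (\<And>Y. Y \<in> K \<Longrightarrow> f Y + g Y - q \<bullet> Y \<le> f X + g X - q \<bullet> X)
        \<Longrightarrow> ball X \<rho> \<subseteq> W" and W: "W \<subseteq> K"
  obtains X A1 A2 \<kappa> p1 p2 where "ball X \<rho> \<subseteq> W" "linear A1" "linear A2" "strict_mono (\<kappa> :: nat \<Rightarrow> nat)"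
    "norm (p1 + p2) \<le> \<delta>" "\<forall>h. (A1 h + A2 h) \<bullet> h \<le> 0"
    "dyadic_expansion f X p1 A1 \<kappa>" "dyadic_expansion g X p2 A2 \<kappa>"
proof -
  define contact where "contact X q \<longleftrightarrow> norm q \<le> \<delta> \<and> (\<forall>Y\<in>K. f Y + g Y - q \<bullet> Y \<le> f X + g X - q \<bullet> X)" for X q
  define E where "E = {X \<in> K. \<exists>q. contact X q}"
  from low_f have "\<forall>X\<in>K. \<exists>p. norm p \<le> B \<and> (\<forall>h. f X + p \<bullet> h - c * (norm h)\<^sup>2 \<le> f (X + h))"
    by blast
  from bchoice[OF this] obtain P1 where P1: "\<And>X. X \<in> K \<Longrightarrow> norm (P1 X) \<le> B"
      "\<And>X h. X \<in> K \<Longrightarrow> f X + P1 X \<bullet> h - c * (norm h)\<^sup>2 \<le> f (X + h)"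
    by blast
  from low_g have "\<forall>X\<in>K. \<exists>p. norm p \<le> B \<and> (\<forall>h. g X + p \<bullet> h - c * (norm h)\<^sup>2 \<le> g (X + h))"
    by blast
  from bchoice[OF this] obtain P2 where P2: "\<And>X. X \<in> K \<Longrightarrow> norm (P2 X) \<le> B"
      "\<And>X h. X \<in> K \<Longrightarrow> g X + P2 X \<bullet> h - c * (norm h)\<^sup>2 \<le> g (X + h)"
    by blast
  obtain X0 where "X0 \<in> K" using K(2) by blast
  hence B: "0 \<le> B" using P1(1)[of X0] norm_ge_zero[of "P1 X0"] by linarith
  have E_ball: "ball X \<rho> \<subseteq> W" if "X \<in> E" for X
    using that inner by (auto simp: E_def contact_def)
  have in_K: "X + h \<in> K" if "X \<in> E" "norm h < \<rho>" for X h
    using E_ball[OF that(1)] W that(2) by (auto simp: dist_norm subset_eq)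
  have touch: "f (X + h) + g (X + h) \<le> f X + g X + q \<bullet> h" if "X \<in> E" "contact X q" "norm h < \<rho>" for X h q
  proof -
    have "f (X + h) + g (X + h) - q \<bullet> (X + h) \<le> f X + g X - q \<bullet> X"
      using that(2) in_K[OF that(1,3)] unfolding contact_def by blast
    thus ?thesis by (simp add: inner_add_right)
  qed
  have grad: "P1 X + P2 X = q" if "X \<in> E" "contact X q" for X q
  proof -
    have XK: "X \<in> K" using that by (simp add: E_def)
    have "(P1 X + P2 X - q) \<bullet> h \<le> (2 * c) * (norm h)\<^sup>2" if "norm h < \<rho>" for h
      using touch[OF \<open>X \<in> E\<close> \<open>contact X q\<close> that] P1(2)[OF XK, of h] P2(2)[OF XK, of h]
      by (simp add: inner_add_left inner_diff_left)
    hence "P1 X + P2 X - q = 0" using pos by (intro contact_gradient_unique[of \<rho> "2 * c"]) auto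
    thus ?thesis by simp
  qed
  \<comment> \<open>Touching from above bounds only the sum; the paraboloid from below for
    \<open>g\<close> converts this into a bound for \<open>f\<close> alone, and conversely in
    \<open>up_g\<close>.\<close>
  have up_f: "f (X + h) \<le> f X + P1 X \<bullet> h + c * (norm h)\<^sup>2" if "X \<in> E" "norm h < \<rho>" for X h
  proof -
    from that(1) obtain q where q: "contact X q" "X \<in> K" by (auto simp: E_def)
    show ?thesis
      using touch[OF that(1) q(1) that(2)] P2(2)[OF q(2), of h]
      by (simp add: inner_add_left flip: grad[OF that(1) q(1)])
  qed
  have up_g: "g (X + h) \<le> g X + P2 X \<bullet> h + c * (norm h)\<^sup>2" if "X \<in> E" "norm h < \<rho>" for X h
  proof -
    from that(1) obtain q where q: "contact X q" "X \<in> K" by (auto simp: E_def)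
    show ?thesis
      using touch[OF that(1) q(1) that(2)] P1(2)[OF q(2), of h]
      by (simp add: inner_add_left flip: grad[OF that(1) q(1)])
  qed
  have EK: "X \<in> K" if "X \<in> E" for X using that by (simp add: E_def)
  \<comment> \<open>Within distance \<open>\<rho>\<close> the two-sided paraboloids give
    \<open>6 * c\<close>; farther apart the bound \<open>B\<close> on both slopes gives
    \<open>2 * B / \<rho>\<close>. The \<open>1\<close> makes \<open>M\<close> positive.\<close>
  define M where "M = 6 * c + 2 * B / \<rho> + 1"
  have M: "0 < M" using pos B by (simp add: M_def add_nonneg_pos)
  have lipP: "norm (P X - P X') \<le> M * dist X X'"
    if P: "P = P1 \<or> P = P2" and X: "X \<in> E" "X' \<in> E" for P X X'
  proof (cases "norm (X' - X) < \<rho>")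
    case True
    have "norm (P X - P X') \<le> 6 * c * norm (X' - X)"
      using P
    proof
      assume "P = P1" thus ?thesis
        using two_sided_paraboloid_gradient_lipschitz[OF P1(2)[OF EK[OF X(1)]] up_f[OF X(1)] up_f[OF X(2)] pos(2) True]
        by simp
    next
      assume "P = P2" thus ?thesis
        using two_sided_paraboloid_gradient_lipschitz[OF P2(2)[OF EK[OF X(1)]] up_g[OF X(1)] up_g[OF X(2)] pos(2) True]
        by simp
    qed
    also have "\<dots> \<le> M * norm (X' - X)" using pos B by (intro mult_right_mono) (auto simp: M_def)
    finally show ?thesis by (simp add: dist_norm norm_minus_commute)
  next
    case False
    have "norm (P X - P X') \<le> B + B"
    proof -
      have "norm (P X) \<le> B" "norm (P X') \<le> B"
        using P P1(1)[OF EK[OF X(1)]] P1(1)[OF EK[OF X(2)]] P2(1)[OF EK[OF X(1)]] P2(1)[OF EK[OF X(2)]] by auto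
      thus ?thesis using norm_triangle_ineq4[of "P X" "P X'"] by linarith
    qed
    also have "\<dots> = 2 * B / \<rho> * \<rho>" using pos by simp
    also have "\<dots> \<le> M * norm (X' - X)"
      using False pos B by (intro mult_mono) (auto simp: M_def)
    finally show ?thesis by (simp add: dist_norm norm_minus_commute)
  qed
  have "cball 0 \<delta> \<subseteq> (\<lambda>X. P1 X + P2 X) ` E"
  proof
    fix q :: 'a assume q: "q \<in> cball 0 \<delta>"
    have "continuous_on K (\<lambda>Y. f Y + g Y - q \<bullet> Y)" by (intro continuous_intros cont)
    then obtain X where X: "X \<in> K" "\<And>Y. Y \<in> K \<Longrightarrow> f Y + g Y - q \<bullet> Y \<le> f X + g X - q \<bullet> X"
      using continuous_attains_sup[OF K] by (metis (no_types, lifting))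
    hence "contact X q" using q by (simp add: contact_def)
    moreover from this have "X \<in> E" using X(1) by (auto simp: E_def)
    ultimately show "q \<in> (\<lambda>X. P1 X + P2 X) ` E" using grad by blast
  qed
  moreover have "\<not> negligible (cball (0::'a) \<delta>)"
    using pos(3) by (simp add: negligible_convex_interior)
  ultimately have img: "\<not> negligible ((\<lambda>X. P1 X + P2 X) ` E)" using negligible_subset by blast
  have "\<not> negligible E"
  proof
    assume "negligible E"
    hence "negligible ((\<lambda>X. P1 X + P2 X) ` E)"
    proof (rule negligible_locally_Lipschitz_image[OF order_refl])
      fix x assume x: "x \<in> E"
      have "norm (P1 y + P2 y - (P1 x + P2 x)) \<le> (2 * M) * norm (y - x)" if "y \<in> E" for y
        using lipP[of P1 y x] lipP[of P2 y x] that x norm_triangle_ineq[of "P1 y - P1 x" "P2 y - P2 x"]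
        by (simp add: dist_norm algebra_simps)
      thus "\<exists>T b. open T \<and> x \<in> T \<and> (\<forall>y\<in>E \<inter> T. norm (P1 y + P2 y - (P1 x + P2 x)) \<le> b * norm (y - x))"
        by (intro exI[of _ UNIV] exI[of _ "2 * M"]) auto
    qed
    with img show False by simp
  qed
  \<comment> \<open>One map into the product, so that a single subsequence serves for both
    gradients.\<close>
  define P where "P X = (P1 X, P2 X)" for X
  have norm_P: "norm (a, b) \<le> norm a + norm b" for a b :: 'a by (rule norm_Pair_le)
  have bE: "bounded E" using compact_imp_bounded[OF K(1)] by (rule bounded_subset) (auto simp: E_def)
  have nP: "norm (P x) \<le> 2 * B" if "x \<in> E" for x
    using norm_P[of "P1 x" "P2 x"] P1(1)[OF EK[OF that]] P2(1)[OF EK[OF that]] by (simp add: P_def)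
  have lP: "norm (P x - P y) \<le> (2 * M) * dist x y" if "x \<in> E" "y \<in> E" for x y
    using norm_P[of "P1 x - P1 y" "P2 x - P2 y"] lipP[of P1 x y] lipP[of P2 x y] that by (simp add: P_def)
  have "0 < 2 * M" using M by simp
  then obtain N where N: "negligible N" "\<And>x. x \<in> E \<Longrightarrow> x \<notin> N \<Longrightarrow> \<exists>A \<kappa>. dyadic_derivative E P x A \<kappa>"
    using lipschitz_blowup_AE[OF bE nP lP] by blast
  have "\<not> E \<subseteq> N" using \<open>\<not> negligible E\<close> N(1) negligible_subset by blast
  then obtain X where XE: "X \<in> E" and "X \<notin> N" by blast
  then obtain A \<kappa> where der: "dyadic_derivative E P X A \<kappa>" using N(2) by blast
  have der1: "dyadic_derivative E P1 X (\<lambda>y. fst (A y)) \<kappa>"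
    using dyadic_derivative_compose[OF der linear_fst norm_fst_le_norm] by (simp add: P_def)
  have der2: "dyadic_derivative E P2 X (\<lambda>y. snd (A y)) \<kappa>"
    using dyadic_derivative_compose[OF der linear_snd norm_snd_le_norm] by (simp add: P_def)
  define A1 where "A1 y = fst (A y)" for y
  define A2 where "A2 y = snd (A y)" for y
  have A1: "linear A1" and A2: "linear A2" and \<kappa>: "strict_mono \<kappa>"
    using der1 der2 by (simp_all add: dyadic_derivative_def A1_def[abs_def] A2_def[abs_def])
  have two_f: "\<bar>f (X + h) - f X - P1 X \<bullet> h\<bar> \<le> c * (norm h)\<^sup>2" if "X \<in> E" "norm h < \<rho>" for X h
    using up_f[OF that] P1(2)[OF EK[OF that(1)], of h] by (simp add: abs_le_iff)
  have two_g: "\<bar>g (X + h) - g X - P2 X \<bullet> h\<bar> \<le> c * (norm h)\<^sup>2" if "X \<in> E" "norm h < \<rho>" for X h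
    using up_g[OF that] P2(2)[OF EK[OF that(1)], of h] by (simp add: abs_le_iff)
  have exp_f: "dyadic_expansion f X (P1 X) A1 \<kappa>"
    using dyadic_expansion_of_dyadic_derivative[OF two_f pos(1,2) der1] by (simp add: A1_def[abs_def])
  have exp_g: "dyadic_expansion g X (P2 X) A2 \<kappa>"
    using dyadic_expansion_of_dyadic_derivative[OF two_g pos(1,2) der2] by (simp add: A2_def[abs_def])
  from XE obtain q where q: "contact X q" by (auto simp: E_def)
  \<comment> \<open>The first-order terms cancel against the slope \<open>q\<close>, so touching
    leaves only the expansion errors as a bound for the sum of the quadratic terms.\<close>
  have nonpos: "(A1 y + A2 y) \<bullet> y \<le> 0" if y: "norm y \<le> 1" for y
  proof (rule field_le_epsilon)
    fix e :: real assume e: "0 < e"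
    have e4: "0 < e / 4" using e by simp
    from eventually_happens'[OF sequentially_bot eventually_conj[OF
        dyadic_scale_eventually_less[OF \<kappa> pos(1)] eventually_conj[OF
        exp_f[unfolded dyadic_expansion_def, THEN spec, THEN mp, OF e4]
        exp_g[unfolded dyadic_expansion_def, THEN spec, THEN mp, OF e4]]]]
    obtain i where i: "1 / 2 ^ \<kappa> i < \<rho>"
      "\<forall>y\<in>cball 0 1. \<bar>f (X + (1 / 2 ^ \<kappa> i) *\<^sub>R y) - f X - (1 / 2 ^ \<kappa> i) * (P1 X \<bullet> y) - (1 / 2 ^ \<kappa> i)\<^sup>2 * (A1 y \<bullet> y) / 2\<bar>
      \<le> e / 4 * (1 / 2 ^ \<kappa> i)\<^sup>2"
      "\<forall>y\<in>cball 0 1. \<bar>g (X + (1 / 2 ^ \<kappa> i) *\<^sub>R y) - g X - (1 / 2 ^ \<kappa> i) * (P2 X \<bullet> y) - (1 / 2 ^ \<kappa> i)\<^sup>2 * (A2 y \<bullet> y) / 2\<bar>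
      \<le> e / 4 * (1 / 2 ^ \<kappa> i)\<^sup>2"
      by (elim exE conjE)
    define r :: real where "r = 1 / 2 ^ \<kappa> i"
    have r: "0 < r" "r < \<rho>" using i(1) by (auto simp: r_def)
    have yc: "y \<in> cball 0 1" using y by simp
    have "norm (r *\<^sub>R y) \<le> r" using y r by (simp add: mult_left_le)
    hence nr: "norm (r *\<^sub>R y) < \<rho>" using r by linarith
    have "f (X + r *\<^sub>R y) + g (X + r *\<^sub>R y) \<le> f X + g X + (P1 X + P2 X) \<bullet> (r *\<^sub>R y)"
      using touch[OF XE q nr] grad[OF XE q] by simp
    moreover have "(P1 X + P2 X) \<bullet> (r *\<^sub>R y) = r * (P1 X \<bullet> y) + r * (P2 X \<bullet> y)"
      by (simp add: inner_add_left algebra_simps)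
    moreover have "r\<^sup>2 * ((A1 y + A2 y) \<bullet> y) = r\<^sup>2 * (A1 y \<bullet> y) + r\<^sup>2 * (A2 y \<bullet> y)"
      by (simp add: inner_add_left algebra_simps)
    moreover have "e / 4 * r\<^sup>2 = r\<^sup>2 * e / 4" by simp
    ultimately have "r\<^sup>2 * ((A1 y + A2 y) \<bullet> y) \<le> r\<^sup>2 * e"
      using bspec[OF i(2) yc, folded r_def] bspec[OF i(3) yc, folded r_def] by linarith
    thus "(A1 y + A2 y) \<bullet> y \<le> 0 + e" using r by simp
  qed
  have nonpos_all: "(A1 h + A2 h) \<bullet> h \<le> 0" for h
  proof (cases "h = 0")
    case False
    define s where "s = 1 / norm h"
    have s: "0 < s" using False by (simp add: s_def)
    have "(A1 (s *\<^sub>R h) + A2 (s *\<^sub>R h)) \<bullet> (s *\<^sub>R h) \<le> 0" using False by (intro nonpos) (simp add: s_def)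
    hence "s * (s * ((A1 h + A2 h) \<bullet> h)) \<le> 0"
      by (simp add: linear_scale[OF A1] linear_scale[OF A2] inner_add_left distrib_left)
    thus ?thesis using s by (simp add: mult_le_0_iff)
  qed simp
  have "norm (P1 X + P2 X) \<le> \<delta>" using grad[OF XE q] q by (simp add: contact_def)
  thus thesis
    by (intro allI nonpos_all that[of X A1 A2 \<kappa> "P1 X" "P2 X"] E_ball[OF XE] A1 A2 \<kappa> exp_f exp_g)
qed

text \<open>One good radius suffices. It is taken below \<open>\<delta> / (C1 + C2)\<close>, where
  \<open>C1\<close> and \<open>C2\<close> bound \<open>B\<close> and its adjoint, so that the
  gradient shift in \<open>upper_jet_of_expansion\<close> is at most
  \<open>\<delta>\<close>.\<close>

lemma upper_jet_near_dyadic_expansion: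
  fixes f :: "'a::euclidean_space \<Rightarrow> real"
  assumes exp: "dyadic_expansion f X p A \<kappa>" and A: "linear A" and \<kappa>: "strict_mono \<kappa>"
    and cont: "continuous_on (cball X \<rho>) f" and \<rho>: "0 < \<rho>" and \<delta>: "0 < \<delta>"
  obtains k a where "norm k < \<rho>" "upper_jet f (X + k) a (\<lambda>h. A h + \<delta> *\<^sub>R h)" "norm (a - p) \<le> \<delta>"
proof -
  define B where "B h = A h + \<delta> *\<^sub>R h" for h
  have B: "linear B" unfolding B_def by (intro linear_compose_add A linear_scale_self)
  obtain C1 where C1: "0 < C1" "\<And>h. norm (B h) \<le> C1 * norm h"
    using linear_bounded_pos[OF B] by (auto simp: mult.commute)
  obtain C2 where C2: "0 < C2" "\<And>h. norm (adjoint B h) \<le> C2 * norm h"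
    using linear_bounded_pos[OF adjoint_linear[OF B]] by (auto simp: mult.commute)
  have d4: "0 < \<delta> / 4" and pos: "0 < min \<rho> (\<delta> / (C1 + C2))" using \<delta> \<rho> C1 C2 by auto
  from eventually_happens'[OF sequentially_bot eventually_conj[OF
      dyadic_scale_eventually_less[OF \<kappa> pos]
      exp[unfolded dyadic_expansion_def, THEN spec, THEN mp, OF d4]]]
  obtain i where i: "1 / 2 ^ \<kappa> i < min \<rho> (\<delta> / (C1 + C2))"
    and e: "\<forall>y\<in>cball 0 1.
      \<bar>f (X + (1 / 2 ^ \<kappa> i) *\<^sub>R y) - f X - (1 / 2 ^ \<kappa> i) * (p \<bullet> y) - (1 / 2 ^ \<kappa> i)\<^sup>2 * (A y \<bullet> y) / 2\<bar>
      \<le> \<delta> / 4 * (1 / 2 ^ \<kappa> i)\<^sup>2" by (elim exE conjE)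
  define r :: real where "r = 1 / 2 ^ \<kappa> i"
  have r: "0 < r" "r < \<rho>" "r < \<delta> / (C1 + C2)" using i by (auto simp: r_def)
  have le: "f (X + h) \<le> f X + p \<bullet> h + (A h \<bullet> h) / 2 + \<delta> / 4 * r\<^sup>2" if h: "norm h \<le> r" for h
  proof -
    define y where "y = (1 / r) *\<^sub>R h"
    have hy: "h = r *\<^sub>R y" using r by (simp add: y_def)
    have "y \<in> cball 0 1" using h r by (simp add: y_def)
    from bspec[OF e this]
    have "\<bar>f (X + r *\<^sub>R y) - f X - r * (p \<bullet> y) - r\<^sup>2 * (A y \<bullet> y) / 2\<bar> \<le> \<delta> / 4 * r\<^sup>2"
      unfolding r_def[symmetric] .
    moreover have "A h \<bullet> h = r\<^sup>2 * (A y \<bullet> y)" "p \<bullet> h = r * (p \<bullet> y)"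
      by (simp_all add: hy linear_scale[OF A] power2_eq_square)
    ultimately show ?thesis unfolding hy[symmetric] abs_le_iff by linarith
  qed
  have cont_r: "continuous_on (cball X r) f"
    using r by (intro continuous_on_subset[OF cont]) auto
  obtain k where k: "norm k < r"
      "upper_jet f (X + k) (p + (1/2) *\<^sub>R (B k + adjoint B k)) B"
    unfolding B_def[abs_def]
    by (rule upper_jet_of_expansion[OF cont_r A r(1) \<delta> le])
  have "norm ((1/2) *\<^sub>R (B k + adjoint B k)) \<le> norm (B k) + norm (adjoint B k)"
    using norm_triangle_ineq[of "B k" "adjoint B k"] norm_ge_zero[of "B k + adjoint B k"]
    unfolding norm_scaleR by linarith
  also have "\<dots> \<le> (C1 + C2) * norm k" using C1(2)[of k] C2(2)[of k] by (simp add: algebra_simps)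
  also have "\<dots> \<le> (C1 + C2) * (\<delta> / (C1 + C2))" using k(1) r C1 C2 by (intro mult_left_mono) auto
  also have "\<dots> = \<delta>" using C1 C2 by simp
  finally have "norm (p + (1/2) *\<^sub>R (B k + adjoint B k) - p) \<le> \<delta>" by simp
  moreover have "norm k < \<rho>" using k(1) r by linarith
  ultimately show thesis using k(2) unfolding B_def[abs_def] by (intro that)
qed

lemma continuous_on_compact_abs_bound:
  fixes w :: "'a::topological_space \<Rightarrow> real"
  assumes "compact K" "continuous_on K w"
  shows "\<exists>M. \<forall>X\<in>K. \<bar>w X\<bar> \<le> M"
  using compact_imp_bounded[OF compact_continuous_image[OF assms(2,1)]]
  by (simp add: bounded_iff)

text \<open>A substitute for the theorem on sums without doubling of variables: \<open>Y\<close> and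
  \<open>Z\<close> may differ, and only nearly opposite gradients and nearly ordered quadratic forms
  are kept. The jets are found for the sup-convolutions and then carried back to \<open>u\<close>
  and \<open>v\<close>.\<close>

theorem semijets_at_interior_maximum:
  fixes u v :: "'a::euclidean_space \<Rightarrow> real"
  assumes U: "open U" "bounded U"
    and cont: "continuous_on (closure U) u" "continuous_on (closure U) v"
    and bd: "\<And>X. X \<in> frontier U \<Longrightarrow> u X + v X \<le> 0"
    and x: "x \<in> U" "0 < u x + v x" and \<delta>: "0 < \<delta>"
  obtains Y Z a b A B where "Y \<in> U" "Z \<in> U" "upper_jet u Y a A" "upper_jet v Z b B"
    "norm (a + b) \<le> \<delta>" "\<forall>h. (A h + B h) \<bullet> h \<le> \<delta> * (norm h)\<^sup>2"
proof -
  define K where "K = closure U"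
  have K: "compact K" "K \<noteq> {}" using U(2) x(1) closure_subset[of U] by (auto simp: K_def)
  have UK: "U \<subseteq> K" by (simp add: K_def closure_subset)
  have cu: "continuous_on K u" and cv: "continuous_on K v" using cont by (simp_all add: K_def)
  define m where "m = u x + v x"
  have m: "0 < m" using x by (simp add: m_def)
  have "\<exists>R. \<forall>X\<in>K. norm X \<le> R" using compact_imp_bounded[OF K(1)] unfolding bounded_iff .
  then obtain R where R': "\<forall>X\<in>K. norm X \<le> R" by (rule exE)
  note R = R'[rule_format]
  have R0: "0 \<le> R" using R[OF subsetD[OF UK x(1)]] norm_ge_zero[of x] by linarith
  obtain Mu where Mu': "\<forall>X\<in>K. \<bar>u X\<bar> \<le> Mu" using continuous_on_compact_abs_bound[OF K(1) cu] by (rule exE)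
  obtain Mv where Mv': "\<forall>X\<in>K. \<bar>v X\<bar> \<le> Mv" using continuous_on_compact_abs_bound[OF K(1) cv] by (rule exE)
  note Mu = Mu'[rule_format] and Mv = Mv'[rule_format]
  define M where "M = max Mu Mv"
  have M0: "0 \<le> M" using Mu[OF subsetD[OF UK x(1)]] by (simp add: M_def)
  have uc: "\<exists>r>0. \<forall>X\<in>K. \<forall>Y\<in>K. dist Y X < r \<longrightarrow> \<bar>w Y - w X\<bar> < m / 16" if "continuous_on K w" for w
  proof -
    have "m / 16 > 0" using m by simp
    with compact_uniformly_continuous[OF that K(1)] show ?thesis
      unfolding uniformly_continuous_on_def dist_real_def by (elim allE[of _ "m / 16"]) simp
  qed
  obtain ru where ru: "0 < ru" "\<forall>X\<in>K. \<forall>Y\<in>K. dist Y X < ru \<longrightarrow> \<bar>u Y - u X\<bar> < m / 16"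
    using uc[OF cu] by (elim exE conjE)
  obtain rv where rv: "0 < rv" "\<forall>X\<in>K. \<forall>Y\<in>K. dist Y X < rv \<longrightarrow> \<bar>v Y - v X\<bar> < m / 16"
    using uc[OF cv] by (elim exE conjE)
  define \<rho> where "\<rho> = min ru rv"
  have \<rho>: "0 < \<rho>" using ru rv by (simp add: \<rho>_def)
  define D where "D = (\<rho> / 2)\<^sup>2"
  have D: "0 < D" using \<rho> by (simp add: D_def)
  \<comment> \<open>With \<open>c * D > 2 * M\<close>, a competitor at distance
    \<open>\<rho> / 2\<close> or more pays more than the function can gain, so maximisers stay
    closer than that.\<close>
  define c where "c = 2 * M / D + 1"
  have "0 \<le> 2 * M / D" using M0 D by simp
  hence c0: "0 < c" unfolding c_def by linarith
  have "c * D = 2 * M + D" unfolding c_def using D by (simp add: distrib_right)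
  hence cM: "2 * M < c * D" using D by linarith
  define f where "f = sup_convolution K c u"
  define g where "g = sup_convolution K c v"
  have near: "norm (X - Y) < \<rho> / 2"
    if XK: "X \<in> K" and YK: "Y \<in> K" and Y: "sup_convolution K c w X = w Y - c * (norm (X - Y))\<^sup>2"
      and cw: "continuous_on K w" and wM: "\<And>X. X \<in> K \<Longrightarrow> \<bar>w X\<bar> \<le> M" for w X Y
  proof -
    have "w X - c * (norm (X - X))\<^sup>2 \<le> sup_convolution K c w X" by (rule sup_convolution_ge[OF K(1) cw XK])
    hence "w X \<le> w Y - c * (norm (X - Y))\<^sup>2" unfolding Y by simp
    hence "c * (norm (X - Y))\<^sup>2 < c * D" using wM[OF XK] wM[OF YK] cM by linarith
    hence "(norm (X - Y))\<^sup>2 < (\<rho> / 2)\<^sup>2" using c0 unfolding D_def by (simp only: mult_less_cancel_left_pos)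
    thus ?thesis by (rule power2_less_imp_less) (use \<rho> in simp)
  qed
  have uM: "\<bar>u X\<bar> \<le> M" and vM: "\<bar>v X\<bar> \<le> M" if "X \<in> K" for X
    using Mu[OF that] Mv[OF that] by (auto simp: M_def)
  have lower: "\<exists>p. norm p \<le> c * \<rho> \<and> (\<forall>h. sup_convolution K c w X + p \<bullet> h - c * (norm h)\<^sup>2 \<le> sup_convolution K c w (X + h))"
    if XK: "X \<in> K" and cw: "continuous_on K w" and wM: "\<And>X. X \<in> K \<Longrightarrow> \<bar>w X\<bar> \<le> M" for w X
  proof -
    obtain Y where Y: "Y \<in> K" "sup_convolution K c w X = w Y - c * (norm (X - Y))\<^sup>2"
      by (rule sup_convolution_attained[OF K cw])
    have "norm ((2 * c) *\<^sub>R (Y - X)) \<le> (2 * c) * (\<rho> / 2)"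
      using near[OF XK Y cw wM] c0 by (simp add: norm_minus_commute)
    moreover have "sup_convolution K c w X + ((2 * c) *\<^sub>R (Y - X)) \<bullet> h - c * (norm h)\<^sup>2 \<le> sup_convolution K c w (X + h)" for h
      by (rule sup_convolution_lower_paraboloid[OF K(1) cw Y])
    ultimately show ?thesis by (intro exI[of _ "(2 * c) *\<^sub>R (Y - X)"] conjI allI) simp_all
  qed
  have f_ge: "u X \<le> f X" and g_ge: "v X \<le> g X" if "X \<in> K" for X
    using sup_convolution_ge[OF K(1) cu that, of c X] sup_convolution_ge[OF K(1) cv that, of c X]
    by (simp_all add: f_def g_def)
  have f_le: "f X \<le> u X + m / 16" if "X \<in> K" for X
  proof -
    obtain Y where Y: "Y \<in> K" "sup_convolution K c u X = u Y - c * (norm (X - Y))\<^sup>2"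
      by (rule sup_convolution_attained[OF K cu])
    have "\<bar>u Y - u X\<bar> < m / 16"
      using near[OF that Y cu uM] \<rho> by (intro ru(2)[rule_format] that Y) (auto simp: \<rho>_def dist_norm norm_minus_commute)
    moreover have "f X \<le> u Y" using Y(2) c0 by (simp add: f_def)
    ultimately show ?thesis by linarith
  qed
  have g_le: "g X \<le> v X + m / 16" if "X \<in> K" for X
  proof -
    obtain Y where Y: "Y \<in> K" "sup_convolution K c v X = v Y - c * (norm (X - Y))\<^sup>2"
      by (rule sup_convolution_attained[OF K cv])
    have "\<bar>v Y - v X\<bar> < m / 16"
      using near[OF that Y cv vM] \<rho> by (intro rv(2)[rule_format] that Y) (auto simp: \<rho>_def dist_norm norm_minus_commute)
    moreover have "g X \<le> v Y" using Y(2) c0 by (simp add: g_def)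
    ultimately show ?thesis by linarith
  qed
  \<comment> \<open>One third of \<open>\<delta>\<close> is for the slope of the tilt and one for
    each of the two gradient shifts. The second bound keeps the tilt within \<open>m / 8\<close> on
    \<open>K\<close>.\<close>
  define \<delta>' where "\<delta>' = min (\<delta> / 3) (m / (8 * (R + 1)))"
  have \<delta>': "0 < \<delta>'" "\<delta>' \<le> \<delta> / 3" unfolding \<delta>'_def using \<delta> m R0 by simp (rule min.cobounded1)
  have \<delta>'R: "\<delta>' * R \<le> m / 8"
  proof -
    have "\<delta>' * R \<le> m / (8 * (R + 1)) * (R + 1)" using R0 m \<delta>'(1) unfolding \<delta>'_def by (intro mult_mono min.cobounded2) auto
    also have "\<dots> = m / 8" using R0 by (simp del: distrib_left_numeral)
    finally show ?thesis .
  qed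
  have inner: "ball X \<rho> \<subseteq> U"
    if X: "X \<in> K" and q: "norm q \<le> \<delta>'" and le: "\<And>Y. Y \<in> K \<Longrightarrow> f Y + g Y - q \<bullet> Y \<le> f X + g X - q \<bullet> X" for X q
  proof (rule ccontr)
    assume not: "\<not> ball X \<rho> \<subseteq> U"
    have xK: "x \<in> K" using x(1) UK by blast
    have q_bound: "\<bar>q \<bullet> Y\<bar> \<le> m / 8" if "Y \<in> K" for Y
    proof -
      have "\<bar>q \<bullet> Y\<bar> \<le> norm q * norm Y" by (rule Cauchy_Schwarz_ineq2)
      also have "\<dots> \<le> \<delta>' * R" using q R[OF that] \<delta>' by (intro mult_mono) auto
      finally show ?thesis using \<delta>'R by linarith
    qed
    \<comment> \<open>From \<open>m\<close> the tilt takes \<open>2 * m / 8\<close> and the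
      convolutions take \<open>2 * m / 16\<close>. A frontier point within \<open>\<rho>\<close>
      would lose at most \<open>2 * m / 16\<close> more, and the sum would still be positive
      there.\<close>
    have big: "5 * m / 8 \<le> u X + v X"
      using le[OF xK] q_bound[OF xK] q_bound[OF X] f_ge[OF xK] g_ge[OF xK] f_le[OF X] g_le[OF X]
      unfolding m_def by (simp add: abs_le_iff field_simps)
    have "\<exists>Y\<in>U. dist Y X < \<rho>" using X \<rho> by (simp add: K_def closure_approachable)
    hence "U \<inter> ball X \<rho> \<noteq> {}" by (auto simp: dist_commute)
    hence "ball X \<rho> \<inter> frontier U \<noteq> {}"
      using not by (intro connected_Int_frontier) auto
    then obtain Z where Z: "dist X Z < \<rho>" "Z \<in> frontier U" by auto
    have ZK: "Z \<in> K" using Z(2) by (simp add: frontier_def K_def)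
    have "\<bar>u Z - u X\<bar> < m / 16" "\<bar>v Z - v X\<bar> < m / 16"
      using Z(1) by (auto intro!: ru(2)[rule_format, OF X ZK] rv(2)[rule_format, OF X ZK]
          simp: \<rho>_def dist_commute simp del: less_divide_eq_numeral1)
    thus False using big bd[OF Z(2)] m by (simp add: abs_less_iff)
  qed
  have cf: "continuous_on S f" and cg: "continuous_on S g" if "bounded S" for S
    unfolding f_def g_def using that c0
    by (auto intro!: continuous_on_sup_convolution[OF K cu] continuous_on_sup_convolution[OF K cv])
  have bK: "bounded K" using K(1) by (rule compact_imp_bounded)
  obtain X A1 A2 \<kappa> p1 p2 where ballU: "ball X \<rho> \<subseteq> U" and A: "linear A1" "linear A2"
    and \<kappa>: "strict_mono (\<kappa> :: nat \<Rightarrow> nat)" and p: "norm (p1 + p2) \<le> \<delta>'" and neg: "\<forall>h. (A1 h + A2 h) \<bullet> h \<le> 0"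
    and exp: "dyadic_expansion f X p1 A1 \<kappa>" "dyadic_expansion g X p2 A2 \<kappa>"
  proof (rule contact_point_second_order[OF K cf[OF bK] cg[OF bK] \<rho> less_imp_le[OF c0] \<delta>'(1), of "c * \<rho>"])
    show "\<exists>p. norm p \<le> c * \<rho> \<and> (\<forall>h. f X + p \<bullet> h - c * (norm h)\<^sup>2 \<le> f (X + h))" if "X \<in> K" for X
      unfolding f_def by (rule lower[OF that cu uM])
    show "\<exists>p. norm p \<le> c * \<rho> \<and> (\<forall>h. g X + p \<bullet> h - c * (norm h)\<^sup>2 \<le> g (X + h))" if "X \<in> K" for X
      unfolding g_def by (rule lower[OF that cv vM])
  next
    fix X q assume "X \<in> K" "norm q \<le> \<delta>'" "\<And>Y. Y \<in> K \<Longrightarrow> f Y + g Y - q \<bullet> Y \<le> f X + g X - q \<bullet> X"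
    thus "ball X \<rho> \<subseteq> U" by (rule inner)
  qed (rule UK)
  have \<rho>2: "0 < \<rho> / 2" and \<delta>3: "0 < \<delta> / 3" using \<rho> \<delta> by auto
  have pull_back: "\<exists>Y\<in>U. upper_jet w Y a B"
    if k: "norm k < \<rho> / 2" and jet: "upper_jet (sup_convolution K c w) (X + k) a B"
      and w: "continuous_on K w" "\<And>X. X \<in> K \<Longrightarrow> \<bar>w X\<bar> \<le> M" for w k a B
  proof -
    have XK: "X + k \<in> K" using k \<rho> ballU UK by (auto simp: dist_norm subset_eq)
    obtain Y where Y: "Y \<in> K" "sup_convolution K c w (X + k) = w Y - c * (norm (X + k - Y))\<^sup>2"
      by (rule sup_convolution_attained[OF K w(1)])
    \<comment> \<open>The shift \<open>k\<close> and the distance to the maximiser are each below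
      \<open>\<rho> / 2\<close>, so \<open>Y\<close> stays in the ball that lies inside
      \<open>U\<close>.\<close>
    have "norm (X - Y) < \<rho>"
      using near[OF XK Y w] norm_triangle_ineq4[of "X + k - Y" k] k by (simp add: algebra_simps)
    hence "Y \<in> U" using ballU by (auto simp: dist_norm)
    moreover have "upper_jet w Y a B"
      by (rule upper_jet_sup_convolution[OF K(1) w(1) U(1) UK \<open>Y \<in> U\<close> Y(2) jet])
    ultimately show ?thesis by blast
  qed
  obtain k a where k: "norm k < \<rho> / 2" "upper_jet f (X + k) a (\<lambda>h. A1 h + (\<delta>/3) *\<^sub>R h)" "norm (a - p1) \<le> \<delta> / 3"
    by (rule upper_jet_near_dyadic_expansion[OF exp(1) A(1) \<kappa> cf[OF bounded_cball] \<rho>2 \<delta>3])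
  obtain l b where l: "norm l < \<rho> / 2" "upper_jet g (X + l) b (\<lambda>h. A2 h + (\<delta>/3) *\<^sub>R h)" "norm (b - p2) \<le> \<delta> / 3"
    by (rule upper_jet_near_dyadic_expansion[OF exp(2) A(2) \<kappa> cg[OF bounded_cball] \<rho>2 \<delta>3])
  obtain Y where Y: "Y \<in> U" "upper_jet u Y a (\<lambda>h. A1 h + (\<delta>/3) *\<^sub>R h)"
    using pull_back[OF k(1) k(2)[unfolded f_def] cu uM] by blast
  obtain Z where Z: "Z \<in> U" "upper_jet v Z b (\<lambda>h. A2 h + (\<delta>/3) *\<^sub>R h)"
    using pull_back[OF l(1) l(2)[unfolded g_def] cv vM] by blast
  show thesis
  proof (rule that[OF Y(1) Z(1) Y(2) Z(2)])
    have "a + b = (a - p1) + (b - p2) + (p1 + p2)" by simp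
    also have "norm \<dots> \<le> \<delta> / 3 + \<delta> / 3 + \<delta> / 3"
      using k(3) l(3) p \<delta>'(2) by (intro norm_triangle_mono) auto
    finally show "norm (a + b) \<le> \<delta>" by simp
  next
    show "\<forall>h. (A1 h + (\<delta>/3) *\<^sub>R h + (A2 h + (\<delta>/3) *\<^sub>R h)) \<bullet> h \<le> \<delta> * (norm h)\<^sup>2"
    proof
      fix h
      have "(A1 h + (\<delta>/3) *\<^sub>R h + (A2 h + (\<delta>/3) *\<^sub>R h)) \<bullet> h = (A1 h + A2 h) \<bullet> h + 2 * (\<delta> / 3 * (norm h)\<^sup>2)"
        by (simp add: inner_add_left power2_norm_eq_inner)
      also have "\<dots> \<le> 0 + \<delta> * (norm h)\<^sup>2" using spec[OF neg, of h] \<delta> by (intro add_mono) auto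
      finally show "(A1 h + (\<delta>/3) *\<^sub>R h + (A2 h + (\<delta>/3) *\<^sub>R h)) \<bullet> h \<le> \<delta> * (norm h)\<^sup>2" by simp
    qed
  qed
qed

section \<open>Eigenvalues and viscosity solutions in terms of semijets\<close>

text \<open>On unit vectors the shift is exactly \<open>\<eta>\<close>, and it passes through the
  supremum and then the infimum. The bounds on \<open>j\<close> keep both sets nonempty: subspaces
  of dimension \<open>j\<close> exist, and they contain unit vectors.\<close>

lemma eigval_le_shift:
  fixes A B :: "real^'n^'n"
  assumes j: "1 \<le> j" "j \<le> CARD('n)"
    and le: "\<And>h. (A *v h) \<bullet> h \<le> (B *v h) \<bullet> h + \<eta> * (norm h)\<^sup>2"
  shows "eigval j A \<le> eigval j B + \<eta>"
proof -
  define Q where "Q M S = {(M *v v) \<bullet> v | v. v \<in> S \<and> norm v = 1}" for M :: "real^'n^'n" and S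
  have eig: "eigval j M = Inf {Sup (Q M S) | S. subspace S \<and> dim S = j}" for M
    by (simp add: eigval_def Q_def)
  have bound: "\<exists>K. \<forall>v. norm v = 1 \<longrightarrow> \<bar>(M *v v) \<bullet> v\<bar> \<le> K" for M :: "real^'n^'n"
  proof -
    obtain K where K: "\<And>v. norm (M *v v) \<le> norm v * K"
      using bounded_linear.bounded[OF matrix_vector_mul_bounded_linear[of M]] by blast
    have "\<bar>(M *v v) \<bullet> v\<bar> \<le> K" if "norm v = 1" for v
      using Cauchy_Schwarz_ineq2[of "M *v v" v] K[of v] that by simp
    thus ?thesis by blast
  qed
  have bdd: "bdd_above (Q M S)" for M S
    using bound[of M] unfolding Q_def bdd_above_def by (auto simp: abs_le_iff)
  have unit: "\<exists>v\<in>S. norm v = 1" if "subspace S" "dim S = j" for S :: "(real^'n) set"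
  proof -
    have "\<not> S \<subseteq> {0}" using that(2) j(1) dim_eq_0[of S] by linarith
    then obtain w where w: "w \<in> S" "w \<noteq> 0" by blast
    hence "(1 / norm w) *\<^sub>R w \<in> S" using that(1) by (simp add: subspace_scale)
    moreover have "norm ((1 / norm w) *\<^sub>R w) = 1" using w by simp
    ultimately show ?thesis by blast
  qed
  obtain S0 :: "(real^'n) set" where S0: "subspace S0" "dim S0 = j"
    using choose_subspace_of_subspace[of j "UNIV :: (real^'n) set"] j(2) by (auto simp: dim_UNIV)
  have below: "bdd_below {Sup (Q A S) | S. subspace S \<and> dim S = j}"
  proof -
    obtain K where K: "\<And>v. norm v = 1 \<Longrightarrow> \<bar>(A *v v) \<bullet> v\<bar> \<le> K" using bound[of A] by blast
    have "- K \<le> Sup (Q A S)" if S: "subspace S" "dim S = j" for S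
    proof -
      obtain v where v: "v \<in> S" "norm v = 1" using unit[OF S] by blast
      hence "(A *v v) \<bullet> v \<le> Sup (Q A S)" by (intro cSup_upper bdd) (auto simp: Q_def)
      thus ?thesis using K[OF v(2)] by linarith
    qed
    thus ?thesis unfolding bdd_below_def by blast
  qed
  have "eigval j A - \<eta> \<le> eigval j B"
    unfolding eig[of B]
  proof (rule cInf_greatest)
    show "{Sup (Q B S) | S. subspace S \<and> dim S = j} \<noteq> {}" using S0 by blast
    fix s assume "s \<in> {Sup (Q B S) | S. subspace S \<and> dim S = j}"
    then obtain S where S: "s = Sup (Q B S)" "subspace S" "dim S = j" by blast
    have "Q A S \<noteq> {}" using unit[OF S(2,3)] by (auto simp: Q_def)
    hence "Sup (Q A S) \<le> s + \<eta>"
    proof (rule cSup_least)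
      fix q assume "q \<in> Q A S"
      then obtain v where v: "q = (A *v v) \<bullet> v" "v \<in> S" "norm v = 1" by (auto simp: Q_def)
      have "(B *v v) \<bullet> v \<le> Sup (Q B S)" using v by (intro cSup_upper bdd) (auto simp: Q_def)
      thus "q \<le> s + \<eta>" using le[of v] v S(1) by simp
    qed
    moreover have "eigval j A \<le> Sup (Q A S)"
      unfolding eig by (rule cInf_lower[OF _ below]) (use S in blast)
    ultimately show "eigval j A - \<eta> \<le> s" by linarith
  qed
  thus ?thesis by linarith
qed

text \<open>The only subspace of full dimension is the whole space, so the infimum is over a single
  value, the supremum of the Rayleigh quotient.\<close>

lemma eigval_CARD_ge:
  fixes M :: "real^'n^'n"
  assumes "norm v = 1"
  shows "(M *v v) \<bullet> v \<le> eigval CARD('n) M"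
proof -
  obtain K where K: "\<And>v. norm (M *v v) \<le> norm v * K"
    using bounded_linear.bounded[OF matrix_vector_mul_bounded_linear[of M]] by blast
  have K': "(M *v v) \<bullet> v \<le> K" if "norm v = 1" for v
    using Cauchy_Schwarz_ineq2[of "M *v v" v] K[of v] that by simp
  have S: "subspace S \<and> dim S = CARD('n) \<longleftrightarrow> S = UNIV" for S :: "(real^'n) set"
  proof
    assume *: "subspace S \<and> dim S = CARD('n)"
    hence "span S = UNIV" using dim_eq_full[of S] by simp
    thus "S = UNIV" using * span_eq_iff[of S] by simp
  qed (simp add: dim_UNIV)
  have "{Sup {(M *v v) \<bullet> v | v. v \<in> S \<and> norm v = 1} | S. subspace S \<and> dim S = CARD('n)}
      = {Sup {(M *v v) \<bullet> v | v. v \<in> UNIV \<and> norm v = 1}}"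
    unfolding S by simp
  hence "eigval CARD('n) M = Sup {(M *v v) \<bullet> v | v. v \<in> UNIV \<and> norm v = 1}"
    unfolding eigval_def by simp
  moreover have "(M *v v) \<bullet> v \<le> Sup {(M *v v) \<bullet> v | v. v \<in> UNIV \<and> norm v = 1}"
    using assms K' by (intro cSup_upper) (auto simp: bdd_above_def)
  ultimately show ?thesis by simp
qed

section \<open>Degenerate ellipticity\<close>

text \<open>Monotonicity and the shift by multiples of the identity in one condition. Being stated
  through quadratic forms, it makes \<open>\<Lambda>\<close> blind to the antisymmetric part, so
  that the possibly non-symmetric map of a semijet can be inserted.\<close>

definition degenerate_elliptic :: "(real^'n^'n \<Rightarrow> real) \<Rightarrow> bool" where
  "degenerate_elliptic \<Lambda> \<longleftrightarrow> (\<forall>A B \<eta>. (\<forall>h. (A *v h) \<bullet> h \<le> (B *v h) \<bullet> h + \<eta> * (norm h)\<^sup>2) \<longrightarrow> \<Lambda> A \<le> \<Lambda> B + \<eta>)"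

lemma degenerate_ellipticD:
  assumes "degenerate_elliptic \<Lambda>" "\<And>h. (A *v h) \<bullet> h \<le> (B *v h) \<bullet> h + \<eta> * (norm h)\<^sup>2"
  shows "\<Lambda> A \<le> \<Lambda> B + \<eta>"
  using assms unfolding degenerate_elliptic_def by blast

lemma degenerate_elliptic_cong:
  assumes "degenerate_elliptic \<Lambda>" "\<And>h. (A *v h) \<bullet> h = (B *v h) \<bullet> h"
  shows "\<Lambda> A = \<Lambda> B"
  using degenerate_ellipticD[OF assms(1), of A B 0] degenerate_ellipticD[OF assms(1), of B A 0] assms(2)
  by simp

lemma degenerate_elliptic_eigval:
  assumes "1 \<le> j" "j \<le> CARD('n)"
  shows "degenerate_elliptic (eigval j :: real^'n^'n \<Rightarrow> real)"
  unfolding degenerate_elliptic_def using eigval_le_shift[OF assms] by blast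

lemma matrix_vector_mult_minus: "(- A) *v x = - (A *v x)" for A :: "real^'n^'m"
  by (simp add: matrix_vector_mult_def vec_eq_iff sum_negf)

text \<open>This is the operator that governs \<open>- u\<close> when \<open>\<Lambda>\<close>
  governs \<open>u\<close>; for the j-th eigenvalue of symmetric matrices it is the (N+1-j)-th.
  Stability of the class reduces the lower bound to the upper one.\<close>

lemma degenerate_elliptic_reflect:
  fixes \<Lambda> :: "real^'n^'n \<Rightarrow> real"
  assumes "degenerate_elliptic \<Lambda>"
  shows "degenerate_elliptic (\<lambda>M. - \<Lambda> (- M))"
  unfolding degenerate_elliptic_def
proof (intro allI impI)
  fix A B :: "real^'n^'n" and \<eta> assume le: "\<forall>h. (A *v h) \<bullet> h \<le> (B *v h) \<bullet> h + \<eta> * (norm h)\<^sup>2"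
  have "\<Lambda> (- B) \<le> \<Lambda> (- A) + \<eta>"
  proof (rule degenerate_ellipticD[OF assms])
    fix h show "(- B *v h) \<bullet> h \<le> (- A *v h) \<bullet> h + \<eta> * (norm h)\<^sup>2"
      using spec[OF le, of h] by (simp add: matrix_vector_mult_minus)
  qed
  thus "- \<Lambda> (- A) \<le> - \<Lambda> (- B) + \<eta>" by linarith
qed

lemma matrix_of_linear_works:
  fixes f :: "real^'n \<Rightarrow> real^'m"
  assumes "linear f"
  shows "matrix f *v x = f x"
  using assms by (simp add: matrix_works linear_matrix_vector_mul_eq)

lemma C2_test_quadratic:
  fixes M :: "real^'n^'n"
  assumes sym: "\<And>v w. (M *v v) \<bullet> w = v \<bullet> (M *v w)"
  shows "C2_test UNIV (\<lambda>y. a \<bullet> (y - x0) + ((M *v (y - x0)) \<bullet> (y - x0)) / 2)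
           (\<lambda>y. a + M *v (y - x0)) (\<lambda>_. M)"
  unfolding C2_test_def
proof (intro conjI ballI)
  fix x
  have Md: "((\<lambda>y. M *v (y - x0)) has_derivative (\<lambda>h. M *v h)) (at x)"
    by (auto intro!: derivative_eq_intros
        bounded_linear.has_derivative[OF matrix_vector_mul_bounded_linear])
  show "((\<lambda>y. a + M *v (y - x0)) has_derivative (\<lambda>h. M *v h)) (at x)"
    using has_derivative_add[OF has_derivative_const Md, of a] by simp
  have "((\<lambda>y. a \<bullet> (y - x0) + ((M *v (y - x0)) \<bullet> (y - x0)) / 2) has_derivative
      (\<lambda>h. a \<bullet> h + ((M *v (x - x0)) \<bullet> h + (M *v h) \<bullet> (x - x0)) / 2)) (at x)"
    by (auto intro!: derivative_eq_intros Md)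
  moreover have "(M *v h) \<bullet> (x - x0) = (M *v (x - x0)) \<bullet> h" for h
    using sym[of h "x - x0"] by (simp add: inner_commute)
  ultimately show "((\<lambda>y. a \<bullet> (y - x0) + ((M *v (y - x0)) \<bullet> (y - x0)) / 2) has_derivative
      (\<lambda>h. (a + M *v (x - x0)) \<bullet> h)) (at x)"
    by (simp add: inner_add_left)
qed auto

text \<open>Symmetrising keeps the quadratic form and makes the polynomial of a jet a test function
  whose Hessian is the given matrix.\<close>

lemma symmetric_matrix_of_linear:
  fixes B :: "real^'n \<Rightarrow> real^'n"
  assumes "linear B"
  obtains M where "\<And>v w. (M *v v) \<bullet> w = v \<bullet> (M *v w)" "\<And>v. (M *v v) \<bullet> v = B v \<bullet> v"
proof -
  define C where "C v = (1/2) *\<^sub>R (B v + adjoint B v)" for v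
  have "linear C" unfolding C_def
    by (intro linear_compose_scale_right linear_compose_add assms adjoint_linear)
  hence C: "matrix C *v v = C v" for v by (simp add: matrix_of_linear_works)
  have "(matrix C *v v) \<bullet> w = v \<bullet> (matrix C *v w)" for v w
    unfolding C by (simp add: C_def inner_add_left inner_add_right adjoint_works[OF assms] adjoint_clauses[OF assms])
  moreover have "(matrix C *v v) \<bullet> v = B v \<bullet> v" for v
    unfolding C using adjoint_works[OF assms, of v v]
    by (simp add: C_def inner_add_left inner_add_right inner_commute)
  ultimately show thesis by (rule that)
qed

section \<open>Semijets as test functions\<close>

text \<open>The quadratic polynomial of the jet, with \<open>B\<close> symmetrised, touches
  \<open>u\<close> from above, and \<open>\<Lambda>\<close> does not see the symmetrisation. The
  gradient \<open>a\<close> drops out because the equation does not depend on it.\<close>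

lemma visc_sub_upper_jet:
  fixes u :: "real^'n \<Rightarrow> real"
  assumes sub: "visc_sub \<Omega> (\<lambda>x r p M. G x r (\<Lambda> M)) u" and \<Lambda>: "degenerate_elliptic \<Lambda>"
    and x0: "x0 \<in> \<Omega>" and jet: "upper_jet u x0 a B"
  shows "G x0 (u x0) (\<Lambda> (matrix B)) \<le> 0"
proof -
  have B: "linear B" using jet by (simp add: upper_jet_def)
  obtain M where M: "\<And>v w. (M *v v) \<bullet> w = v \<bullet> (M *v w)" "\<And>v. (M *v v) \<bullet> v = B v \<bullet> v"
    using symmetric_matrix_of_linear[OF B] by blast
  obtain e where e: "e > 0" "\<And>h. norm h < e \<Longrightarrow> u (x0 + h) \<le> u x0 + a \<bullet> h + (B h \<bullet> h) / 2"
    using jet by (auto simp: upper_jet_def)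
  define p where "p y = a \<bullet> (y - x0) + ((M *v (y - x0)) \<bullet> (y - x0)) / 2" for y
  have "u y - p y \<le> u x0 - p x0" if "y \<in> ball x0 e" for y
    using e(2)[of "y - x0"] that by (simp add: p_def M(2) dist_norm norm_minus_commute)
  hence "G x0 (u x0) (\<Lambda> M) \<le> 0"
    using sub x0 C2_test_quadratic[OF M(1), of a x0] e(1)
    unfolding visc_sub_def p_def[abs_def] by blast
  moreover have "\<Lambda> M = \<Lambda> (matrix B)"
    by (rule degenerate_elliptic_cong[OF \<Lambda>]) (simp add: M(2) matrix_of_linear_works[OF B])
  ultimately show ?thesis by simp
qed

text \<open>Negation exchanges touching from below and from above, so \<open>- u\<close> is a
  subsolution for the reflected operator.\<close>

lemma visc_super_upper_jet:
  fixes u :: "real^'n \<Rightarrow> real"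
  assumes super: "visc_super \<Omega> (\<lambda>x r p M. G x r (\<Lambda> M)) u" and \<Lambda>: "degenerate_elliptic \<Lambda>"
    and x0: "x0 \<in> \<Omega>" and jet: "upper_jet (\<lambda>x. - u x) x0 a B"
  shows "0 \<le> G x0 (u x0) (\<Lambda> (- matrix B))"
proof -
  have "visc_sub \<Omega> (\<lambda>x r p M. - G x (- r) (- (- \<Lambda> (- M)))) (\<lambda>x. - u x)"
    unfolding visc_sub_def
  proof (intro conjI ballI allI impI)
    show "continuous_on \<Omega> (\<lambda>x. - u x)" using super by (auto simp: visc_super_def intro: continuous_intros)
    fix x0 U p Dp Hp
    assume x0: "x0 \<in> \<Omega>" and *: "C2_test U p Dp Hp \<and> x0 \<in> U \<and> (\<exists>e>0. \<forall>y\<in>ball x0 e. - u y - p y \<le> - u x0 - p x0)"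
    have "C2_test U (\<lambda>x. - p x) (\<lambda>x. - Dp x) (\<lambda>x. - Hp x)"
      unfolding C2_test_def
    proof (intro conjI ballI)
      fix x assume x: "x \<in> U"
      have "(p has_derivative (\<lambda>h. Dp x \<bullet> h)) (at x)" "(Dp has_derivative (\<lambda>h. Hp x *v h)) (at x)"
        using * x unfolding C2_test_def by blast+
      from this[THEN has_derivative_minus]
      show "((\<lambda>x. - p x) has_derivative (\<lambda>h. (- Dp x) \<bullet> h)) (at x)"
        "((\<lambda>x. - Dp x) has_derivative (\<lambda>h. (- Hp x) *v h)) (at x)"
        by (simp_all add: matrix_vector_mult_minus)
    qed (use * in \<open>auto simp: C2_test_def intro: continuous_intros\<close>)
    moreover have "\<exists>e>0. \<forall>y\<in>ball x0 e. u y - (- p y) \<ge> u x0 - (- p x0)" using * by force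
    ultimately have "0 \<le> G x0 (u x0) (\<Lambda> (- Hp x0))"
      using super x0 * unfolding visc_super_def by blast
    thus "- G x0 (- (- u x0)) (- (- \<Lambda> (- Hp x0))) \<le> 0" by simp
  qed
  from visc_sub_upper_jet[where G = "\<lambda>x r l. - G x (- r) (- l)", OF this degenerate_elliptic_reflect[OF \<Lambda>] x0 jet]
  show ?thesis by simp
qed

text \<open>This is the spatial block of a space-time Hessian, the only second-order part that the
  parabolic equation sees.\<close>

lemma linear_slice:
  fixes D :: "'a::real_normed_vector \<times> real \<Rightarrow> 'a \<times> real"
  assumes "linear D"
  shows "linear (\<lambda>k. fst (D (k, 0)))"
proof (rule linearI)
  show "fst (D (x + y, 0)) = fst (D (x, 0)) + fst (D (y, 0))" for x y
    using linear_add[OF assms, of "(x, 0)" "(y, 0)"] by simp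
  show "fst (D (c *\<^sub>R x, 0)) = c *\<^sub>R fst (D (x, 0))" for c x
    using linear_scale[OF assms, of c "(x, 0)"] by simp
qed

lemma C21_test_quadratic:
  fixes C :: "(real^'n) \<times> real \<Rightarrow> (real^'n) \<times> real"
  assumes C: "linear C" and sym: "\<And>v w. C v \<bullet> w = v \<bullet> C w"
  shows "C21_test UNIV (\<lambda>x t. a \<bullet> (x - x0) + \<alpha> * (t - t0) + (C (x - x0, t - t0) \<bullet> (x - x0, t - t0)) / 2)
     (\<lambda>x t. a + fst (C (x - x0, t - t0))) (\<lambda>x t. matrix (\<lambda>k. fst (C (k, 0))))
     (\<lambda>x t. \<alpha> + snd (C (x - x0, t - t0)))"
  unfolding C21_test_def
proof (intro conjI ballI, simp_all only: case_prod_unfold)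
  have bl: "bounded_linear C" using C by (simp add: linear_conv_bounded_linear)
  have dx: "((\<lambda>y. (y - x0, t - t0)) has_derivative (\<lambda>h. (h, 0))) (at x)" for x t
    by (auto intro!: derivative_eq_intros)
  note Cx = bounded_linear.has_derivative[OF bl dx]
  note lin = linear_slice[OF C]
  fix X :: "(real^'n) \<times> real" assume "X \<in> UNIV"
  obtain x t where X: "X = (x, t)" by (cases X)
  have sq: "((\<lambda>y. C (y - x0, t - t0) \<bullet> (y - x0, t - t0)) has_derivative
      (\<lambda>h. C (x - x0, t - t0) \<bullet> (h, 0) + C (h, 0) \<bullet> (x - x0, t - t0))) (at x)"
    by (rule has_derivative_inner[OF Cx dx])
  have "((\<lambda>y. a \<bullet> (y - x0) + \<alpha> * (t - t0) + (C (y - x0, t - t0) \<bullet> (y - x0, t - t0)) / 2) has_derivative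
      (\<lambda>h. a \<bullet> h + (C (x - x0, t - t0) \<bullet> (h, 0) + C (h, 0) \<bullet> (x - x0, t - t0)) / 2)) (at x)"
  proof (rule has_derivative_add)
    show "((\<lambda>y. a \<bullet> (y - x0) + \<alpha> * (t - t0)) has_derivative (\<lambda>h. a \<bullet> h)) (at x)"
      by (auto intro!: derivative_eq_intros)
  qed (rule bounded_linear.has_derivative[OF bounded_linear_divide sq])
  moreover have "C (h, 0) \<bullet> (x - x0, t - t0) = C (x - x0, t - t0) \<bullet> (h, 0)" for h
    using sym[of "(h, 0)"] by (metis inner_commute)
  moreover have "C (x - x0, t - t0) \<bullet> (h, 0) = fst (C (x - x0, t - t0)) \<bullet> h" for h
    by (simp add: inner_prod_def)
  ultimately show "((\<lambda>y. a \<bullet> (y - x0) + \<alpha> * (snd X - t0) + (C (y - x0, snd X - t0) \<bullet> (y - x0, snd X - t0)) / 2) has_derivative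
      (\<lambda>h. (a + fst (C (fst X - x0, snd X - t0))) \<bullet> h)) (at (fst X))"
    by (simp add: X inner_add_left)
  have "((\<lambda>y. fst (C (y - x0, t - t0))) has_derivative (\<lambda>h. fst (C (h, 0)))) (at x)"
    by (rule has_derivative_fst[OF Cx])
  thus "((\<lambda>y. a + fst (C (y - x0, snd X - t0))) has_derivative (\<lambda>h. matrix (\<lambda>k. fst (C (k, 0))) *v h)) (at (fst X))"
    using has_derivative_add[OF has_derivative_const, of _ _ _ a] by (simp add: X matrix_of_linear_works[OF lin])
  have dt: "((\<lambda>s. (x - x0, s - t0)) has_derivative (\<lambda>h. (0, h))) (at t)"
    by (auto intro!: derivative_eq_intros)
  note Ct = bounded_linear.has_derivative[OF bl dt]
  have sq: "((\<lambda>s. C (x - x0, s - t0) \<bullet> (x - x0, s - t0)) has_derivative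
      (\<lambda>h. C (x - x0, t - t0) \<bullet> (0, h) + C (0, h) \<bullet> (x - x0, t - t0))) (at t)"
    by (rule has_derivative_inner[OF Ct dt])
  have "((\<lambda>s. a \<bullet> (x - x0) + \<alpha> * (s - t0) + (C (x - x0, s - t0) \<bullet> (x - x0, s - t0)) / 2) has_derivative
      (\<lambda>h. \<alpha> * h + (C (x - x0, t - t0) \<bullet> (0, h) + C (0, h) \<bullet> (x - x0, t - t0)) / 2)) (at t)"
  proof (rule has_derivative_add)
    show "((\<lambda>s. a \<bullet> (x - x0) + \<alpha> * (s - t0)) has_derivative (\<lambda>h. \<alpha> * h)) (at t)"
      by (auto intro!: derivative_eq_intros)
  qed (rule bounded_linear.has_derivative[OF bounded_linear_divide sq])
  moreover have "(\<lambda>h. \<alpha> * h + (C (x - x0, t - t0) \<bullet> (0, h) + C (0, h) \<bullet> (x - x0, t - t0)) / 2)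
      = (*) (\<alpha> + snd (C (x - x0, t - t0)))"
  proof
    fix h :: real
    have "C (0, h) \<bullet> (x - x0, t - t0) = C (x - x0, t - t0) \<bullet> (0, h)"
      using sym[of "(0, h)"] by (metis inner_commute)
    moreover have "C (x - x0, t - t0) \<bullet> (0, h) = snd (C (x - x0, t - t0)) * h"
      by (simp add: inner_prod_def)
    ultimately show "\<alpha> * h + (C (x - x0, t - t0) \<bullet> (0, h) + C (0, h) \<bullet> (x - x0, t - t0)) / 2
      = (\<alpha> + snd (C (x - x0, t - t0))) * h" by (simp add: distrib_right)
  qed
  ultimately show "((\<lambda>s. a \<bullet> (fst X - x0) + \<alpha> * (s - t0) + (C (fst X - x0, s - t0) \<bullet> (fst X - x0, s - t0)) / 2)
      has_real_derivative \<alpha> + snd (C (fst X - x0, snd X - t0))) (at (snd X))"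
    by (simp add: X has_field_derivative_def)
next
  have bl: "bounded_linear C" using C by (simp add: linear_conv_bounded_linear)
  have cC: "continuous_on UNIV (\<lambda>X. C (fst X - x0, snd X - t0))"
    by (intro bounded_linear.continuous_on[OF bl] continuous_intros)
  show "continuous_on UNIV (\<lambda>X. a \<bullet> (fst X - x0) + \<alpha> * (snd X - t0) + (C (fst X - x0, snd X - t0) \<bullet> (fst X - x0, snd X - t0)) / 2)"
    by (intro continuous_intros cC) auto
  show "continuous_on UNIV (\<lambda>X. a + fst (C (fst X - x0, snd X - t0)))"
    by (intro continuous_intros cC)
  show "continuous_on UNIV (\<lambda>X. \<alpha> + snd (C (fst X - x0, snd X - t0)))"
    by (intro continuous_intros cC)
qed auto

lemma pvisc_sub_upper_jet:
  fixes u :: "real^'n \<Rightarrow> real \<Rightarrow> real"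
  assumes sub: "pvisc_sub \<Omega> (\<lambda>x t r pt p M. pt - \<Lambda> M) u" and \<Lambda>: "degenerate_elliptic \<Lambda>"
    and x0: "x0 \<in> \<Omega>" "0 < t0" and jet: "upper_jet (\<lambda>(x, t). u x t) (x0, t0) (a, \<alpha>) B"
  shows "\<alpha> \<le> \<Lambda> (matrix (\<lambda>k. fst (B (k, 0))))"
proof -
  have B: "linear B" using jet by (simp add: upper_jet_def)
  define C where "C v = (1/2) *\<^sub>R (B v + adjoint B v)" for v
  have C: "linear C" unfolding C_def
    by (intro linear_compose_scale_right linear_compose_add B adjoint_linear)
  have sym: "C v \<bullet> w = v \<bullet> C w" for v w
    by (simp add: C_def inner_add_left inner_add_right adjoint_works[OF B] adjoint_clauses[OF B])
  have CB: "C v \<bullet> v = B v \<bullet> v" for v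
    using adjoint_works[OF B, of v v] by (simp add: C_def inner_add_left inner_add_right inner_commute)
  obtain e where e: "e > 0" "\<And>h. norm h < e \<Longrightarrow> (\<lambda>(x, t). u x t) ((x0, t0) + h) \<le> u x0 t0 + (a, \<alpha>) \<bullet> h + (B h \<bullet> h) / 2"
    using jet by (auto simp: upper_jet_def)
  define p where "p x t = a \<bullet> (x - x0) + \<alpha> * (t - t0) + (C (x - x0, t - t0) \<bullet> (x - x0, t - t0)) / 2" for x t
  \<comment> \<open>Half of \<open>e\<close>, because space and time are bounded separately and the
    norm of a pair is at most the sum of the two norms.\<close>
  have "u y s - p y s \<le> u x0 t0 - p x0 t0" if "dist y x0 < e / 2" "\<bar>s - t0\<bar> < e / 2" for y s
  proof -
    have "norm (y - x0, s - t0) \<le> norm (y - x0) + norm (s - t0)" by (rule norm_Pair_le)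
    hence "norm (y - x0, s - t0) < e" using that by (simp add: dist_norm)
    from e(2)[OF this] show ?thesis by (simp add: p_def CB inner_prod_def[of _ "(0, 0)"])
  qed
  moreover have "0 < e / 2" using e(1) by simp
  ultimately have "\<exists>e>0. \<forall>y s. dist y x0 < e \<and> \<bar>s - t0\<bar> < e \<longrightarrow> u y s - p y s \<le> u x0 t0 - p x0 t0" by blast
  moreover note C21_test_quadratic[OF C sym, of a x0 \<alpha> t0]
  ultimately have "(\<alpha> + snd (C (x0 - x0, t0 - t0))) - \<Lambda> (matrix (\<lambda>k. fst (C (k, 0)))) \<le> 0"
    using sub x0 unfolding pvisc_sub_def p_def[abs_def] by blast
  moreover have "\<Lambda> (matrix (\<lambda>k. fst (C (k, 0)))) = \<Lambda> (matrix (\<lambda>k. fst (B (k, 0))))"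
  proof (rule degenerate_elliptic_cong[OF \<Lambda>])
    fix h :: "real^'n"
    have "fst (D (h, 0)) \<bullet> h = D (h, 0) \<bullet> (h, 0)" for D :: "(real^'n) \<times> real \<Rightarrow> (real^'n) \<times> real"
      by (simp add: inner_prod_def)
    thus "(matrix (\<lambda>k. fst (C (k, 0))) *v h) \<bullet> h = (matrix (\<lambda>k. fst (B (k, 0))) *v h) \<bullet> h"
      by (simp add: matrix_of_linear_works[OF linear_slice[OF C]] matrix_of_linear_works[OF linear_slice[OF B]] CB)
  qed
  ultimately show ?thesis using linear_0[OF C] by (simp add: zero_prod_def)
qed

section \<open>Concavity of the eigenfunction\<close>

text \<open>If convexity fails on a segment, \<open>f\<close> is touched from above, inside a thin
  tube around it, by a function strictly concave along the segment. Its Hessian is negative in that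
  direction, against the hypothesis on jets.\<close>

lemma convex_on_of_upper_jets:
  fixes f :: "'a::euclidean_space \<Rightarrow> real"
  assumes W: "open W" "convex W" and cont: "continuous_on W f"
    and jets: "\<And>x a B v. x \<in> W \<Longrightarrow> upper_jet f x a B \<Longrightarrow> 0 \<le> B v \<bullet> v"
  shows "convex_on W f"
proof (rule convex_onI[OF _ W(2)], rule ccontr)
  fix s :: real and x1 x2 :: 'a
  assume s: "0 < s" "s < 1" and x: "x1 \<in> W" "x2 \<in> W"
    and "\<not> f ((1 - s) *\<^sub>R x1 + s *\<^sub>R x2) \<le> (1 - s) * f x1 + s * f x2"
  hence gt: "(1 - s) * f x1 + s * f x2 < f ((1 - s) *\<^sub>R x1 + s *\<^sub>R x2)" by simp
  define e where "e = x2 - x1"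
  have e: "e \<noteq> 0"
  proof
    assume "e = 0"
    hence "x2 = x1" by (simp add: e_def)
    with gt show False by (simp flip: scaleR_add_left distrib_right)
  qed
  \<comment> \<open>Coordinates adapted to the segment: \<open>\<sigma>\<close> runs from
    \<open>0\<close> at \<open>x1\<close> to \<open>1\<close> at \<open>x2\<close>, and
    \<open>k\<close> is the component orthogonal to \<open>e\<close>; the primed versions are their
    linear parts.\<close>
  define \<sigma>' where "\<sigma>' h = (h \<bullet> e) / (e \<bullet> e)" for h
  define k' where "k' h = h - \<sigma>' h *\<^sub>R e" for h
  define \<sigma> where "\<sigma> y = \<sigma>' (y - x1)" for y
  define k where "k y = k' (y - x1)" for y
  have ee: "0 < e \<bullet> e" using e by simp
  have \<sigma>'_add: "\<sigma>' (h + h') = \<sigma>' h + \<sigma>' h'" for h h' by (simp add: \<sigma>'_def inner_add_left add_divide_distrib)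
  have k'_add: "k' (h + h') = k' h + k' h'" for h h' unfolding k'_def \<sigma>'_add by (simp add: scaleR_add_left)
  have \<sigma>'_scale: "\<sigma>' (c *\<^sub>R h) = c * \<sigma>' h" for c h by (simp add: \<sigma>'_def)
  have k'_scale: "k' (c *\<^sub>R h) = c *\<^sub>R k' h" for c h unfolding k'_def \<sigma>'_scale by (simp add: scaleR_diff_right)
  have \<sigma>'e: "\<sigma>' e = 1" using ee by (simp add: \<sigma>'_def)
  have k'e: "k' e = 0" by (simp add: k'_def \<sigma>'e)
  have k'_orth: "k' h \<bullet> e = 0" for h
  proof -
    have "k' h \<bullet> e = h \<bullet> e - \<sigma>' h * (e \<bullet> e)" by (simp only: k'_def inner_diff_left inner_scaleR_left)
    thus ?thesis using ee by (simp add: \<sigma>'_def)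
  qed
  have k'_inner: "k' h \<bullet> k' h' = k' h \<bullet> h'" for h h'
  proof -
    have "k' h \<bullet> k' h' = k' h \<bullet> h' - \<sigma>' h' * (k' h \<bullet> e)"
      unfolding k'_def[of h'] by (simp only: inner_diff_right inner_scaleR_right)
    thus ?thesis using k'_orth[of h] by simp
  qed
  have decomp: "y = x1 + \<sigma> y *\<^sub>R e + k y" for y by (simp add: \<sigma>_def k_def k'_def)
  define xs where "xs = (1 - s) *\<^sub>R x1 + s *\<^sub>R x2"
  have xs: "xs - x1 = s *\<^sub>R e" by (simp add: xs_def e_def algebra_simps)
  have \<sigma>xs: "\<sigma> xs = s" and kxs: "k xs = 0" by (simp_all add: \<sigma>_def k_def xs \<sigma>'_scale k'_scale \<sigma>'e k'e)
  define gap where "gap = f xs - ((1 - s) * f x1 + s * f x2)"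
  have gap: "0 < gap" using gt by (simp add: gap_def xs_def)
  \<comment> \<open>The chord is subtracted and a term vanishing at both ends is added. Its
    coefficient is the failure of convexity, and the value at \<open>xs\<close> stays positive since
    \<open>s - s^2 < 1\<close>. On the other side of the inequality the term supplies the concavity
    along \<open>e\<close>.\<close>
  define \<Psi> where "\<Psi> y = f y - (f x1 + \<sigma> y * (f x2 - f x1)) + gap * ((\<sigma> y)\<^sup>2 - \<sigma> y)" for y
  have c\<sigma>: "continuous_on S \<sigma>" for S
    unfolding \<sigma>_def \<sigma>'_def using ee by (intro continuous_intros) auto
  have ck: "continuous_on S k" for S
    using c\<sigma>[of S] unfolding k_def k'_def \<sigma>_def[symmetric] by (intro continuous_intros)
  have c\<Psi>: "continuous_on W \<Psi>" unfolding \<Psi>_def by (intro continuous_intros cont c\<sigma>)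
  define d where "d = \<Psi> xs"
  have d: "0 < d"
  proof -
    have "d = gap * (1 + (s\<^sup>2 - s))" by (simp add: d_def \<Psi>_def \<sigma>xs gap_def algebra_simps)
    moreover have "0 < 1 + (s\<^sup>2 - s)" using s zero_le_power2[of s] by linarith
    ultimately show ?thesis using gap by simp
  qed
  have \<Psi>1: "\<Psi> x1 = 0" by (simp add: \<Psi>_def \<sigma>_def \<sigma>'_def)
  have \<sigma>x2: "\<sigma> x2 = 1" unfolding \<sigma>_def e_def[symmetric] by (rule \<sigma>'e)
  have \<Psi>2: "\<Psi> x2 = 0" by (simp add: \<Psi>_def \<sigma>x2)
  have near: "\<exists>r>0. \<forall>y. dist y w < r \<longrightarrow> \<Psi> y < d" if "w \<in> W" "\<Psi> w = 0" for w
  proof -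
    have "isCont \<Psi> w" using c\<Psi> W(1) that(1) continuous_on_eq_continuous_at by blast
    then obtain r where "r > 0" "\<forall>y. dist y w < r \<longrightarrow> dist (\<Psi> y) (\<Psi> w) < d"
      using d unfolding continuous_at_eps_delta by blast
    thus ?thesis using that(2) by (intro exI[of _ r]) (auto simp: dist_real_def abs_less_iff)
  qed
  obtain r1 where r1: "0 < r1" "\<forall>y. dist y x1 < r1 \<longrightarrow> \<Psi> y < d" using near[OF x(1) \<Psi>1] by blast
  obtain r2 where r2: "0 < r2" "\<forall>y. dist y x2 < r2 \<longrightarrow> \<Psi> y < d" using near[OF x(2) \<Psi>2] by blast
  have seg: "closed_segment x1 x2 \<subseteq> W" using x W(2) by (simp add: closed_segment_subset)
  obtain r0 where r0: "0 < r0" "{y. infdist y (closed_segment x1 x2) \<le> r0} \<subseteq> W"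
    using compact_in_open_separated[OF _ compact_segment W(1) seg] by auto
  \<comment> \<open>A tube thinner than \<open>r1\<close> and \<open>r2\<close> has end faces on
    which \<open>\<Psi> < d\<close>; thinner than \<open>r0\<close>, it stays in
    \<open>W\<close>.\<close>
  define \<rho> where "\<rho> = min r0 (min r1 r2) / 2"
  have \<rho>: "0 < \<rho>" "\<rho> < r0" "\<rho> < r1" "\<rho> < r2" using r0 r1 r2 by (auto simp: \<rho>_def min_def)
  define T where "T = {y. 0 \<le> \<sigma> y \<and> \<sigma> y \<le> 1 \<and> norm (k y) \<le> \<rho>}"
  have TW: "T \<subseteq> W"
  proof
    fix y assume y: "y \<in> T"
    have "x1 + \<sigma> y *\<^sub>R e \<in> closed_segment x1 x2"
      using y by (auto simp: T_def in_segment e_def algebra_simps intro!: exI[of _ "\<sigma> y"])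
    hence "infdist y (closed_segment x1 x2) \<le> dist y (x1 + \<sigma> y *\<^sub>R e)" by (rule infdist_le)
    also have "dist y (x1 + \<sigma> y *\<^sub>R e) = norm (k y)" by (simp add: dist_norm k_def k'_def \<sigma>_def algebra_simps)
    also have "\<dots> \<le> r0" using y \<rho> by (simp add: T_def)
    finally show "y \<in> W" using r0(2) by blast
  qed
  have "compact T"
  proof -
    have "closed T"
      unfolding T_def by (intro closed_Collect_conj closed_Collect_le continuous_intros c\<sigma> ck)
    moreover have "bounded T"
      unfolding bounded_iff
    proof (intro exI[of _ "norm x1 + norm e + \<rho>"] ballI)
      fix y assume y: "y \<in> T"
      have "norm y \<le> norm x1 + norm (\<sigma> y *\<^sub>R e) + norm (k y)"
        by (subst decomp[of y]) (intro norm_triangle_mono order_refl)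
      also have "norm (\<sigma> y *\<^sub>R e) \<le> norm e" using y by (auto simp: T_def mult_left_le_one_le)
      finally show "norm y \<le> norm x1 + norm e + \<rho>" using y by (simp add: T_def)
    qed
    ultimately show ?thesis by (simp add: compact_eq_bounded_closed)
  qed
  have xsT: "xs \<in> T" using s \<rho> by (simp add: T_def \<sigma>xs kxs)
  obtain P where P: "\<forall>y\<in>T. \<bar>\<Psi> y\<bar> \<le> P"
    using continuous_on_compact_abs_bound[OF \<open>compact T\<close> continuous_on_subset[OF c\<Psi> TW]] by (rule exE)
  \<comment> \<open>With this penalty \<open>H\<close> is nonpositive on the lateral surface, where
    \<open>k\<close> has norm \<open>\<rho>\<close>.\<close>
  define M where "M = P / \<rho>\<^sup>2"
  have M\<rho>: "M * \<rho>\<^sup>2 = P" using \<rho> by (simp add: M_def)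
  define H where "H y = \<Psi> y - M * (k y \<bullet> k y)" for y
  have "continuous_on T H"
    unfolding H_def by (intro continuous_intros ck continuous_on_subset[OF c\<Psi> TW])
  then obtain x where xT: "x \<in> T" and max: "\<forall>y\<in>T. H y \<le> H x"
    using continuous_attains_sup[OF \<open>compact T\<close>, of H] xsT by blast
  have Hx: "d \<le> H x" using bspec[OF max xsT] by (simp add: H_def kxs d_def)
  have M0: "0 \<le> M" using bspec[OF P xsT] \<rho> by (simp add: M_def)
  have "0 \<le> M * (k x \<bullet> k x)" using M0 by simp
  hence \<Psi>x: "d \<le> \<Psi> x" using Hx unfolding H_def by linarith
  have kx: "norm (k x) < \<rho>"
  proof (rule ccontr)
    assume "\<not> norm (k x) < \<rho>"
    hence "norm (k x) = \<rho>" using xT by (simp add: T_def)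
    hence "k x \<bullet> k x = \<rho>\<^sup>2" by (simp flip: power2_norm_eq_inner)
    hence "H x = \<Psi> x - P" using M\<rho> by (simp add: H_def)
    thus False using bspec[OF P xT] Hx d by (simp add: abs_le_iff)
  qed
  have \<sigma>0: "\<sigma> x \<noteq> 0"
  proof
    assume "\<sigma> x = 0"
    hence "x = x1 + k x" using decomp[of x] by simp
    hence "x - x1 = k x" by (metis add_diff_cancel_left')
    hence "dist x x1 = norm (k x)" by (simp only: dist_norm)
    hence "dist x x1 < r1" using kx \<rho> by linarith
    hence "\<Psi> x < d" using r1(2) by blast
    thus False using \<Psi>x by linarith
  qed
  have \<sigma>1: "\<sigma> x \<noteq> 1"
  proof
    assume "\<sigma> x = 1"
    hence "x = x2 + k x" using decomp[of x] by (simp add: e_def)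
    hence "x - x2 = k x" by (metis add_diff_cancel_left')
    hence "dist x x2 = norm (k x)" by (simp only: dist_norm)
    hence "dist x x2 < r2" using kx \<rho> by linarith
    hence "\<Psi> x < d" using r2(2) by blast
    thus False using \<Psi>x by linarith
  qed
  have open_V: "open {y. 0 < \<sigma> y \<and> \<sigma> y < 1 \<and> norm (k y) < \<rho>}"
    by (intro open_Collect_conj open_Collect_less continuous_intros c\<sigma> ck)
  have "x \<in> {y. 0 < \<sigma> y \<and> \<sigma> y < 1 \<and> norm (k y) < \<rho>}" using xT \<sigma>0 \<sigma>1 kx by (simp add: T_def)
  then obtain \<epsilon> where \<epsilon>: "0 < \<epsilon>" "ball x \<epsilon> \<subseteq> {y. 0 < \<sigma> y \<and> \<sigma> y < 1 \<and> norm (k y) < \<rho>}"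
    using open_V by (meson openE)
  \<comment> \<open>Gradient at \<open>x\<close> and Hessian of the touching function, which up to a
    constant is the chord minus \<open>gap * (\<sigma>^2 - \<sigma>)\<close> plus
    \<open>M * (k \<bullet> k)\<close>.\<close>
  define a where "a = ((f x2 - f x1 - gap * (2 * \<sigma> x - 1)) / (e \<bullet> e)) *\<^sub>R e + (2 * M) *\<^sub>R k x"
  define B where "B h = 2 *\<^sub>R (M *\<^sub>R k' h - ((gap * \<sigma>' h) / (e \<bullet> e)) *\<^sub>R e)" for h
  have "linear B"
    by (rule linearI) (simp_all add: B_def k'_add \<sigma>'_add k'_scale \<sigma>'_scale algebra_simps add_divide_distrib)
  moreover have "f (x + h) \<le> f x + a \<bullet> h + (B h \<bullet> h) / 2" if h: "norm h < \<epsilon>" for h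
  proof -
    have "x + h \<in> ball x \<epsilon>" using h by (simp add: dist_norm)
    hence "x + h \<in> {y. 0 < \<sigma> y \<and> \<sigma> y < 1 \<and> norm (k y) < \<rho>}" using \<epsilon>(2) by blast
    hence "x + h \<in> T" by (simp add: T_def)
    hence le: "H (x + h) \<le> H x" using max by blast
    have sh: "\<sigma> (x + h) = \<sigma> x + \<sigma>' h" and kh: "k (x + h) = k x + k' h"
      using \<sigma>'_add[of "x - x1" h] k'_add[of "x - x1" h] by (simp_all add: \<sigma>_def k_def algebra_simps)
    have ah: "a \<bullet> h = (f x2 - f x1 - gap * (2 * \<sigma> x - 1)) * \<sigma>' h + 2 * M * (k x \<bullet> h)"
      by (simp add: a_def inner_add_left \<sigma>'_def inner_commute[of h e])
    have Bh: "(B h \<bullet> h) / 2 = M * (k' h \<bullet> h) - gap * (\<sigma>' h)\<^sup>2"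
      by (simp add: B_def inner_diff_left \<sigma>'_def inner_commute[of h e] power2_eq_square)
    have kk: "k (x + h) \<bullet> k (x + h) = k x \<bullet> k x + 2 * (k x \<bullet> h) + k' h \<bullet> h"
    proof -
      have "k (x + h) \<bullet> k (x + h) = k x \<bullet> k x + 2 * (k x \<bullet> k' h) + k' h \<bullet> k' h"
        unfolding kh by (simp add: inner_add_left inner_add_right inner_commute)
      moreover have "k x \<bullet> k' h = k x \<bullet> h" unfolding k_def by (rule k'_inner)
      ultimately show ?thesis using k'_inner[of h h] by simp
    qed
    have "f (x + h) = H (x + h) + f x1 + \<sigma> (x + h) * (f x2 - f x1) - gap * ((\<sigma> (x + h))\<^sup>2 - \<sigma> (x + h))
        + M * (k (x + h) \<bullet> k (x + h))" by (simp add: H_def \<Psi>_def)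
    also have "\<dots> \<le> H x + f x1 + \<sigma> (x + h) * (f x2 - f x1) - gap * ((\<sigma> (x + h))\<^sup>2 - \<sigma> (x + h))
        + M * (k (x + h) \<bullet> k (x + h))" using le by simp
    also have "\<dots> = f x + a \<bullet> h + (B h \<bullet> h) / 2"
      unfolding ah Bh kk sh H_def \<Psi>_def by (simp add: power2_eq_square algebra_simps)
    finally show ?thesis .
  qed
  ultimately have "upper_jet f x a B" unfolding upper_jet_def using \<epsilon>(1) by blast
  hence "0 \<le> B e \<bullet> e" using jets xT TW by blast
  moreover have "B e \<bullet> e = - 2 * gap" using ee by (simp add: B_def \<sigma>'e k'e)
  ultimately show False using gap by simp
qed

text \<open>Separation of \<open>(x0, f x0)\<close> from the strict epigraph. A vertical hyperplane
  is excluded because the open set \<open>W\<close> contains points displaced from \<open>x0\<close>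
  against its normal.\<close>

lemma convex_on_open_subgradient:
  fixes f :: "'a::euclidean_space \<Rightarrow> real"
  assumes W: "open W" and f: "convex_on W f" and x0: "x0 \<in> W"
  obtains p where "\<forall>x\<in>W. f x0 + p \<bullet> (x - x0) \<le> f x"
proof -
  define S where "S = {(x, t). x \<in> W \<and> f x < t}"
  have "convex S"
    unfolding convex_alt
  proof (intro ballI allI impI)
    fix X Y and u :: real assume XY: "X \<in> S" "Y \<in> S" and u: "0 \<le> u \<and> u \<le> 1"
    obtain x s y t where XY': "X = (x, s)" "Y = (y, t)" by (cases X, cases Y)
    have in_S: "x \<in> W" "f x < s" "y \<in> W" "f y < t" using XY by (auto simp: XY' S_def)
    have "f ((1 - u) *\<^sub>R x + u *\<^sub>R y) \<le> (1 - u) * f x + u * f y"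
      using u in_S by (intro convex_onD[OF f]) auto
    also have "\<dots> < (1 - u) * s + u * t"
    proof (cases "u = 0")
      case False
      thus ?thesis using u in_S by (intro add_le_less_mono mult_left_mono mult_strict_left_mono) auto
    qed (use in_S in simp)
    finally show "(1 - u) *\<^sub>R X + u *\<^sub>R Y \<in> S"
      using convexD_alt[OF convex_on_imp_convex[OF f] in_S(1,3), of u] u by (simp add: S_def XY')
  qed
  moreover have "(x0, f x0 + 1) \<in> S" using x0 by (simp add: S_def)
  hence "S \<noteq> {}" by blast
  moreover have "{(x0, f x0)} \<inter> S = {}" by (simp add: S_def)
  ultimately have "\<exists>A b. A \<noteq> 0 \<and> (\<forall>x\<in>{(x0, f x0)}. A \<bullet> x \<le> b) \<and> (\<forall>x\<in>S. b \<le> A \<bullet> x)"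
    by (intro separating_hyperplane_sets) simp_all
  then obtain A b where A: "A \<noteq> 0" "A \<bullet> (x0, f x0) \<le> b" "\<forall>x\<in>S. b \<le> A \<bullet> x" by auto
  obtain q \<tau> where A': "A = (q, \<tau>)" by (cases A)
  have le: "q \<bullet> x0 + \<tau> * f x0 \<le> q \<bullet> x + \<tau> * t" if "x \<in> W" "f x < t" for x t
  proof -
    have "(x, t) \<in> S" using that by (simp add: S_def)
    from bspec[OF A(3) this] A(2) show ?thesis by (simp add: A')
  qed
  have "0 \<le> \<tau>" using le[OF x0, of "f x0 + 1"] by (simp add: algebra_simps)
  moreover have "\<tau> \<noteq> 0"
  proof
    assume \<tau>: "\<tau> = 0"
    hence q: "q \<noteq> 0" using A(1) by (simp add: A' zero_prod_def)
    obtain r where r: "0 < r" "ball x0 r \<subseteq> W" using W x0 by (meson openE)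
    define c where "c = r / (2 * norm q)"
    have c: "0 < c" using r q by (simp add: c_def)
    have "norm (c *\<^sub>R q) < r" using r q by (simp add: c_def)
    hence "x0 - c *\<^sub>R q \<in> W" using r(2) by (auto simp: dist_norm subset_eq)
    from le[OF this, of "f (x0 - c *\<^sub>R q) + 1"] have "c * (q \<bullet> q) \<le> 0"
      by (simp add: \<tau> inner_diff_right)
    moreover have "0 < c * (q \<bullet> q)" using c q by simp
    ultimately show False by linarith
  qed
  ultimately have \<tau>: "0 < \<tau>" by simp
  show thesis
  proof (rule that[of "- (1 / \<tau>) *\<^sub>R q"], rule ballI)
    fix x assume x: "x \<in> W"
    have "f x0 + (- (1 / \<tau>) *\<^sub>R q) \<bullet> (x - x0) \<le> f x + \<epsilon>" if "0 < \<epsilon>" for \<epsilon>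
    proof -
      have "q \<bullet> x0 + \<tau> * f x0 \<le> q \<bullet> x + \<tau> * (f x + \<epsilon>)" using that by (intro le x) simp
      thus ?thesis using \<tau> by (simp add: field_simps inner_diff_right)
    qed
    thus "f x0 + (- (1 / \<tau>) *\<^sub>R q) \<bullet> (x - x0) \<le> f x" by (rule field_le_epsilon)
  qed
qed

section \<open>Consequences for the eigenfunction\<close>

text \<open>A bound on the largest eigenvalue is a bound in every direction at once: the form of
  \<open>- B\<close> is at most \<open>- \<mu> * \<psi> x\<close> on unit vectors.\<close>

lemma visc_super_eigval_CARD_upper_jet:
  fixes \<psi> :: "real^'n \<Rightarrow> real"
  assumes super: "visc_super \<Omega> (\<lambda>x r p M. - eigval CARD('n) M - \<mu> * r) \<psi>"
    and x: "x \<in> \<Omega>" and jet: "upper_jet (\<lambda>x. - \<psi> x) x a B"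
  shows "\<mu> * \<psi> x * (norm v)\<^sup>2 \<le> B v \<bullet> v"
proof (cases "v = 0")
  case False
  have B: "linear B" using jet by (simp add: upper_jet_def)
  have N: "1 \<le> CARD('n)" by (simp add: Suc_leI)
  have le: "eigval CARD('n) (- matrix B) \<le> - \<mu> * \<psi> x"
    using visc_super_upper_jet[where G = "\<lambda>x r l. - l - \<mu> * r", OF super
        degenerate_elliptic_eigval[OF N order_refl] x jet] by simp
  define w where "w = (1 / norm v) *\<^sub>R v"
  have w: "norm w = 1" "v = norm v *\<^sub>R w" using False by (simp_all add: w_def)
  have "(- matrix B *v w) \<bullet> w \<le> - \<mu> * \<psi> x" using eigval_CARD_ge[OF w(1)] le by (rule order_trans)
  hence "\<mu> * \<psi> x \<le> B w \<bullet> w" by (simp add: matrix_vector_mult_minus matrix_of_linear_works[OF B])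
  hence "\<mu> * \<psi> x * (norm v)\<^sup>2 \<le> (B w \<bullet> w) * (norm v)\<^sup>2" by (intro mult_right_mono) auto
  also have "\<dots> = B (norm v *\<^sub>R w) \<bullet> (norm v *\<^sub>R w)"
    by (simp only: linear_scale[OF B] inner_scaleR_left inner_scaleR_right power2_eq_square mult_ac)
  finally show ?thesis using w(2) by simp
qed simp

text \<open>By continuity \<open>\<mu> * \<psi>\<close> stays above \<open>2 * c\<close> on a ball
  around \<open>x0\<close>, so upper jets of \<open>- \<psi> - c |x|^2\<close> have nonnegative form
  there and this function is convex. A subgradient at \<open>x0\<close> gives the
  paraboloid.\<close>

lemma eigenfunction_semiconcave_support:
  fixes \<psi> :: "real^'n \<Rightarrow> real"
  assumes super: "visc_super \<Omega> (\<lambda>x r p M. - eigval CARD('n) M - \<mu> * r) \<psi>"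
    and \<Omega>: "open \<Omega>" and x0: "x0 \<in> \<Omega>" and c: "2 * c < \<mu> * \<psi> x0"
  shows "\<exists>p. \<exists>e>0. \<forall>h. norm h < e \<longrightarrow> \<psi> (x0 + h) \<le> \<psi> x0 + p \<bullet> h - c * (norm h)\<^sup>2"
proof -
  have cont: "continuous_on \<Omega> \<psi>" using super by (simp add: visc_super_def)
  have "isCont (\<lambda>x. \<mu> * \<psi> x) x0"
    using cont \<Omega> x0 by (intro continuous_intros) (simp add: continuous_on_eq_continuous_at)
  hence "((\<lambda>x. \<mu> * \<psi> x) \<longlongrightarrow> \<mu> * \<psi> x0) (at x0)" by (simp add: isCont_def)
  hence "\<forall>\<^sub>F x in at x0. 2 * c < \<mu> * \<psi> x" using c by (rule order_tendstoD(1))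
  then obtain r1 where r1: "0 < r1" "\<forall>x. x \<noteq> x0 \<and> dist x x0 < r1 \<longrightarrow> 2 * c < \<mu> * \<psi> x"
    unfolding eventually_at by auto
  obtain r2 where r2: "0 < r2" "ball x0 r2 \<subseteq> \<Omega>" using \<Omega> x0 by (meson openE)
  define W where "W = ball x0 (min r1 r2)"
  have W: "open W" "convex W" "x0 \<in> W" using r1 r2 by (simp_all add: W_def)
  have W\<Omega>: "W \<subseteq> \<Omega>" using r2(2) by (auto simp: W_def)
  have big: "2 * c \<le> \<mu> * \<psi> x" if "x \<in> W" for x
  proof (cases "x = x0")
    case False
    have "dist x x0 < r1" using that by (simp add: W_def dist_commute)
    thus ?thesis using r1(2) False by (simp add: less_imp_le)
  qed (use c in simp)
  define f where "f x = - \<psi> x - c * (x \<bullet> x)" for x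
  have "convex_on W f"
  proof (rule convex_on_of_upper_jets[OF W(1,2)])
    show "continuous_on W f"
      unfolding f_def by (intro continuous_intros continuous_on_subset[OF cont W\<Omega>])
    fix x a B and v :: "real^'n" assume x: "x \<in> W" and jet: "upper_jet f x a B"
    define B' where "B' h = B h + (2 * c) *\<^sub>R h" for h
    have B: "linear B" using jet by (simp add: upper_jet_def)
    have B': "linear B'" unfolding B'_def by (intro linear_compose_add B linear_scale_self)
    obtain e where e: "0 < e" "\<forall>h. norm h < e \<longrightarrow> f (x + h) \<le> f x + a \<bullet> h + (B h \<bullet> h) / 2"
      using jet unfolding upper_jet_def by (elim conjE exE)
    have "- \<psi> (x + h) \<le> - \<psi> x + (a + (2 * c) *\<^sub>R x) \<bullet> h + (B' h \<bullet> h) / 2" if "norm h < e" for h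
    proof -
      have "- \<psi> (x + h) = f (x + h) + c * ((x + h) \<bullet> (x + h))" by (simp add: f_def)
      also have "(x + h) \<bullet> (x + h) = x \<bullet> x + 2 * (x \<bullet> h) + h \<bullet> h"
        by (simp add: inner_add_left inner_add_right inner_commute)
      also have "f (x + h) + c * (x \<bullet> x + 2 * (x \<bullet> h) + h \<bullet> h)
          \<le> (f x + a \<bullet> h + (B h \<bullet> h) / 2) + c * (x \<bullet> x + 2 * (x \<bullet> h) + h \<bullet> h)"
        using e(2) that by simp
      also have "\<dots> = - \<psi> x + (a + (2 * c) *\<^sub>R x) \<bullet> h + (B' h \<bullet> h) / 2"
        by (simp add: f_def B'_def inner_add_left algebra_simps add_divide_distrib)
      finally show ?thesis .
    qed
    hence "upper_jet (\<lambda>x. - \<psi> x) x (a + (2 * c) *\<^sub>R x) B'"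
      using e(1) B' unfolding upper_jet_def by blast
    hence "\<mu> * \<psi> x * (norm v)\<^sup>2 \<le> B' v \<bullet> v"
      by (rule visc_super_eigval_CARD_upper_jet[OF super subsetD[OF W\<Omega> x]])
    moreover have "2 * c * (norm v)\<^sup>2 \<le> \<mu> * \<psi> x * (norm v)\<^sup>2" using big[OF x] by (intro mult_right_mono) auto
    moreover have "B' v \<bullet> v = B v \<bullet> v + 2 * c * (norm v)\<^sup>2"
      by (simp add: B'_def inner_add_left power2_norm_eq_inner)
    ultimately show "0 \<le> B v \<bullet> v" by linarith
  qed
  then obtain p where p: "\<forall>x\<in>W. f x0 + p \<bullet> (x - x0) \<le> f x"
    using convex_on_open_subgradient[OF W(1) _ W(3)] by blast
  have "\<psi> (x0 + h) \<le> \<psi> x0 + (- p - (2 * c) *\<^sub>R x0) \<bullet> h - c * (norm h)\<^sup>2" if h: "norm h < min r1 r2" for h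
  proof -
    have "x0 + h \<in> W" using h by (simp add: W_def dist_norm)
    from bspec[OF p this] have le: "f x0 + p \<bullet> h \<le> f (x0 + h)" by simp
    have sq: "(x0 + h) \<bullet> (x0 + h) = x0 \<bullet> x0 + 2 * (x0 \<bullet> h) + (norm h)\<^sup>2"
      by (simp add: inner_add_left inner_add_right inner_commute power2_norm_eq_inner)
    have "c * ((x0 + h) \<bullet> (x0 + h)) = c * (x0 \<bullet> x0) + 2 * c * (x0 \<bullet> h) + c * (norm h)\<^sup>2"
      unfolding sq by (simp add: algebra_simps)
    thus ?thesis using le by (simp add: f_def inner_diff_left)
  qed
  moreover have "0 < min r1 r2" using r1 r2 by simp
  ultimately show ?thesis by blast
qed

lemma eigenfunction_concave:
  fixes \<psi> :: "real^'n \<Rightarrow> real"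
  assumes super: "visc_super \<Omega> (\<lambda>x r p M. - eigval CARD('n) M - \<mu> * r) \<psi>"
    and \<Omega>: "open \<Omega>" "convex \<Omega>" and \<mu>: "0 \<le> \<mu>" and pos: "\<forall>x\<in>\<Omega>. 0 < \<psi> x"
  shows "convex_on \<Omega> (\<lambda>x. - \<psi> x)"
proof (rule convex_on_of_upper_jets[OF \<Omega>])
  show "continuous_on \<Omega> (\<lambda>x. - \<psi> x)"
    using super by (intro continuous_on_minus) (simp add: visc_super_def)
  fix x a B and v :: "real^'n" assume x: "x \<in> \<Omega>" and jet: "upper_jet (\<lambda>x. - \<psi> x) x a B"
  have "0 \<le> \<mu> * \<psi> x * (norm v)\<^sup>2" using \<mu> bspec[OF pos x] by simp
  also have "\<dots> \<le> B v \<bullet> v" by (rule visc_super_eigval_CARD_upper_jet[OF super x jet])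
  finally show "0 \<le> B v \<bullet> v" .
qed

text \<open>At \<open>x = x0\<close> the jet gives a local minimum of a differentiable function of
  \<open>t\<close>, so \<open>\<alpha>\<close> is determined exactly. At \<open>t = t0\<close> the
  paraboloid replaces \<open>\<psi>\<close> and turns the jet into one for \<open>- z\<close>, whose
  quadratic form is that of the spatial block minus \<open>2 * b t0 * c\<close> times the squared
  norm.\<close>

lemma separated_sum_upper_jet:
  fixes z \<psi> :: "real^'n \<Rightarrow> real" and b d :: "real \<Rightarrow> real"
  assumes \<Lambda>: "degenerate_elliptic \<Lambda>"
    and z: "\<And>a B. upper_jet (\<lambda>x. - z x) x0 a B \<Longrightarrow> \<Lambda> (- matrix B) \<le> 0"
    and \<psi>: "\<And>c. 2 * c < m \<Longrightarrow> \<exists>p. \<exists>e>0. \<forall>h. norm h < e \<longrightarrow> \<psi> (x0 + h) \<le> \<psi> x0 + p \<bullet> h - c * (norm h)\<^sup>2"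
    and b: "0 < b t0" and b': "(b has_real_derivative b') (at t0)" and d': "(d has_real_derivative d') (at t0)"
    and jet: "upper_jet (\<lambda>(x, t). - (z x + b t * \<psi> x + d t)) (x0, t0) (a, \<alpha>) B"
  shows "\<alpha> = - (b' * \<psi> x0 + d')" and "\<Lambda> (- matrix (\<lambda>k. fst (B (k, 0)))) \<le> - b t0 * m"
proof -
  have B: "linear B" using jet by (simp add: upper_jet_def)
  obtain e where e: "0 < e" and "\<forall>h. norm h < e \<longrightarrow> (case (x0, t0) + h of (x, t) \<Rightarrow> - (z x + b t * \<psi> x + d t))
      \<le> (case (x0, t0) of (x, t) \<Rightarrow> - (z x + b t * \<psi> x + d t)) + (a, \<alpha>) \<bullet> h + (B h \<bullet> h) / 2"
    using jet unfolding upper_jet_def by (elim conjE exE)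
  hence le: "- (z (x0 + k) + b (t0 + s) * \<psi> (x0 + k) + d (t0 + s))
      \<le> - (z x0 + b t0 * \<psi> x0 + d t0) + (a \<bullet> k + \<alpha> * s) + (B (k, s) \<bullet> (k, s)) / 2"
    if "norm (k, s) < e" for k s
    using that by (auto dest: spec[of _ "(k, s)"])
  show "\<alpha> = - (b' * \<psi> x0 + d')"
  proof -
    define K where "K = (B (0, 1) \<bullet> (0, 1)) / 2"
    define \<phi> where "\<phi> s = b s * \<psi> x0 + d s + \<alpha> * (s - t0) + K * (s - t0)\<^sup>2" for s
    have "(\<phi> has_real_derivative (b' * \<psi> x0 + d' + \<alpha>)) (at t0)"
      unfolding \<phi>_def by (auto intro!: derivative_eq_intros b' d')
    moreover have "\<forall>y. \<bar>t0 - y\<bar> < e \<longrightarrow> \<phi> t0 \<le> \<phi> y"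
    proof (intro allI impI)
      fix y assume y: "\<bar>t0 - y\<bar> < e"
      define s where "s = y - t0"
      have "norm (0 :: real^'n, s) < e" using y by (simp add: s_def norm_Pair)
      from le[OF this] have "b t0 * \<psi> x0 + d t0 \<le> b (t0 + s) * \<psi> x0 + d (t0 + s) + \<alpha> * s + (B (0, s) \<bullet> (0, s)) / 2"
        by simp
      moreover have "B (0, s) = s *\<^sub>R B (0, 1)" using linear_scale[OF B, of s "(0, 1)"] by simp
      hence "(B (0, s) \<bullet> (0, s)) / 2 = K * s\<^sup>2"
        by (simp add: K_def inner_prod_def power2_eq_square)
      ultimately show "\<phi> t0 \<le> \<phi> y" by (simp add: \<phi>_def s_def)
    qed
    ultimately have "b' * \<psi> x0 + d' + \<alpha> = 0" using e by (intro DERIV_local_min[of \<phi> _ t0 e]) auto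
    thus ?thesis by simp
  qed
  define Bx where "Bx k = fst (B (k, 0))" for k
  have Bx: "linear Bx" unfolding Bx_def[abs_def] by (rule linear_slice[OF B])
  have bound: "\<Lambda> (- matrix Bx) \<le> - (2 * b t0 * c)" if c: "2 * c < m" for c
  proof -
    from \<psi>[OF c] obtain p e' where e': "0 < e'"
      and p: "\<forall>h. norm h < e' \<longrightarrow> \<psi> (x0 + h) \<le> \<psi> x0 + p \<bullet> h - c * (norm h)\<^sup>2" by (elim exE conjE)
    define B' where "B' k = Bx k - (2 * b t0 * c) *\<^sub>R k" for k
    have B': "linear B'" unfolding B'_def by (intro linear_compose_sub Bx linear_scale_self)
    have "- z (x0 + k) \<le> - z x0 + (a + b t0 *\<^sub>R p) \<bullet> k + (B' k \<bullet> k) / 2" if k: "norm k < min e e'" for k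
    proof -
      have "norm (k, 0 :: real) < e" using k by (simp add: norm_Pair)
      from le[OF this] have 1: "- (z (x0 + k) + b t0 * \<psi> (x0 + k)) \<le> - (z x0 + b t0 * \<psi> x0) + a \<bullet> k + (Bx k \<bullet> k) / 2"
        by (simp add: Bx_def inner_prod_def)
      have "b t0 * \<psi> (x0 + k) \<le> b t0 * (\<psi> x0 + p \<bullet> k - c * (norm k)\<^sup>2)"
        using p k b by (intro mult_left_mono) auto
      hence 2: "b t0 * \<psi> (x0 + k) \<le> b t0 * \<psi> x0 + b t0 * (p \<bullet> k) - b t0 * c * (norm k)\<^sup>2"
        by (simp add: algebra_simps)
      have 3: "(B' k \<bullet> k) / 2 = (Bx k \<bullet> k) / 2 - b t0 * c * (norm k)\<^sup>2"
        by (simp add: B'_def inner_diff_left power2_norm_eq_inner)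
      have 4: "(a + b t0 *\<^sub>R p) \<bullet> k = a \<bullet> k + b t0 * (p \<bullet> k)" by (simp add: inner_add_left)
      show ?thesis using 1 2 unfolding 3 4 by linarith
    qed
    moreover have "0 < min e e'" using e e' by simp
    ultimately have "upper_jet (\<lambda>x. - z x) x0 (a + b t0 *\<^sub>R p) B'" using B' unfolding upper_jet_def by blast
    hence "\<Lambda> (- matrix B') \<le> 0" by (rule z)
    moreover have "\<Lambda> (- matrix Bx) \<le> \<Lambda> (- matrix B') + (- (2 * b t0 * c))"
      by (rule degenerate_ellipticD[OF \<Lambda>])
        (simp add: matrix_vector_mult_minus matrix_of_linear_works[OF Bx] matrix_of_linear_works[OF B']
          B'_def inner_diff_left power2_norm_eq_inner)
    ultimately show ?thesis by linarith
  qed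
  \<comment> \<open>Paraboloids exist only for \<open>2 * c < m\<close>, so the bound with
    \<open>m\<close> itself is reached as a limit.\<close>
  have "\<Lambda> (- matrix Bx) \<le> - b t0 * m"
  proof (rule field_le_epsilon)
    fix \<epsilon> :: real assume \<epsilon>: "0 < \<epsilon>"
    define c where "c = (m - \<epsilon> / b t0) / 2"
    have "2 * c < m" using \<epsilon> b by (simp add: c_def)
    from bound[OF this] have "\<Lambda> (- matrix Bx) \<le> - (b t0 * (2 * c))" by (simp add: mult_ac)
    also have "b t0 * (2 * c) = b t0 * m - \<epsilon>" using b by (simp add: c_def right_diff_distrib)
    finally show "\<Lambda> (- matrix Bx) \<le> - b t0 * m + \<epsilon>" by simp
  qed
  thus "\<Lambda> (- matrix (\<lambda>k. fst (B (k, 0)))) \<le> - b t0 * m" by (simp only: Bx_def[abs_def])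
qed

section \<open>Comparison\<close>

text \<open>The cylinder extends to \<open>T + 1\<close>, so that time \<open>T\<close> is interior.
  The equations for \<open>u\<close> and \<open>z\<close> enter only through semijets, which lets
  the same statement be applied to \<open>- u\<close>, \<open>- z\<close> and the reflected
  operator.\<close>

lemma parabolic_upper_bound:
  fixes z \<psi> :: "real^'n \<Rightarrow> real" and u :: "real^'n \<Rightarrow> real \<Rightarrow> real"
  assumes \<Omega>: "open \<Omega>" "bounded \<Omega>" and \<Lambda>: "degenerate_elliptic \<Lambda>"
    and cz: "continuous_on (closure \<Omega>) z" and c\<psi>: "continuous_on (closure \<Omega>) \<psi>"
    and cu: "continuous_on (closure \<Omega> \<times> {0..}) (\<lambda>(x, t). u x t)"
    and z: "\<And>x a B. x \<in> \<Omega> \<Longrightarrow> upper_jet (\<lambda>x. - z x) x a B \<Longrightarrow> \<Lambda> (- matrix B) \<le> 0"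
    and u: "\<And>x t a \<alpha> B. x \<in> \<Omega> \<Longrightarrow> 0 < t \<Longrightarrow> upper_jet (\<lambda>(x, t). u x t) (x, t) (a, \<alpha>) B
        \<Longrightarrow> \<alpha> \<le> \<Lambda> (matrix (\<lambda>k. fst (B (k, 0))))"
    and \<psi>: "\<And>x c. x \<in> \<Omega> \<Longrightarrow> 2 * c < \<mu> * \<psi> x
        \<Longrightarrow> \<exists>p. \<exists>e>0. \<forall>h. norm h < e \<longrightarrow> \<psi> (x + h) \<le> \<psi> x + p \<bullet> h - c * (norm h)\<^sup>2"
    and \<psi>0: "\<And>x. x \<in> closure \<Omega> \<Longrightarrow> 0 \<le> \<psi> x"
    and lateral: "\<And>x t. x \<in> frontier \<Omega> \<Longrightarrow> 0 < t \<Longrightarrow> u x t \<le> z x"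
    and initial: "\<And>x. x \<in> closure \<Omega> \<Longrightarrow> u x 0 \<le> z x + C * \<psi> x"
    and C: "0 < C" and x0: "x0 \<in> \<Omega>" and T: "0 < T"
  shows "u x0 T \<le> z x0 + C * exp (- \<mu> * T) * \<psi> x0"
proof (rule field_le_epsilon)
  fix \<gamma> :: real assume \<gamma>: "0 < \<gamma>"
  define Q where "Q = closure \<Omega> \<times> {0..T + 1}"
  have "compact Q" unfolding Q_def using \<Omega>(2) by (intro compact_Times) auto
  have cuQ: "continuous_on Q (\<lambda>(x, t). u x t)"
    by (rule continuous_on_subset[OF cu]) (auto simp: Q_def)
  obtain Mu where Mu: "\<forall>X\<in>Q. \<bar>case X of (x, t) \<Rightarrow> u x t\<bar> \<le> Mu"
    using continuous_on_compact_abs_bound[OF \<open>compact Q\<close> cuQ] by (rule exE)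
  have "compact (closure \<Omega>)" using \<Omega>(2) by simp
  obtain Mz where Mz: "\<forall>x\<in>closure \<Omega>. \<bar>z x\<bar> \<le> Mz"
    using continuous_on_compact_abs_bound[OF \<open>compact (closure \<Omega>)\<close> cz] by (rule exE)
  have x0c: "x0 \<in> closure \<Omega>" using x0 closure_subset by blast
  have Mz0: "0 \<le> Mz" using bspec[OF Mz x0c] by linarith
  have "(x0, 0) \<in> Q" using x0c T by (simp add: Q_def)
  from bspec[OF Mu this] have Mu0: "0 \<le> Mu" by simp
  \<comment> \<open>Makes \<open>\<gamma> * K\<close> exceed \<open>Mu + Mz\<close>; as
    \<open>exp K\<close> is larger than \<open>K\<close>, the perturbation at time
    \<open>T + 1\<close> then dominates \<open>u - z\<close>.\<close>
  define K where "K = (Mu + Mz) / \<gamma> + 1"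
  have K: "0 < K" using Mu0 Mz0 \<gamma> by (simp add: K_def add_nonneg_pos)
  have "\<gamma> * ((Mu + Mz) / \<gamma>) = Mu + Mz" using \<gamma> by (simp del: distrib_left)
  hence \<gamma>K: "\<gamma> * K = Mu + Mz + \<gamma>" by (simp only: K_def distrib_left mult_1_right)
  define b where "b t = C * exp (- \<mu> * t)" for t
  \<comment> \<open>A strictly increasing perturbation of size \<open>\<gamma>\<close> at time \<open>T\<close>, large enough at \<open>T + 1\<close> to keep the
    maximum away from the final time.\<close>
  define d where "d t = \<gamma> * exp (K * (t - T))" for t
  have b0: "0 < b t" for t using C by (simp add: b_def)
  have b': "(b has_real_derivative - \<mu> * b t) (at t)" for t
    unfolding b_def by (auto intro!: derivative_eq_intros)
  have d': "(d has_real_derivative K * d t) (at t)" for t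
    unfolding d_def by (auto intro!: derivative_eq_intros)
  have d0: "0 < d t" for t using \<gamma> by (simp add: d_def)
  have d_top: "Mu + Mz \<le> d (T + 1)"
  proof -
    have "K \<le> exp K" using exp_ge_add_one_self[of K] by linarith
    hence "\<gamma> * K \<le> \<gamma> * exp K" using \<gamma> by simp
    thus ?thesis using \<gamma>K \<gamma> by (simp add: d_def)
  qed
  \<comment> \<open>A lower bound for the time derivative of \<open>d\<close>: the strict gain, of
    which the approximate jets may consume only two thirds.\<close>
  define \<kappa> where "\<kappa> = K * d 0"
  have \<kappa>: "0 < \<kappa>" using K d0 by (simp add: \<kappa>_def)
  have d_mono: "\<kappa> \<le> K * d t" if "0 < t" for t
  proof -
    have "K * (0 - T) \<le> K * (t - T)" using K that by (intro mult_left_mono) auto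
    hence "exp (K * (0 - T)) \<le> exp (K * (t - T))" by (simp only: exp_le_cancel_iff)
    thus ?thesis unfolding \<kappa>_def d_def using K \<gamma> by (intro mult_left_mono) auto
  qed
  define V where "V = (\<lambda>(x, t). - (z x + b t * \<psi> x + d t))"
  define U where "U = \<Omega> \<times> {0<..<T + 1}"
  have Uc: "closure U = Q" using T by (simp add: U_def Q_def closure_Times)
  have cV: "continuous_on Q V"
  proof -
    have "continuous_on Q (\<lambda>X. z (fst X))"
      by (rule continuous_on_compose2[OF cz continuous_on_fst[OF continuous_on_id]]) (auto simp: Q_def)
    moreover have "continuous_on Q (\<lambda>X. \<psi> (fst X))"
      by (rule continuous_on_compose2[OF c\<psi> continuous_on_fst[OF continuous_on_id]]) (auto simp: Q_def)
    ultimately show ?thesis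
      unfolding V_def case_prod_unfold b_def d_def by (intro continuous_intros)
  qed
  show "u x0 T \<le> z x0 + C * exp (- \<mu> * T) * \<psi> x0 + \<gamma>"
  proof (rule ccontr)
    assume "\<not> u x0 T \<le> z x0 + C * exp (- \<mu> * T) * \<psi> x0 + \<gamma>"
    hence gt: "0 < (case (x0, T) of (x, t) \<Rightarrow> u x t) + V (x0, T)" by (simp add: V_def b_def d_def)
    have U: "open U" "bounded U" unfolding U_def using \<Omega> by (auto intro: open_Times bounded_Times)
    have xU: "(x0, T) \<in> U" using x0 T by (simp add: U_def)
    have fr: "(case X of (x, t) \<Rightarrow> u x t) + V X \<le> 0" if "X \<in> frontier U" for X
    proof -
      obtain y s where X: "X = (y, s)" by (cases X)
      have "X \<in> Q" "X \<notin> U" using that U(1) Uc by (auto simp: frontier_def interior_open)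
      hence y: "y \<in> closure \<Omega>" and s: "0 \<le> s" "s \<le> T + 1" and not: "\<not> (y \<in> \<Omega> \<and> 0 < s \<and> s < T + 1)"
        by (auto simp: X Q_def U_def)
      have b\<psi>: "0 \<le> b s * \<psi> y" using b0[of s] \<psi>0[OF y] by simp
      have "y \<in> frontier \<Omega>" if "0 < s" "s < T + 1"
        using not that y \<Omega>(1) by (simp add: frontier_def interior_open)
      hence "s = 0 \<or> s = T + 1 \<or> (0 < s \<and> y \<in> frontier \<Omega>)" using s by linarith
      then consider "s = 0" | "s = T + 1" | "0 < s" "y \<in> frontier \<Omega>" by (elim disjE conjE)
      thus ?thesis
      proof cases
        case 1
        thus ?thesis using initial[OF y] d0[of 0] by (simp add: X V_def b_def)
      next
        case 2
        have "u y s \<le> Mu" using bspec[OF Mu \<open>X \<in> Q\<close>] by (simp add: X)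
        moreover have "- z y \<le> Mz" using bspec[OF Mz y] by simp
        ultimately show ?thesis using d_top b\<psi> 2 by (simp add: X V_def)
      next
        case 3
        thus ?thesis using lateral[OF 3(2,1)] b\<psi> d0[of s] by (simp add: X V_def)
      qed
    qed
    have \<delta>: "0 < \<kappa> / 3" using \<kappa> by simp
    obtain Y Z A A' B B' where YZ: "Y \<in> U" "Z \<in> U"
      and jY: "upper_jet (\<lambda>(x, t). u x t) Y A B" and jZ: "upper_jet V Z A' B'"
      and AA: "norm (A + A') \<le> \<kappa> / 3" and BB: "\<forall>h. (B h + B' h) \<bullet> h \<le> \<kappa> / 3 * (norm h)\<^sup>2"
      by (rule semijets_at_interior_maximum[OF U cuQ[folded Uc] cV[folded Uc] fr xU gt \<delta>])
    obtain x t where Y: "Y = (x, t)" by (cases Y)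
    obtain x' t' where Z: "Z = (x', t')" by (cases Z)
    obtain a \<alpha> where A: "A = (a, \<alpha>)" by (cases A)
    obtain a' \<alpha>' where A': "A' = (a', \<alpha>')" by (cases A')
    have t: "x \<in> \<Omega>" "0 < t" "x' \<in> \<Omega>" "0 < t'" using YZ by (auto simp: Y Z U_def)
    have sub: "\<alpha> \<le> \<Lambda> (matrix (\<lambda>k. fst (B (k, 0))))"
      by (rule u[OF t(1,2)]) (use jY in \<open>simp add: Y A\<close>)
    have jZ': "upper_jet (\<lambda>(x, t). - (z x + b t * \<psi> x + d t)) (x', t') (a', \<alpha>') B'"
      using jZ by (simp add: Z A' V_def)
    have "\<alpha>' = - (- \<mu> * b t' * \<psi> x' + K * d t')"
      by (rule separated_sum_upper_jet(1)[OF \<Lambda> z[OF t(3)] \<psi>[OF t(3)] b0 b' d' jZ'])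
    hence time: "\<alpha>' = b t' * (\<mu> * \<psi> x') - K * d t'" by simp
    have space: "\<Lambda> (- matrix (\<lambda>k. fst (B' (k, 0)))) \<le> - b t' * (\<mu> * \<psi> x')"
      by (rule separated_sum_upper_jet(2)[OF \<Lambda> z[OF t(3)] \<psi>[OF t(3)] b0 b' d' jZ'])
    have B: "linear B" "linear B'" using jY jZ by (simp_all add: upper_jet_def)
    have "\<Lambda> (matrix (\<lambda>k. fst (B (k, 0)))) \<le> \<Lambda> (- matrix (\<lambda>k. fst (B' (k, 0)))) + \<kappa> / 3"
    proof (rule degenerate_ellipticD[OF \<Lambda>])
      fix h :: "real^'n"
      have "fst (D (h, 0)) \<bullet> h = D (h, 0) \<bullet> (h, 0)" for D :: "(real^'n) \<times> real \<Rightarrow> (real^'n) \<times> real"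
        by (simp add: inner_prod_def)
      moreover have "B (h, 0) \<bullet> (h, 0) + B' (h, 0) \<bullet> (h, 0) \<le> \<kappa> / 3 * (norm h)\<^sup>2"
        using spec[OF BB, of "(h, 0)"] by (simp only: inner_add_left norm_Pair) simp
      ultimately show "(matrix (\<lambda>k. fst (B (k, 0))) *v h) \<bullet> h
          \<le> (- matrix (\<lambda>k. fst (B' (k, 0))) *v h) \<bullet> h + \<kappa> / 3 * (norm h)\<^sup>2"
        by (simp add: matrix_vector_mult_minus matrix_of_linear_works[OF linear_slice[OF B(1)]]
            matrix_of_linear_works[OF linear_slice[OF B(2)]])
    qed
    moreover have "\<bar>\<alpha> + \<alpha>'\<bar> \<le> \<kappa> / 3"
      using norm_snd_le_norm[of "A + A'"] AA by (simp add: A A')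
    \<comment> \<open>Both relations for the barrier hold at the same point \<open>Z\<close>, so the
      terms \<open>b t' * (\<mu> * \<psi> x')\<close> cancel exactly. The derivative of
      \<open>d\<close> is left against two errors \<open>\<kappa> / 3\<close>, one in time and one
      in space.\<close>
    ultimately have "K * d t' \<le> 2 * (\<kappa> / 3)" using sub time space by linarith
    thus False using d_mono[OF t(4)] \<kappa> by linarith
  qed
qed

section \<open>Reflection in time-dependent form, and ordering of the initial data\<close>

lemma pvisc_super_imp_sub_reflect:
  assumes "pvisc_super \<Omega> (\<lambda>x t r pt p M. pt - \<Lambda> M) u"
  shows "pvisc_sub \<Omega> (\<lambda>x t r pt p M. pt - (- \<Lambda> (- M))) (\<lambda>x t. - u x t)"
  unfolding pvisc_sub_def
proof (intro conjI ballI allI impI)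
  show "continuous_on (\<Omega> \<times> {0<..}) (\<lambda>(x, t). - u x t)"
    using assms unfolding pvisc_super_def case_prod_unfold by (intro continuous_on_minus) simp
  fix x0 and t0 :: real and U p Dp Hp Tp
  assume x0: "x0 \<in> \<Omega>" "0 < t0" and *: "C21_test U p Dp Hp Tp \<and> (x0, t0) \<in> U \<and>
    (\<exists>e>0. \<forall>y s. dist y x0 < e \<and> \<bar>s - t0\<bar> < e \<longrightarrow> - u y s - p y s \<le> - u x0 t0 - p x0 t0)"
  have test: "C21_test U (\<lambda>x t. - p x t) (\<lambda>x t. - Dp x t) (\<lambda>x t. - Hp x t) (\<lambda>x t. - Tp x t)"
    unfolding C21_test_def case_prod_unfold
  proof (intro conjI ballI)
    fix X assume X: "X \<in> U"
    have "((\<lambda>y. p y (snd X)) has_derivative (\<lambda>h. Dp (fst X) (snd X) \<bullet> h)) (at (fst X))"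
      and "((\<lambda>y. Dp y (snd X)) has_derivative (\<lambda>h. Hp (fst X) (snd X) *v h)) (at (fst X))"
      and "((\<lambda>s. p (fst X) s) has_real_derivative Tp (fst X) (snd X)) (at (snd X))"
      using * X unfolding C21_test_def case_prod_unfold by simp_all
    from this(1,2)[THEN has_derivative_minus] DERIV_minus[OF this(3)]
    show "((\<lambda>y. - p y (snd X)) has_derivative (\<lambda>h. (- Dp (fst X) (snd X)) \<bullet> h)) (at (fst X))"
      "((\<lambda>y. - Dp y (snd X)) has_derivative (\<lambda>h. (- Hp (fst X) (snd X)) *v h)) (at (fst X))"
      "((\<lambda>s. - p (fst X) s) has_real_derivative - Tp (fst X) (snd X)) (at (snd X))"
      by (simp_all add: matrix_vector_mult_minus)
  qed (use * in \<open>auto simp: C21_test_def case_prod_unfold intro: continuous_on_minus\<close>)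
  have "\<exists>e>0. \<forall>y s. dist y x0 < e \<and> \<bar>s - t0\<bar> < e \<longrightarrow> u x0 t0 - (- p x0 t0) \<le> u y s - (- p y s)"
  proof -
    from * obtain e where e: "0 < e"
      "\<forall>y s. dist y x0 < e \<and> \<bar>s - t0\<bar> < e \<longrightarrow> - u y s - p y s \<le> - u x0 t0 - p x0 t0" by (elim conjE exE)
    have "u x0 t0 - (- p x0 t0) \<le> u y s - (- p y s)" if "dist y x0 < e \<and> \<bar>s - t0\<bar> < e" for y s
      using e(2)[THEN spec, THEN spec, THEN mp, OF that] by linarith
    with e(1) show ?thesis by blast
  qed
  with test * x0 assms have "0 \<le> - Tp x0 t0 - \<Lambda> (- Hp x0 t0)"
    unfolding pvisc_super_def by blast
  thus "Tp x0 t0 - - \<Lambda> (- Hp x0 t0) \<le> 0" by simp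
qed

lemma strictly_convex_set_imp_convex:
  assumes "strictly_convex_set \<Omega>"
  shows "convex \<Omega>"
  unfolding convex_alt
proof (intro ballI allI impI)
  fix x y and t :: real assume xy: "x \<in> \<Omega>" "y \<in> \<Omega>" and t: "0 \<le> t \<and> t \<le> 1"
  consider "x = y \<or> t = 0 \<or> t = 1" | "x \<noteq> y" "0 < t" "t < 1" using t by linarith
  thus "(1 - t) *\<^sub>R x + t *\<^sub>R y \<in> \<Omega>"
  proof cases
    case 1 thus ?thesis using xy by (auto simp flip: scaleR_add_left)
  next
    case 2
    have "x \<in> closure \<Omega>" "y \<in> closure \<Omega>" using xy closure_subset by blast+
    with 2 assms show ?thesis unfolding strictly_convex_set_def by blast
  qed
qed

text \<open>The gradient extends continuously to the compact closure and is therefore bounded;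
  convexity allows the mean value inequality, and continuity carries the estimate to the
  closure.\<close>

lemma C1_closure_lipschitz:
  assumes C1: "C1_closure \<Omega> f" and \<Omega>: "convex \<Omega>" "bounded \<Omega>"
  obtains L where "L-lipschitz_on (closure \<Omega>) f"
proof -
  obtain Df where cont: "continuous_on (closure \<Omega>) f" and cD: "continuous_on (closure \<Omega>) Df"
    and der: "\<forall>x\<in>\<Omega>. (f has_derivative (\<lambda>h. Df x \<bullet> h)) (at x)"
    using C1 unfolding C1_closure_def by (elim conjE exE)
  have "compact (closure \<Omega>)" using \<Omega>(2) by simp
  from continuous_on_compact_abs_bound[OF this continuous_on_norm[OF cD]]
  obtain M where M: "\<forall>x\<in>closure \<Omega>. \<bar>norm (Df x)\<bar> \<le> M" by (rule exE)
  have bound: "norm (f x - f y) \<le> max M 0 * norm (x - y)" if "x \<in> \<Omega>" "y \<in> \<Omega>" for x y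
  proof (rule differentiable_bound[OF \<Omega>(1) _ _ that])
    fix w assume w: "w \<in> \<Omega>"
    show "(f has_derivative (\<lambda>h. Df w \<bullet> h)) (at w within \<Omega>)"
      using bspec[OF der w] by (rule has_derivative_at_withinI)
    have "norm (Df w) \<le> M" using M w closure_subset by fastforce
    have "\<bar>Df w \<bullet> h\<bar> \<le> max M 0 * norm h" for h
    proof -
      have "\<bar>Df w \<bullet> h\<bar> \<le> norm (Df w) * norm h" by (rule Cauchy_Schwarz_ineq2)
      also have "\<dots> \<le> max M 0 * norm h" using \<open>norm (Df w) \<le> M\<close> by (intro mult_right_mono) auto
      finally show ?thesis .
    qed
    thus "onorm (\<lambda>h. Df w \<bullet> h) \<le> max M 0" by (intro onorm_bound) auto
  qed
  have "(max M 0)-lipschitz_on \<Omega> f"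
    using bound by (intro lipschitz_onI) (auto simp: dist_norm)
  thus thesis using cont by (intro that lipschitz_on_closure)
qed

text \<open>On the ray from \<open>x0\<close> through \<open>x\<close>, the Lipschitz bound makes
  \<open>f\<close> at most linear in the distance to the exit point, and concavity makes
  \<open>\<psi>\<close> at least linear in it.\<close>

lemma lipschitz_bounded_by_concave:
  fixes \<psi> f :: "'a::euclidean_space \<Rightarrow> real"
  assumes \<Omega>: "open \<Omega>" "convex \<Omega>" "bounded \<Omega>" "\<Omega> \<noteq> {}"
    and conc: "convex_on \<Omega> (\<lambda>x. - \<psi> x)" and pos: "\<forall>x\<in>\<Omega>. 0 < \<psi> x"
    and lip: "L-lipschitz_on (closure \<Omega>) f" and f0: "\<forall>x\<in>frontier \<Omega>. f x = 0"
  obtains C where "0 < C" "\<forall>x\<in>\<Omega>. \<bar>f x\<bar> \<le> C * \<psi> x"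
proof -
  obtain x0 where x0: "x0 \<in> \<Omega>" using \<Omega>(4) by blast
  have L: "0 \<le> L" using lip by (rule lipschitz_on_nonneg)
  define m where "m = \<psi> x0"
  have m: "0 < m" using bspec[OF pos x0] by (simp add: m_def)
  have "bounded (closure \<Omega>)" using \<Omega>(3) by (rule bounded_closure)
  then obtain R0 where R0: "\<forall>x\<in>closure \<Omega>. norm x \<le> R0" unfolding bounded_iff by (rule exE)
  define R where "R = max R0 0"
  have R: "norm x \<le> R" if "x \<in> closure \<Omega>" for x using bspec[OF R0 that] by (simp add: R_def)
  \<comment> \<open>The first term serves \<open>x \<noteq> x0\<close>, the second
    \<open>x = x0\<close>, where no ray is defined.\<close>
  define C where "C = 4 * L * R / m + \<bar>f x0\<bar> / m + 1"
  have C: "0 < C" using L m by (simp add: C_def R_def add_nonneg_pos)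
  have "\<bar>f x\<bar> \<le> C * \<psi> x" if x: "x \<in> \<Omega>" for x
  proof (cases "x = x0")
    case True
    have "0 \<le> 4 * L * R / m" using L m by (simp add: R_def)
    hence "\<bar>f x0\<bar> / m \<le> C" unfolding C_def by linarith
    thus ?thesis using m True by (simp add: m_def field_simps)
  next
    case False
    define l where "l = x - x0"
    have l: "l \<noteq> 0" using False by (simp add: l_def)
    have x0i: "x0 \<in> interior \<Omega>" using x0 \<Omega>(1) by (simp add: interior_open)
    obtain d where d: "0 < d" "x0 + d *\<^sub>R l \<in> frontier \<Omega>" "\<And>e. 0 \<le> e \<Longrightarrow> e < d \<Longrightarrow> x0 + e *\<^sub>R l \<in> interior \<Omega>"
      using ray_to_frontier[OF \<Omega>(3) x0i l] by blast
    have notin: "x0 + d *\<^sub>R l \<notin> \<Omega>" using d(2) \<Omega>(1) by (simp add: frontier_def interior_open)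
    have d1: "1 < d"
    proof (rule ccontr)
      assume "\<not> 1 < d"
      hence "(1 - d) *\<^sub>R x0 + d *\<^sub>R x \<in> \<Omega>" using d(1) by (intro convexD_alt[OF \<Omega>(2) x0 x]) auto
      moreover have "(1 - d) *\<^sub>R x0 + d *\<^sub>R x = x0 + d *\<^sub>R l" by (simp add: l_def algebra_simps)
      ultimately show False using notin by simp
    qed
    define y where "y = x0 + d *\<^sub>R l"
    have yc: "y \<in> closure \<Omega>" using d(2) by (simp add: y_def frontier_def)
    have xc: "x \<in> closure \<Omega>" "x0 \<in> closure \<Omega>" using x x0 closure_subset by blast+
    \<comment> \<open>Concavity is known in \<open>\<Omega>\<close> only, so it is used up to a
      point \<open>w\<close> halfway between \<open>x\<close> and the exit point;
      \<open>d - 1 = 2 * (s - 1)\<close> accounts for a factor two.\<close>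
    define s where "s = (1 + d) / 2"
    have s: "1 < s" "s < d" using d1 by (simp_all add: s_def)
    define w where "w = x0 + s *\<^sub>R l"
    have w: "w \<in> \<Omega>" using d(3)[of s] s \<Omega>(1) by (simp add: w_def interior_open)
    have "- \<psi> ((1 - 1 / s) *\<^sub>R x0 + (1 / s) *\<^sub>R w) \<le> (1 - 1 / s) * (- \<psi> x0) + (1 / s) * (- \<psi> w)"
      using s by (intro convex_onD[OF conc _ _ x0 w]) auto
    moreover have "(1 - 1 / s) *\<^sub>R x0 + (1 / s) *\<^sub>R w = x"
      using s by (simp add: w_def l_def algebra_simps)
    moreover have "0 \<le> (1 / s) * \<psi> w" using bspec[OF pos w] s by simp
    ultimately have "(1 - 1 / s) * m \<le> \<psi> x" by (simp add: m_def)
    hence "s * ((1 - 1 / s) * m) \<le> s * \<psi> x" using s by (intro mult_left_mono) auto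
    hence sm: "(s - 1) * m \<le> s * \<psi> x" using s by (simp add: algebra_simps)
    have "\<bar>f x\<bar> = dist (f x) (f y)" using f0 d(2) by (simp add: y_def)
    also have "\<dots> \<le> L * dist x y" by (rule lipschitz_onD[OF lip xc(1) yc])
    also have "dist x y = (d - 1) * norm l"
    proof -
      have "x - y = (1 - d) *\<^sub>R l" by (simp add: y_def l_def algebra_simps)
      thus ?thesis using d1 by (simp add: dist_norm)
    qed
    finally have "\<bar>f x\<bar> * m \<le> (L * ((d - 1) * norm l)) * m" using m by (intro mult_right_mono) auto
    also have "\<dots> = (2 * L * norm l) * ((s - 1) * m)" by (simp add: s_def field_simps)
    also have "\<dots> \<le> (2 * L * norm l) * (s * \<psi> x)" using sm L by (intro mult_left_mono) auto
    also have "\<dots> = 2 * L * (s * norm l) * \<psi> x" by simp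
    also have "\<dots> \<le> 2 * L * (2 * R) * \<psi> x"
    proof -
      have "s * norm l = norm (w - x0)" using s by (simp add: w_def)
      also have "\<dots> \<le> 2 * R"
        using norm_triangle_ineq4[of w x0] R[OF subsetD[OF closure_subset w]] R[OF xc(2)] by linarith
      finally show ?thesis using L bspec[OF pos x] by (intro mult_right_mono mult_left_mono) auto
    qed
    finally have "\<bar>f x\<bar> \<le> (4 * L * R / m) * \<psi> x" using m by (simp add: field_simps)
    also have "\<dots> \<le> C * \<psi> x" using bspec[OF pos x] m by (intro mult_right_mono) (auto simp: C_def)
    finally show ?thesis .
  qed
  thus thesis using C that by blast
qed

theorem theorem3p4:
  fixes \<Omega> :: "(real^'n) set"
    and j :: nat
    and g z u0 \<psi>1 :: "real^'n \<Rightarrow> real"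
    and u :: "real^'n \<Rightarrow> real \<Rightarrow> real"
    and \<mu>1 :: real
  assumes dom: "domain \<Omega>" and bdd: "bounded \<Omega>"
    and sconv: "strictly_convex_set \<Omega>"
    and iball: "interior_ball_condition \<Omega>"
    and j: "1 \<le> j" "j \<le> CARD('n)"
    and z_cont: "continuous_on (closure \<Omega>) z"
    and z_sol: "visc_sol \<Omega> (\<lambda>x r p M. - eigval j M) z"
    and z_bd: "\<forall>x\<in>frontier \<Omega>. z x = g x"
    and z_C1: "C1_closure \<Omega> z"
    and u0_C1: "C1_closure \<Omega> u0"
    and u0_bd: "\<forall>x\<in>frontier \<Omega>. u0 x = g x"
    and mu: "\<mu>1 > 0"
    and psi_cont: "continuous_on (closure \<Omega>) \<psi>1"
    and psi_pos: "\<forall>x\<in>\<Omega>. \<psi>1 x > 0"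
    and psi_bd: "\<forall>x\<in>frontier \<Omega>. \<psi>1 x = 0"
    and psi_sol: "visc_sol \<Omega> (\<lambda>x r p M. - eigval CARD('n) M - \<mu>1 * r) \<psi>1"
    and u_cont: "continuous_on (closure \<Omega> \<times> {0..}) (\<lambda>(x,t). u x t)"
    and u_sol: "pvisc_sol \<Omega> (\<lambda>x t r pt p M. pt - eigval j M) u"
    and u_bd: "\<forall>x\<in>frontier \<Omega>. \<forall>t>0. u x t = g x"
    and u_init: "\<forall>x\<in>closure \<Omega>. u x 0 = u0 x"
  shows "\<exists>C1 C2. C1 > 0 \<and> C2 > 0 \<and>
           (\<forall>x\<in>\<Omega>. \<forall>t>0.
              z x + C1 * exp (- \<mu>1 * t) * (- \<psi>1 x) \<le> u x t \<and>
              u x t \<le> z x + C2 * exp (- \<mu>1 * t) * \<psi>1 x)"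
proof -
  have \<Omega>: "open \<Omega>" "\<Omega> \<noteq> {}" using dom by (simp_all add: domain_def)
  have conv: "convex \<Omega>" by (rule strictly_convex_set_imp_convex[OF sconv])
  have psi_super: "visc_super \<Omega> (\<lambda>x r p M. - eigval CARD('n) M - \<mu>1 * r) \<psi>1"
    using psi_sol by (simp add: visc_sol_def)
  have z_sub: "visc_sub \<Omega> (\<lambda>x r p M. - eigval j M) z"
    and z_super: "visc_super \<Omega> (\<lambda>x r p M. - eigval j M) z"
    using z_sol by (simp_all add: visc_sol_def)
  have u_sub: "pvisc_sub \<Omega> (\<lambda>x t r pt p M. pt - eigval j M) u"
    and u_super: "pvisc_super \<Omega> (\<lambda>x t r pt p M. pt - eigval j M) u"
    using u_sol by (simp_all add: pvisc_sol_def)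
  obtain L1 where L1: "L1-lipschitz_on (closure \<Omega>) u0" by (rule C1_closure_lipschitz[OF u0_C1 conv bdd])
  obtain L2 where L2: "L2-lipschitz_on (closure \<Omega>) z" by (rule C1_closure_lipschitz[OF z_C1 conv bdd])
  have lip: "(L1 + L2)-lipschitz_on (closure \<Omega>) (\<lambda>x. u0 x - z x)" by (rule lipschitz_on_diff[OF L1 L2])
  have bd0: "\<forall>x\<in>frontier \<Omega>. u0 x - z x = 0" using u0_bd z_bd by simp
  \<comment> \<open>One constant bounds \<open>u0 - z\<close> from both sides and serves as
    \<open>C1\<close> and as \<open>C2\<close>.\<close>
  obtain C where C: "0 < C" "\<forall>x\<in>\<Omega>. \<bar>u0 x - z x\<bar> \<le> C * \<psi>1 x"
    by (rule lipschitz_bounded_by_concave[OF \<Omega>(1) conv bdd \<Omega>(2)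
        eigenfunction_concave[OF psi_super \<Omega>(1) conv less_imp_le[OF mu] psi_pos] psi_pos lip bd0])
  have cl: "x \<in> \<Omega> \<or> x \<in> frontier \<Omega>" if "x \<in> closure \<Omega>" for x
    using that \<Omega>(1) by (auto simp: frontier_def interior_open)
  have psi_nonneg: "0 \<le> \<psi>1 x" if "x \<in> closure \<Omega>" for x
    using cl[OF that] psi_pos psi_bd by (auto intro: less_imp_le)
  have init: "\<bar>u x 0 - z x\<bar> \<le> C * \<psi>1 x" if "x \<in> closure \<Omega>" for x
    using cl[OF that] C(2) bd0 psi_bd bspec[OF u_init that] by auto
  have supp: "\<exists>p. \<exists>e>0. \<forall>h. norm h < e \<longrightarrow> \<psi>1 (x + h) \<le> \<psi>1 x + p \<bullet> h - c * (norm h)\<^sup>2"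
    if "x \<in> \<Omega>" "2 * c < \<mu>1 * \<psi>1 x" for x c
    by (rule eigenfunction_semiconcave_support[OF psi_super \<Omega>(1) that])
  note ell = degenerate_elliptic_eigval[OF j]
  have upper: "u x t \<le> z x + C * exp (- \<mu>1 * t) * \<psi>1 x" if "x \<in> \<Omega>" "0 < t" for x t
  proof (rule parabolic_upper_bound[OF \<Omega>(1) bdd ell z_cont psi_cont u_cont _ _ supp psi_nonneg _ _ C(1) that])
    show "eigval j (- matrix B) \<le> 0" if "x \<in> \<Omega>" "upper_jet (\<lambda>x. - z x) x a B" for x a B
      using visc_super_upper_jet[where G = "\<lambda>x r l. - l", OF z_super ell that] by simp
    show "\<alpha> \<le> eigval j (matrix (\<lambda>k. fst (B (k, 0))))"
      if "x \<in> \<Omega>" "0 < t" "upper_jet (\<lambda>(x, t). u x t) (x, t) (a, \<alpha>) B" for x t a \<alpha> B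
      by (rule pvisc_sub_upper_jet[OF u_sub ell that])
    show "u x t \<le> z x" if "x \<in> frontier \<Omega>" "0 < t" for x t
      using u_bd z_bd that by simp
    show "u x 0 \<le> z x + C * \<psi>1 x" if "x \<in> closure \<Omega>" for x
      using init[OF that] by linarith
  qed
  \<comment> \<open>The upper bound for \<open>- u\<close> and \<open>- z\<close> with the reflected
    operator; the subsolution property of \<open>z\<close> now takes the place of the supersolution
    property.\<close>
  have lower: "- u x t \<le> - z x + C * exp (- \<mu>1 * t) * \<psi>1 x" if "x \<in> \<Omega>" "0 < t" for x t
  proof (rule parabolic_upper_bound[where u = "\<lambda>x t. - u x t" and z = "\<lambda>x. - z x",
        OF \<Omega>(1) bdd degenerate_elliptic_reflect[OF ell] continuous_on_minus[OF z_cont] psi_cont _ _ _ supp psi_nonneg _ _ C(1) that])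
    show "continuous_on (closure \<Omega> \<times> {0..}) (\<lambda>(x, t). - u x t)"
      using continuous_on_minus[OF u_cont] by (simp add: case_prod_unfold)
    show "- eigval j (- (- matrix B)) \<le> 0" if "x \<in> \<Omega>" "upper_jet (\<lambda>x. - (- z x)) x a B" for x a B
      using visc_sub_upper_jet[where G = "\<lambda>x r l. - l", OF z_sub ell that(1)] that(2) by simp
    have "pvisc_sub \<Omega> (\<lambda>x t r pt p M. pt - (- eigval j (- M))) (\<lambda>x t. - u x t)"
      by (rule pvisc_super_imp_sub_reflect[OF u_super])
    from pvisc_sub_upper_jet[OF this degenerate_elliptic_reflect[OF ell]]
    show "\<alpha> \<le> - eigval j (- matrix (\<lambda>k. fst (B (k, 0))))"
      if "x \<in> \<Omega>" "0 < t" "upper_jet (\<lambda>(x, t). - u x t) (x, t) (a, \<alpha>) B" for x t a \<alpha> B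
      using that by simp
    show "- u x t \<le> - z x" if "x \<in> frontier \<Omega>" "0 < t" for x t
      using u_bd z_bd that by simp
    show "- u x 0 \<le> - z x + C * \<psi>1 x" if "x \<in> closure \<Omega>" for x
      using init[OF that] by linarith
  qed
  show ?thesis
  proof (intro exI[of _ C] conjI C(1) ballI allI impI)
    fix x and t :: real assume "x \<in> \<Omega>" "0 < t"
    from upper[OF this] lower[OF this]
    show "z x + C * exp (- \<mu>1 * t) * (- \<psi>1 x) \<le> u x t" "u x t \<le> z x + C * exp (- \<mu>1 * t) * \<psi>1 x"
      by simp_all
  qed
qed

end
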